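(* Let $n\ge5$, let $\Lambda=\{p_1,\dots,p_k\}$ be a set of $k$ distinct points of $\mathbf{S}^n$, and let $g$ be a complete metric on $\mathbf{S}^n\setminus\Lambda$, conformal to the round metric, with $Q$-curvature equal to $\frac{n(n^2-4)}{8}$. Via stereographic projection from a point not in $\Lambda$, regard $g=u^{\frac{4}{n-4}}g_{\rm eucl}$ as a metric on $\mathbf{R}^n\setminus\{p_1,\dots,p_k\}$, where $g_{\rm eucl}$ is the Euclidean metric and the images of the punctures are still denoted $p_i$. Let $\mathcal{W}_g$ be the deficiency space of $g$, and for $v,w\in\mathcal{W}_g$ define $$\omega(v,w)=\lim_{r\searrow0}\int_{\Omega_r}\big(v\,L_g(w)-w\,L_g(v)\big)\,d\mu_0,\qquad \Omega_r=\mathbf{R}^n\setminus\bigcup_{i=1}^k\mathbf{B}_r(p_i),$$ where $d\mu_0$ is the Euclidean volume element. Then $\omega$ is a symplectic form on the $2k$-dimensional vector space $\mathcal{W}_g$.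
   Context: **$Q$-curvature and linearized operator.** For a metric $g$ in dimension $n\ge 5$, $$Q_g=-\frac{1}{2(n-1)}\Delta_gR_g-\frac{2}{(n-2)^2}|\operatorname{Ric}_g|^2+\frac{n^3-4n^2+16n-16}{8(n-1)^2(n-2)^2}R_g^2 .$$ For $g=u^{\frac{4}{n-4}}g_{\rm eucl}$ the condition $Q_g=\frac{n(n^2-4)}{8}$ reads $\Delta_0^2u=\frac{n(n-4)(n^2-4)}{16}u^{\frac{n+4}{n-4}}$, where $\Delta_0$ is the Euclidean Laplacian, and the linearized (Jacobi) operator is $$L_g(v)=\Delta_0^2v-\frac{n(n+4)(n^2-4)}{16}u^{\frac{8}{n-4}}v .$$ **Delaunay solutions.** Let $\overline{\varepsilon}=\big(\frac{n(n-4)}{n^2-4}\big)^{\frac{n-4}{8}}$. For each $\varepsilon\in(0,\overline{\varepsilon}]$ there is a unique $v_\varepsilon:\mathbf{R}\to(0,\infty)$ solving $$\ddddot v-\tfrac{n(n-4)+8}{2}\ddot v+\tfrac{n^2(n-4)^2}{16}v-\tfrac{n(n-4)(n^2-4)}{16}v^{\frac{n+4}{n-4}}=0$$ and attaining its minimal value $\varepsilon$ at $t=0$; it is periodic, and constant when $\varepsilon=\overline\varepsilon$. **Emden–Fowler change of coordinates.** $\mathfrak{F}(u)(t,\theta)=e^{\frac{4-n}{2}t}u(e^{-t}\theta)$, with inverse $\mathfrak{F}^{-1}(v)(x)=|x|^{\frac{4-n}{2}}v(-\log|x|,x/|x|)$. **Asymptotic data.** It is known that for each $i$ there are a unique $\varepsilon_i\in(0,\overline\varepsilon]$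 (the asymptotic necksize at $p_i$) and $T_i\in\mathbf{R}$ such that $\mathfrak{F}(u(\cdot+p_i))(t,\theta)=v_{\varepsilon_i}(t+T_i)+\mathcal{O}(e^{-t})$ as $t\to\infty$. **Geometric Jacobi fields.** For $\varepsilon<\overline\varepsilon$ let $w_0^+(\varepsilon)=\dot v_\varepsilon$ and $w_0^-(\varepsilon)=\frac{d}{d\varepsilon}v_\varepsilon$. For $\varepsilon=\overline\varepsilon$ let $w_0^+=\sin(\sqrt\mu\,t)$, $w_0^-=\cos(\sqrt\mu\,t)$, with $\mu=\frac{\sqrt{n^4-64n+64}-(n^2-4n+8)}{4}$. **Deficiency space.** Choose $r_0>0$ so small that the balls $\mathbf{B}_{2r_0}(p_i)$ are pairwise disjoint, and fix a smooth cut-off function $\chi$ on $\mathbf{R}^n$ with $\chi(x)=1$ for $|x|<r_0$, $\chi(x)=0$ for $|x|>3r_0/2$ and $\|\nabla^m\chi\|_{\mathcal{C}^0}\le c\,r_0^{-m}$. Then $\mathcal{W}_g$ is the span of the $2k$ functions $$x\mapsto\chi(x-p_i)\,\mathfrak{F}^{-1}\big(w_0^\pm(\varepsilon_i)(\cdot+T_i)\big)(x-p_i),\qquad i=1,\dots,k .$$ *)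

theory Defs
  imports "HOL-Analysis.Analysis" "HOL-Library.Function_Algebras" "HOL-Library.Landau_Symbols"
begin

instantiation "fun" :: (type, real_vector) real_vector
begin

definition scaleR_fun :: "real \<Rightarrow> ('a \<Rightarrow> 'b) \<Rightarrow> 'a \<Rightarrow> 'b" where
  "scaleR_fun c f = (\<lambda>x. c *\<^sub>R f x)"

instance
  by standard (simp_all add: scaleR_fun_def fun_eq_iff algebra_simps)

end

definition dir_deriv :: "'a::euclidean_space \<Rightarrow> ('a \<Rightarrow> real) \<Rightarrow> 'a \<Rightarrow> real" where
  "dir_deriv b f x = frechet_derivative f (at x) b"

text \<open>For an open set \<open>S\<close> this is C-infinity: all iterated partial derivatives exist on \<open>S\<close>
  as (totally) differentiable functions.\<close>

definition smooth_on :: "'a::euclidean_space set \<Rightarrow> ('a \<Rightarrow> real) \<Rightarrow> bool" where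
  "smooth_on S f \<longleftrightarrow>
     (\<forall>bs. set bs \<subseteq> Basis \<longrightarrow> (\<forall>x\<in>S. foldr dir_deriv bs f differentiable (at x)))"

definition pd :: "'n::finite \<Rightarrow> (real^'n \<Rightarrow> real) \<Rightarrow> real^'n \<Rightarrow> real" where
  "pd i = dir_deriv (axis i 1)"

definition laplacian :: "(real^'n::finite \<Rightarrow> real) \<Rightarrow> real^'n \<Rightarrow> real" where
  "laplacian f x = (\<Sum>i\<in>UNIV. pd i (pd i f) x)"

text \<open>A metric on an open subset of \<open>real^'n\<close> is given by the matrix field \<open>G\<close> of its
  components; \<open>christoffel G k i j\<close> has the upper index \<open>k\<close>.\<close>

definition christoffel ::
  "(real^'n::finite \<Rightarrow> real^'n^'n) \<Rightarrow> 'n \<Rightarrow> 'n \<Rightarrow> 'n \<Rightarrow> real^'n \<Rightarrow> real" where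
  "christoffel G k i j x = (1/2) * (\<Sum>l\<in>UNIV. matrix_inv (G x) $ k $ l *
     (pd i (\<lambda>y. G y $ j $ l) x + pd j (\<lambda>y. G y $ i $ l) x - pd l (\<lambda>y. G y $ i $ j) x))"

definition ricci :: "(real^'n::finite \<Rightarrow> real^'n^'n) \<Rightarrow> 'n \<Rightarrow> 'n \<Rightarrow> real^'n \<Rightarrow> real" where
  "ricci G i j x =
     (\<Sum>k\<in>UNIV. pd k (christoffel G k i j) x - pd j (christoffel G k i k) x)
     + (\<Sum>k\<in>UNIV. \<Sum>l\<in>UNIV. christoffel G k k l x * christoffel G l i j x
                               - christoffel G k j l x * christoffel G l i k x)"

definition scal :: "(real^'n::finite \<Rightarrow> real^'n^'n) \<Rightarrow> real^'n \<Rightarrow> real" where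
  "scal G x = (\<Sum>i\<in>UNIV. \<Sum>j\<in>UNIV. matrix_inv (G x) $ i $ j * ricci G i j x)"

definition ricci_norm_sq :: "(real^'n::finite \<Rightarrow> real^'n^'n) \<Rightarrow> real^'n \<Rightarrow> real" where
  "ricci_norm_sq G x = (\<Sum>i\<in>UNIV. \<Sum>j\<in>UNIV. \<Sum>k\<in>UNIV. \<Sum>l\<in>UNIV.
     matrix_inv (G x) $ i $ k * matrix_inv (G x) $ j $ l * ricci G i j x * ricci G k l x)"

definition laplace_beltrami ::
  "(real^'n::finite \<Rightarrow> real^'n^'n) \<Rightarrow> (real^'n \<Rightarrow> real) \<Rightarrow> real^'n \<Rightarrow> real" where
  "laplace_beltrami G f x = (\<Sum>i\<in>UNIV. \<Sum>j\<in>UNIV. matrix_inv (G x) $ i $ j *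
     (pd i (pd j f) x - (\<Sum>k\<in>UNIV. christoffel G k i j x * pd k f x)))"

definition Q_curvature :: "(real^'n::finite \<Rightarrow> real^'n^'n) \<Rightarrow> real^'n \<Rightarrow> real" where
  "Q_curvature G x = (let n = real CARD('n) in
     - 1 / (2 * (n - 1)) * laplace_beltrami G (scal G) x
     - 2 / (n - 2)^2 * ricci_norm_sq G x
     + (n^3 - 4 * n^2 + 16 * n - 16) / (8 * (n - 1)^2 * (n - 2)^2) * (scal G x)^2)"

text \<open>The unit sphere of \<open>(real^'n) \<times> real\<close> is the \<open>n\<close>-sphere.  A \<open>(0,2)\<close>-tensor \<open>g\<close> on a subset
  of it is a function of a base point and two ambient vectors; only its values on vectors
  tangent to the sphere at the base point are ever used.\<close>

type_synonym 'n ambient = "(real^'n) \<times> real"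
type_synonym 'n tensor2 = "'n ambient \<Rightarrow> 'n ambient \<Rightarrow> 'n ambient \<Rightarrow> real"

abbreviation unit_sphere :: "('n::finite) ambient set" where
  "unit_sphere \<equiv> sphere 0 1"

text \<open>Smoothness on an open subset of the sphere is smoothness of the extension that is constant
  along rays, on the corresponding open cone.\<close>

definition smooth_on_sphere :: "('n::finite) ambient set \<Rightarrow> ('n ambient \<Rightarrow> real) \<Rightarrow> bool" where
  "smooth_on_sphere M f \<longleftrightarrow> smooth_on {y. y \<noteq> 0 \<and> sgn y \<in> M} (\<lambda>y. f (sgn y))"

definition conformal_to_round :: "('n::finite) ambient set \<Rightarrow> 'n tensor2 \<Rightarrow> bool" where
  "conformal_to_round M g \<longleftrightarrow>
     (\<exists>\<rho>. smooth_on_sphere M \<rho> \<and> (\<forall>q\<in>M. \<rho> q > 0) \<and>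
          (\<forall>q\<in>M. \<forall>X Y. X \<bullet> q = 0 \<and> Y \<bullet> q = 0 \<longrightarrow> g q X Y = \<rho> q * (X \<bullet> Y)))"

text \<open>A piecewise C1 curve can be reparametrized to be C1 by letting it come to rest at
  the corners, so C1 curves give the usual Riemannian distance.\<close>

definition riem_length :: "('n::finite) tensor2 \<Rightarrow> (real \<Rightarrow> 'n ambient) \<Rightarrow> real" where
  "riem_length g \<gamma> = integral {0..1}
     (\<lambda>t. sqrt (g (\<gamma> t) (vector_derivative \<gamma> (at t)) (vector_derivative \<gamma> (at t))))"

definition riem_dist ::
  "('n::finite) ambient set \<Rightarrow> 'n tensor2 \<Rightarrow> 'n ambient \<Rightarrow> 'n ambient \<Rightarrow> real" where
  "riem_dist M g a b = Inf {riem_length g \<gamma> | \<gamma>.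
     \<gamma> C1_differentiable_on {0..1} \<and> \<gamma> ` {0..1} \<subseteq> M \<and> \<gamma> 0 = a \<and> \<gamma> 1 = b}"

definition complete_metric_on :: "('n::finite) ambient set \<Rightarrow> 'n tensor2 \<Rightarrow> bool" where
  "complete_metric_on M g \<longleftrightarrow> Metric_space.mcomplete M (riem_dist M g)"

text \<open>\<open>inv_stereo N J\<close> is the inverse of the stereographic projection from the pole \<open>N\<close> onto the
  equatorial hyperplane orthogonal to \<open>N\<close>, which the linear isometry \<open>J\<close> identifies with
  \<open>real^'n\<close>.\<close>

definition stereo_frame ::
  "('n::finite) ambient \<Rightarrow> (real^'n \<Rightarrow> 'n ambient) \<Rightarrow> bool" where
  "stereo_frame N J \<longleftrightarrow>
     norm N = 1 \<and> linear J \<and> (\<forall>x. norm (J x) = norm x) \<and> (\<forall>x. J x \<bullet> N = 0)"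

definition inv_stereo ::
  "('n::finite) ambient \<Rightarrow> (real^'n \<Rightarrow> 'n ambient) \<Rightarrow> real^'n \<Rightarrow> 'n ambient" where
  "inv_stereo N J x = (1 / (1 + (norm x)^2)) *\<^sub>R (2 *\<^sub>R J x + ((norm x)^2 - 1) *\<^sub>R N)"

definition pullback ::
  "(real^'n::finite \<Rightarrow> 'n ambient) \<Rightarrow> 'n tensor2 \<Rightarrow> real^'n \<Rightarrow> real^'n \<Rightarrow> real^'n \<Rightarrow> real" where
  "pullback \<phi> g x X Y =
     g (\<phi> x) (frechet_derivative \<phi> (at x) X) (frechet_derivative \<phi> (at x) Y)"

definition metric_matrix ::
  "(real^'n::finite \<Rightarrow> real^'n \<Rightarrow> real^'n \<Rightarrow> real) \<Rightarrow> real^'n \<Rightarrow> real^'n^'n" where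
  "metric_matrix h x = (\<chi> i j. h x (axis i 1) (axis j 1))"

text \<open>Q-curvature is computed in stereographic charts, which together cover the sphere.\<close>

definition const_Q_curvature :: "('n::finite) ambient set \<Rightarrow> 'n tensor2 \<Rightarrow> real \<Rightarrow> bool" where
  "const_Q_curvature M g c \<longleftrightarrow>
     (\<forall>N J x. stereo_frame N J \<and> inv_stereo N J x \<in> M \<longrightarrow>
        Q_curvature (metric_matrix (pullback (inv_stereo N J) g)) x = c)"

definition eps_bar :: "nat \<Rightarrow> real" where
  "eps_bar n = (real n * (real n - 4) / ((real n)^2 - 4)) powr ((real n - 4) / 8)"

definition delaunay_solution :: "nat \<Rightarrow> real \<Rightarrow> (real \<Rightarrow> real) \<Rightarrow> bool" where
  "delaunay_solution d \<epsilon> v \<longleftrightarrow> (let n = real d in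
     (\<forall>t. v t > 0) \<and>
     (\<forall>m<4. \<forall>t. (deriv ^^ m) v differentiable (at t)) \<and>
     (\<forall>t. (deriv ^^ 4) v t - (n * (n - 4) + 8) / 2 * (deriv ^^ 2) v t
            + n^2 * (n - 4)^2 / 16 * v t
            - n * (n - 4) * (n^2 - 4) / 16 * v t powr ((n + 4) / (n - 4)) = 0) \<and>
     v 0 = \<epsilon> \<and> (\<forall>t. \<epsilon> \<le> v t))"

definition emden_fowler :: "(real^'n::finite \<Rightarrow> real) \<Rightarrow> real \<Rightarrow> real^'n \<Rightarrow> real" where
  "emden_fowler u t \<theta> = exp ((4 - real CARD('n)) / 2 * t) * u (exp (- t) *\<^sub>R \<theta>)"

definition emden_fowler_inv :: "(real \<Rightarrow> real^'n::finite \<Rightarrow> real) \<Rightarrow> real^'n \<Rightarrow> real" where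
  "emden_fowler_inv v x =
     norm x powr ((4 - real CARD('n)) / 2) * v (- ln (norm x)) (x /\<^sub>R norm x)"

text \<open>\<open>u\<close> is asymptotic at \<open>p\<close> to the Delaunay solution \<open>v\<close> translated by \<open>T\<close>; the error is
  uniform in the angular variable.\<close>

definition asymptotic_to ::
  "(real^'n::finite \<Rightarrow> real) \<Rightarrow> real^'n \<Rightarrow> (real \<Rightarrow> real) \<Rightarrow> real \<Rightarrow> bool" where
  "asymptotic_to u p v T \<longleftrightarrow>
     (\<lambda>(t, \<theta>). emden_fowler (\<lambda>x. u (x + p)) t \<theta> - v (t + T))
       \<in> O[at_top \<times>\<^sub>F principal (sphere 0 1)](\<lambda>(t, \<theta>). exp (- t))"

definition jacobi_op :: "(real^'n::finite \<Rightarrow> real) \<Rightarrow> (real^'n \<Rightarrow> real) \<Rightarrow> real^'n \<Rightarrow> real" where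
  "jacobi_op u v x = (let n = real CARD('n) in
     laplacian (laplacian v) x
     - n * (n + 4) * (n^2 - 4) / 16 * u x powr (8 / (n - 4)) * v x)"

definition mu :: "nat \<Rightarrow> real" where
  "mu d = (let n = real d in (sqrt (n^4 - 64 * n + 64) - (n^2 - 4 * n + 8)) / 4)"

text \<open>In the next two definitions \<open>V \<epsilon>\<close> is the Delaunay solution of necksize \<open>\<epsilon>\<close>.\<close>

definition w0_plus :: "nat \<Rightarrow> (real \<Rightarrow> real \<Rightarrow> real) \<Rightarrow> real \<Rightarrow> real \<Rightarrow> real" where
  "w0_plus n V \<epsilon> t =
     (if \<epsilon> = eps_bar n then sin (sqrt (mu n) * t) else deriv (V \<epsilon>) t)"

definition w0_minus :: "nat \<Rightarrow> (real \<Rightarrow> real \<Rightarrow> real) \<Rightarrow> real \<Rightarrow> real \<Rightarrow> real" where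
  "w0_minus n V \<epsilon> t =
     (if \<epsilon> = eps_bar n then cos (sqrt (mu n) * t) else deriv (\<lambda>e. V e t) \<epsilon>)"

definition cutoff :: "real \<Rightarrow> (real^'n::finite \<Rightarrow> real) \<Rightarrow> bool" where
  "cutoff r0 \<eta> \<longleftrightarrow> smooth_on UNIV \<eta> \<and>
     (\<forall>x. norm x < r0 \<longrightarrow> \<eta> x = 1) \<and> (\<forall>x. norm x > 3 * r0 / 2 \<longrightarrow> \<eta> x = 0) \<and>
     (\<forall>m. \<exists>c. \<forall>bs x. set bs \<subseteq> Basis \<and> length bs = m \<longrightarrow> \<bar>foldr dir_deriv bs \<eta> x\<bar> \<le> c / r0^m)"

definition local_field ::
  "(real^'n::finite \<Rightarrow> real) \<Rightarrow> real^'n \<Rightarrow> (real \<Rightarrow> real) \<Rightarrow> real \<Rightarrow> real^'n \<Rightarrow> real" where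
  "local_field \<eta> p w T x = \<eta> (x - p) * emden_fowler_inv (\<lambda>t \<theta>. w (t + T)) (x - p)"

text \<open>The spanning functions live on the complement of \<open>P\<close>.  As total functions they all vanish
  on \<open>P\<close>, since \<open>0 powr a = 0\<close> and the supports of cut-offs at different points
  are disjoint; so this is the same vector space.\<close>

definition deficiency_space ::
  "(real \<Rightarrow> real \<Rightarrow> real) \<Rightarrow> (real^'n::finite) set \<Rightarrow> (real^'n \<Rightarrow> real) \<Rightarrow> (real^'n \<Rightarrow> real) \<Rightarrow>
   (real^'n \<Rightarrow> real) \<Rightarrow> (real^'n \<Rightarrow> real) set" where
  "deficiency_space V P \<epsilon> T \<eta> = span
     ((\<lambda>p. local_field \<eta> p (w0_plus CARD('n) V (\<epsilon> p)) (T p)) ` P \<union>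
      (\<lambda>p. local_field \<eta> p (w0_minus CARD('n) V (\<epsilon> p)) (T p)) ` P)"

definition perforated_space :: "(real^'n::finite) set \<Rightarrow> real \<Rightarrow> (real^'n) set" where
  "perforated_space P r = - (\<Union>p\<in>P. ball p r)"

definition green_integrand ::
  "(real^'n::finite \<Rightarrow> real) \<Rightarrow> (real^'n \<Rightarrow> real) \<Rightarrow> (real^'n \<Rightarrow> real) \<Rightarrow> real^'n \<Rightarrow> real" where
  "green_integrand u v w x = v x * jacobi_op u w x - w x * jacobi_op u v x"

definition green_integral ::
  "(real^'n::finite) set \<Rightarrow> (real^'n \<Rightarrow> real) \<Rightarrow> (real^'n \<Rightarrow> real) \<Rightarrow> (real^'n \<Rightarrow> real) \<Rightarrow> real \<Rightarrow> real"
  where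
  "green_integral P u v w r = (LINT x:perforated_space P r|lborel. green_integrand u v w x)"

definition omega_form ::
  "(real^'n::finite) set \<Rightarrow> (real^'n \<Rightarrow> real) \<Rightarrow> (real^'n \<Rightarrow> real) \<Rightarrow> (real^'n \<Rightarrow> real) \<Rightarrow> real" where
  "omega_form P u v w = Lim (at_right 0) (green_integral P u v w)"

definition symplectic_form_on :: "'v::real_vector set \<Rightarrow> ('v \<Rightarrow> 'v \<Rightarrow> real) \<Rightarrow> bool" where
  "symplectic_form_on W \<omega> \<longleftrightarrow> subspace W \<and>
     (\<forall>x\<in>W. \<forall>y\<in>W. \<forall>z\<in>W. \<forall>a b. \<omega> (a *\<^sub>R x + b *\<^sub>R y) z = a * \<omega> x z + b * \<omega> y z) \<and>
     (\<forall>x\<in>W. \<forall>y\<in>W. \<forall>z\<in>W. \<forall>a b. \<omega> z (a *\<^sub>R x + b *\<^sub>R y) = a * \<omega> z x + b * \<omega> z y) \<and>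
     (\<forall>x\<in>W. \<omega> x x = 0) \<and>
     (\<forall>x\<in>W. (\<forall>y\<in>W. \<omega> x y = 0) \<longrightarrow> x = 0)"

end

theory Submission
  imports Defs
begin

text \<open>
The potential terms of \<open>v L(w) - w L(v)\<close> cancel, so the form \<open>\<omega>\<close> only sees the bilaplacian, and
\<open>v \<Delta>\<^sup>2 w - w \<Delta>\<^sup>2 v\<close> is a divergence. Near a puncture \<open>p\<close> the elements of the deficiency space are
\<open>|x - p|\<^sup>-\<^sup>a f(- log |x - p|)\<close> with \<open>a = (n - 4) / 2\<close>, where \<open>f\<close> solves a linear fourth-order equation
\<open>f'''' - A f'' + B f = q f\<close> whose potential \<open>q\<close> is the same for all of them. There the divergence
vanishes, so the integral over the perforated space does not depend on the radius of small holes, and it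
equals the sum over the punctures of a positive constant times the pairing
\<open>f g''' - f' g'' + f'' g' - f''' g - A (f g' - f' g)\<close>, which is constant along solutions
(\<open>green_formula\<close>). Functions attached to different punctures do not interact, so \<open>\<omega>\<close> is block
diagonal with blocks of size two. Everything reduces to one fact: the pairing of \<open>w\<^sub>0\<^sup>+\<close> and
\<open>w\<^sub>0\<^sup>-\<close> is not zero (\<open>geometric_jacobi_fields\<close>). Linear algebra does the rest, and nondegeneracy
also yields the dimension (\<open>symplectic_form_of_weights\<close>).

For the cylinder, of necksize \<open>\<epsilon>bar\<close>, the two fields are explicit. For smaller necksizes even the
existence of \<open>d/d\<epsilon> v\<^sub>\<epsilon>\<close> has to be proved, because \<open>v\<^sub>\<epsilon>\<close> is only characterised as a positive solution
with minimum \<open>\<epsilon>\<close> at \<open>0\<close>. The tool is a comparison principle. The linear part of the equation factors as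
\<open>(\<partial>\<^sup>2 - \<lambda>) (\<partial>\<^sup>2 - \<mu>)\<close> with \<open>\<lambda>, \<mu> > 0\<close>, so the difference \<open>w\<close> of two solutions remains in the cone
\<open>w, w', w'' - \<lambda> w, (w'' - \<lambda> w)' \<ge> 0\<close> once it is there; the nonlinearity then drives it to infinity in
finite time (\<open>solutions_cannot_separate\<close>). Hence a global nonnegative solution is determined by its
value and its slope at one point (\<open>solution_eqI\<close>), and reflection makes \<open>v\<^sub>\<epsilon>\<close> even about each of its
critical points, thus periodic. In the linearized equation the same cone shows that a nonzero solution which
vanishes to first order at a point cannot grow at most linearly in both directions (\<open>driven_growth\<close>).

The comparison also bounds \<open>v\<^sub>\<epsilon>''(0)\<close> and makes it Lipschitz in \<open>\<epsilon>\<close>. The difference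
quotients in \<open>\<epsilon>\<close> are therefore precompact, every limit is an even solution of the linearized equation
with value \<open>1\<close> at \<open>0\<close>, and it has linear growth because the period of \<open>v\<^sub>\<epsilon>\<close> is Lipschitz as
well. Only one such solution exists, so the quotients converge (\<open>necksize_derivative\<close>).

Finally let \<open>\<phi> = d/d\<epsilon> v\<^sub>\<epsilon>\<close>. The Wronskian of \<open>v'\<close> and \<open>\<phi>\<close> has no zero, by the growth lemma. If the
pairing of \<open>v'\<close> and \<open>\<phi>\<close> were zero, the linearized operator would factor as \<open>T\<^sup>* T\<close>, where \<open>T\<close> is the
second-order operator that annihilates both. Integration by parts over half a period would make the
quadratic form of the linearized operator nonnegative at \<open>v\<close> itself, where it is negative since the
nonlinearity is superlinear (\<open>symplectic_pairing_nonzero\<close>).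
\<close>

section \<open>Towers of derivatives and first-exit arguments\<close>

text \<open>Solutions are handled together with their derivatives: \<open>f i\<close> is the \<open>i\<close>-th derivative of \<open>f 0\<close>. Four
steps suffice for a fourth-order equation, and \<open>f 4\<close> need not be differentiable.\<close>

definition tower :: "(nat \<Rightarrow> real \<Rightarrow> real) \<Rightarrow> bool" where
  "tower f \<longleftrightarrow> (\<forall>i<4. \<forall>t. (f i has_real_derivative f (Suc i) t) (at t))"

text \<open>The derivatives of \<open>t \<mapsto> f (2 s - t)\<close>. The equations below have only even-order terms, so reflection maps
solutions to solutions.\<close>

definition reflect :: "real \<Rightarrow> (nat \<Rightarrow> real \<Rightarrow> real) \<Rightarrow> nat \<Rightarrow> real \<Rightarrow> real" where
  "reflect s f = (\<lambda>i t. (- 1) ^ i * f i (2 * s - t))"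

lemma less_4_cases: "i < (4::nat) \<longleftrightarrow> i = 0 \<or> i = 1 \<or> i = 2 \<or> i = 3"
  by auto

lemma tower_derivs:
  assumes "tower f"
  shows "(f 0 has_real_derivative f 1 t) (at t)" "(f 1 has_real_derivative f 2 t) (at t)"
    "(f 2 has_real_derivative f 3 t) (at t)" "(f 3 has_real_derivative f 4 t) (at t)"
  using assms unfolding tower_def less_4_cases by (auto simp: eval_nat_numeral)

lemma towerI:
  assumes "\<And>t. (f 0 has_real_derivative f 1 t) (at t)" "\<And>t. (f 1 has_real_derivative f 2 t) (at t)"
    "\<And>t. (f 2 has_real_derivative f 3 t) (at t)" "\<And>t. (f 3 has_real_derivative f 4 t) (at t)"
  shows "tower f"
  unfolding tower_def less_4_cases using assms by (auto simp: eval_nat_numeral)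

lemma tower_continuous: "tower f \<Longrightarrow> i < 4 \<Longrightarrow> continuous_on S (f i)"
  unfolding tower_def by (meson DERIV_isCont continuous_at_imp_continuous_on)

lemma tower_lincomb:
  assumes "tower f" "tower g"
  shows "tower (\<lambda>i t. a * f i t + b * g i t)"
  using assms unfolding tower_def by (auto intro!: derivative_eq_intros)

lemma tower_diff: "tower f \<Longrightarrow> tower g \<Longrightarrow> tower (\<lambda>i t. f i t - g i t)"
  using tower_lincomb[of f g 1 "-1"] by simp

lemma tower_reflect:
  assumes "tower f" shows "tower (reflect s f)"
  unfolding tower_def reflect_def
proof (intro allI impI)
  fix i :: nat and t :: real assume i: "i < 4"
  have "(f i has_real_derivative f (Suc i) (2 * s - t)) (at (2 * s - t))"
    using assms i unfolding tower_def by blast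
  moreover have "((\<lambda>t. 2 * s - t) has_real_derivative - 1) (at t)"
    by (auto intro!: derivative_eq_intros)
  ultimately have "((\<lambda>t. f i (2 * s - t)) has_real_derivative f (Suc i) (2 * s - t) * - 1) (at t)"
    by (rule DERIV_chain2)
  then show "((\<lambda>t. (- 1) ^ i * f i (2 * s - t)) has_real_derivative
      (- 1) ^ Suc i * f (Suc i) (2 * s - t)) (at t)"
    by (auto intro!: derivative_eq_intros)
qed

lemma tower_translate:
  assumes "tower f" shows "tower (\<lambda>i t. f i (t + T))"
  unfolding tower_def
proof (intro allI impI)
  fix i :: nat and t :: real assume i: "i < 4"
  have "(f i has_real_derivative f (Suc i) (t + T)) (at (t + T))"
    using assms i unfolding tower_def by blast
  then show "((\<lambda>t. f i (t + T)) has_real_derivative f (Suc i) (t + T)) (at t)"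
    by (simp add: DERIV_shift)
qed

text \<open>The boundary term of Green's formula for the operator \<open>\<partial>\<^sup>4 - A \<partial>\<^sup>2\<close> on the line.\<close>

definition symplectic_pairing :: "real \<Rightarrow> (nat \<Rightarrow> real \<Rightarrow> real) \<Rightarrow> (nat \<Rightarrow> real \<Rightarrow> real) \<Rightarrow> real \<Rightarrow> real" where
  "symplectic_pairing A f g t = f 0 t * g 3 t - f 1 t * g 2 t + f 2 t * g 1 t - f 3 t * g 0 t
     - A * (f 0 t * g 1 t - f 1 t * g 0 t)"

text \<open>At the first time at which some component vanishes, all components were positive before, hence
nondecreasing, and so the component still exceeds its initial value. All comparison arguments below, including
the Gronwall estimate, are instances.\<close>

lemma positivity_propagates:
  fixes X X' :: "'i \<Rightarrow> real \<Rightarrow> real"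
  assumes I: "finite I"
    and der: "\<And>i t. i \<in> I \<Longrightarrow> s \<le> t \<Longrightarrow> t \<le> T \<Longrightarrow> (X i has_real_derivative X' i t) (at t)"
    and init: "\<And>i. i \<in> I \<Longrightarrow> X i s > 0"
    and mono: "\<And>i t. i \<in> I \<Longrightarrow> s \<le> t \<Longrightarrow> t \<le> T \<Longrightarrow> (\<And>j. j \<in> I \<Longrightarrow> X j t > 0) \<Longrightarrow> X' i t \<ge> 0"
    and t: "s \<le> t" "t \<le> T" and i: "i \<in> I"
  shows "X i t > 0"
proof (rule ccontr)
  assume neg: "\<not> X i t > 0"
  define Z where "Z = (\<Union>j\<in>I. {r\<in>{s..T}. X j r \<le> 0})"
  have "isCont (X j) x" if "j \<in> I" "x \<in> {s..T}" for j x
    using DERIV_isCont[OF der[of j x]] that by auto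
  then have "continuous_on {s..T} (X j)" if "j \<in> I" for j
    using that by (simp add: continuous_at_imp_continuous_on)
  then have "closed {r\<in>{s..T}. X j r \<le> 0}" if "j \<in> I" for j
    using that by (intro continuous_on_closed_Collect_le) auto
  then have "closed Z" unfolding Z_def by (intro closed_UN I) auto
  moreover have "bounded Z"
    by (rule bounded_subset[of "{s..T}"]) (auto simp: Z_def)
  ultimately have "compact Z" by (simp add: compact_eq_bounded_closed)
  moreover have "Z \<noteq> {}" using neg i t unfolding Z_def by force
  ultimately obtain r where r: "r \<in> Z" "\<And>r'. r' \<in> Z \<Longrightarrow> r \<le> r'"
    using compact_attains_inf[of Z] by blast
  then obtain j where j: "j \<in> I" "s \<le> r" "r \<le> T" "X j r \<le> 0" unfolding Z_def by auto
  have before: "X k r' > 0" if "k \<in> I" "s \<le> r'" "r' < r" for k r'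
  proof (rule ccontr)
    assume "\<not> X k r' > 0"
    then have "r' \<in> Z" using that j unfolding Z_def by force
    then show False using r(2) that by force
  qed
  have "X j s \<le> X j r"
  proof (cases "s = r")
    case False
    have "\<exists>y. s < y \<and> y < r \<and> X j r - X j s = (r - s) * X' j y"
    proof -
      have "\<exists>l y. s < y \<and> y < r \<and> (X j has_real_derivative l) (at y) \<and> X j r - X j s = (r - s) * l"
      proof (rule MVT)
        show "s < r" using False j by auto
        have "isCont (X j) x" if "x \<in> {s..r}" for x
          using DERIV_isCont[OF der[of j x]] that j by auto
        then show "continuous_on {s..r} (X j)" by (simp add: continuous_at_imp_continuous_on)
        show "X j differentiable at x" if "s < x" "x < r" for x
          using der[of j x] that j real_differentiable_def by force
      qed
      then obtain l y where y: "s < y" "y < r" "(X j has_real_derivative l) (at y)"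
        "X j r - X j s = (r - s) * l" by blast
      then have "l = X' j y" using der[of j y] j DERIV_unique by force
      then show ?thesis using y by auto
    qed
    then obtain y where y: "s < y" "y < r" "X j r - X j s = (r - s) * X' j y" by blast
    then have "X' j y \<ge> 0" using mono[of j y] before j by auto
    then have "(r - s) * X' j y \<ge> 0" using y by simp
    then show ?thesis using y by simp
  qed simp
  then show False using init[of j] j by auto
qed

lemma mono_of_nonneg_deriv:
  fixes f f' :: "real \<Rightarrow> real"
  assumes "s \<le> t" "\<And>r. s \<le> r \<Longrightarrow> r \<le> t \<Longrightarrow> (f has_real_derivative f' r) (at r)"
    "\<And>r. s \<le> r \<Longrightarrow> r \<le> t \<Longrightarrow> f' r \<ge> 0"
  shows "f s \<le> f t"
  using DERIV_nonneg_imp_nondecreasing[of s t f] assms by blast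

lemma linear_lower_bound:
  fixes f f' :: "real \<Rightarrow> real"
  assumes "s \<le> t" "\<And>r. s \<le> r \<Longrightarrow> r \<le> t \<Longrightarrow> (f has_real_derivative f' r) (at r)"
    "\<And>r. s \<le> r \<Longrightarrow> r \<le> t \<Longrightarrow> f' r \<ge> c"
  shows "f s + c * (t - s) \<le> f t"
proof -
  have "f s - c * s \<le> f t - c * t"
    by (rule mono_of_nonneg_deriv[where f' = "\<lambda>r. f' r - c"])
      (use assms in \<open>auto intro!: derivative_eq_intros\<close>)
  then show ?thesis by (simp add: algebra_simps)
qed

text \<open>The functions \<open>M exp (\<nu> (t - s)) \<plusminus> w i t\<close> start positive, and as long as all of them are positive the
exponential grows faster than \<open>w i\<close> can.\<close>

lemma gronwall_tower:
  assumes w: "tower w" and K: "K \<ge> 0" and \<rho>: "0 \<le> \<rho>" "\<rho> \<le> M"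
    and bound: "\<And>t. s \<le> t \<Longrightarrow> t \<le> T \<Longrightarrow>
      \<bar>w 4 t\<bar> \<le> K * (\<bar>w 0 t\<bar> + \<bar>w 1 t\<bar> + \<bar>w 2 t\<bar> + \<bar>w 3 t\<bar>) + \<rho>"
    and init: "\<And>i. i < 4 \<Longrightarrow> \<bar>w i s\<bar> < M"
    and t: "s \<le> t" "t \<le> T" and i: "i < 4"
  shows "\<bar>w i t\<bar> < M * exp ((4 * K + 1) * (t - s))"
proof -
  define \<nu> where "\<nu> = 4 * K + 1"
  define e where "e r = exp (\<nu> * (r - s))" for r
  define X where "X = (\<lambda>(j, \<sigma>::real) r. M * e r + \<sigma> * w j r)"
  define X' where "X' = (\<lambda>(j, \<sigma>::real) r. \<nu> * (M * e r) + \<sigma> * w (Suc j) r)"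
  define I where "I = {0,1,2,3::nat} \<times> {1,- 1::real}"
  have M: "M > 0" using init[of 0] by auto
  have pos: "X k r > 0" if "s \<le> r" "r \<le> T" "k \<in> I" for k r
  proof (rule positivity_propagates[of I s T X X' r k])
    show "finite I" by (simp add: I_def)
    show "(X k has_real_derivative X' k r) (at r)" if kI: "k \<in> I" for k r
    proof -
      obtain j \<sigma> where k: "k = (j, \<sigma>)" "j < 4" using kI unfolding I_def by force
      have "(w j has_real_derivative w (Suc j) r) (at r)" using w k unfolding tower_def by blast
      then show ?thesis unfolding X_def X'_def e_def k
        by (auto intro!: derivative_eq_intros)
    qed
    show "X k s > 0" if kI: "k \<in> I" for k
    proof -
      obtain j \<sigma> where k: "k = (j, \<sigma>)" "j < 4" "\<sigma> = 1 \<or> \<sigma> = - 1" using kI unfolding I_def by force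
      then show ?thesis using init[of j] unfolding X_def e_def by (auto simp: abs_less_iff)
    qed
    show "X' k r \<ge> 0" if k: "k \<in> I" and r: "s \<le> r" "r \<le> T" and P: "\<And>k. k \<in> I \<Longrightarrow> X k r > 0" for k r
    proof -
      have er: "e r \<ge> 1" using r K unfolding e_def \<nu>_def by simp
      have Me: "M * e r \<ge> M" "M * e r > 0" using M er by (auto simp: mult_le_cancel_left1)
      have small: "\<bar>w j r\<bar> < M * e r" if "j < 4" for j
      proof -
        have "(j, 1) \<in> I" "(j, - 1) \<in> I" using that unfolding I_def less_4_cases by auto
        then have "X (j, 1) r > 0" "X (j, - 1) r > 0" by (auto intro: P)
        then show ?thesis by (auto simp: X_def abs_less_iff)
      qed
      have last: "\<bar>w 4 r\<bar> \<le> \<nu> * (M * e r)"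
      proof -
        have "\<bar>w 4 r\<bar> \<le> K * (4 * (M * e r)) + \<rho>"
          using bound[OF r] small[of 0] small[of 1] small[of 2] small[of 3] K
            mult_left_mono[of "\<bar>w 0 r\<bar> + \<bar>w 1 r\<bar> + \<bar>w 2 r\<bar> + \<bar>w 3 r\<bar>" "4 * (M * e r)" K]
          by auto
        also have "\<dots> \<le> \<nu> * (M * e r)" using \<rho> Me unfolding \<nu>_def by (simp add: algebra_simps)
        finally show ?thesis .
      qed
      have "\<bar>w (Suc j) r\<bar> \<le> \<nu> * (M * e r)" if "j < 4" for j
      proof (cases "j = 3")
        case True then show ?thesis using last by simp
      next
        case False
        then have "\<bar>w (Suc j) r\<bar> < M * e r" using small[of "Suc j"] that by auto
        also have "M * e r \<le> \<nu> * (M * e r)" using Me K unfolding \<nu>_def by (simp add: algebra_simps)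
        finally show ?thesis by simp
      qed
      then have "- (\<nu> * (M * e r)) \<le> w (Suc j) r \<and> w (Suc j) r \<le> \<nu> * (M * e r)" if "j < 4" for j
        using that by (meson abs_le_D1 abs_le_D2 minus_le_iff)
      then have "0 \<le> \<nu> * (M * e r) + w (Suc j) r \<and> 0 \<le> \<nu> * (M * e r) - w (Suc j) r" if "j < 4" for j
        using that by (smt (verit))
      moreover obtain j \<sigma> where "k = (j, \<sigma>)" "j < 4" "\<sigma> = 1 \<or> \<sigma> = - 1" using k unfolding I_def by force
      ultimately show ?thesis unfolding X'_def by auto
    qed
  qed (use that in auto)
  have "(i, 1) \<in> I" "(i, - 1) \<in> I" using i unfolding I_def less_4_cases by auto
  then have "X (i, 1) t > 0" "X (i, - 1) t > 0" using pos t by auto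
  then show ?thesis by (auto simp: X_def e_def \<nu>_def abs_less_iff)
qed

text \<open>The function \<open>c (E - t)\<^sup>-\<^sup>m\<close> with \<open>m = 4 / (p - 1)\<close> solves \<open>u'''' = C u\<^sup>p\<close> for a suitable \<open>c\<close> and blows
up at \<open>E\<close>. If \<open>E\<close> is late enough then \<open>u\<close> starts below \<open>w\<close> together with its derivatives,
and \<open>w\<close> stays above it up to the time \<open>E\<close>.\<close>

lemma no_global_blowup:
  assumes w: "tower w" and C: "C > 0" and p: "p > (1::real)"
    and pos: "\<And>i. i < 4 \<Longrightarrow> w i s > 0"
    and ineq: "\<And>t. t \<ge> s \<Longrightarrow> w 0 t \<ge> 0 \<Longrightarrow> w 4 t \<ge> C * w 0 t powr p"
  shows False
proof -
  define m where "m = 4 / (p - 1)"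
  have m: "m > 0" using p by (simp add: m_def)
  define c where "c = (pochhammer m 4 / C) powr (1 / (p - 1))"
  have poch: "pochhammer m i > 0" for i using m by (simp add: pochhammer_pos)
  have c: "c > 0" using poch[of 4] C by (simp add: c_def)
  have cp: "c * pochhammer m 4 = C * c powr p"
  proof -
    have "c powr (p - 1) = pochhammer m 4 / C"
      using p poch[of 4] C by (simp add: c_def powr_powr)
    moreover have "c powr p = c powr (p - 1) * c" using c by (simp add: powr_diff)
    ultimately show ?thesis using C by simp
  qed
  have "\<forall>\<^sub>F L in at_top. \<forall>i\<in>{..<4}. c * pochhammer m i * L powr (- m - real i) < w i s"
  proof (intro eventually_ball_finite ballI)
    fix i :: nat assume i: "i \<in> {..<4}"
    have "((\<lambda>L::real. L powr (- m - real i)) \<longlongrightarrow> 0) at_top"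
      by (rule tendsto_neg_powr) (use m in \<open>auto intro: filterlim_ident\<close>)
    then have "((\<lambda>L::real. c * pochhammer m i * L powr (- m - real i)) \<longlongrightarrow> 0) at_top"
      by (rule tendsto_mult_right_zero)
    then show "\<forall>\<^sub>F L in at_top. c * pochhammer m i * L powr (- m - real i) < w i s"
      by (rule order_tendstoD) (use pos i in auto)
  qed simp
  then have "\<forall>\<^sub>F L in at_top. L > 0 \<and> (\<forall>i\<in>{..<4}. c * pochhammer m i * L powr (- m - real i) < w i s)"
    by (intro eventually_conj eventually_gt_at_top)
  then obtain L where L: "L > 0" "\<And>i. i < 4 \<Longrightarrow> c * pochhammer m i * L powr (- m - real i) < w i s"
    by (auto dest!: eventually_happens)
  define E where "E = s + L"
  define U where "U i t = c * pochhammer m i * (E - t) powr (- m - real i)" for i t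
  have U': "(U i has_real_derivative U (Suc i) t) (at t)" if "t < E" for i t
    unfolding U_def using that
    by (auto intro!: derivative_eq_intros simp: pochhammer_Suc algebra_simps)
  have U4: "U 4 t = C * U 0 t powr p" if "t < E" for t
  proof -
    have "U 0 t powr p = c powr p * (E - t) powr (- m * p)"
      unfolding U_def using that c by (simp add: powr_mult powr_powr)
    moreover have "- m * p = - m - 4" using p by (simp add: m_def field_simps)
    ultimately show ?thesis unfolding U_def using cp by simp
  qed
  have ahead: "w 0 t > U 0 t" if t: "s \<le> t" "t < E" for t
  proof -
    define X where "X i r = w i r - U i r" for i r
    have "X 0 t > 0"
    proof (rule positivity_propagates[of "{..<4}" s t X "\<lambda>i. X (Suc i)" t 0])
      show "(X i has_real_derivative X (Suc i) r) (at r)" if "i \<in> {..<4}" "r \<le> t" for i r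
        using that w t unfolding X_def tower_def
        by (auto intro!: derivative_eq_intros U')
      show "X i s > 0" if "i \<in> {..<4}" for i
        using L(2)[of i] that unfolding X_def U_def E_def by auto
      show "X (Suc i) r \<ge> 0" if i: "i \<in> {..<4}" and r: "s \<le> r" "r \<le> t"
        and P: "\<And>j. j \<in> {..<4} \<Longrightarrow> X j r > 0" for i r
      proof (cases "i = 3")
        case True
        have "U 0 r \<ge> 0" unfolding U_def using c by simp
        moreover have "w 0 r > U 0 r" using P[of 0] unfolding X_def by auto
        ultimately have "C * U 0 r powr p \<le> C * w 0 r powr p" "w 0 r \<ge> 0"
          using C p by (auto intro!: mult_left_mono powr_mono2)
        then have "U 4 r \<le> w 4 r" using U4[of r] ineq[of r] r t by auto
        then show ?thesis using True by (simp add: X_def)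
      next
        case False
        then show ?thesis using P[of "Suc i"] i by auto
      qed
    qed (use t in auto)
    then show ?thesis by (simp add: X_def)
  qed
  have "compact (w 0 ` {s..E})"
    by (intro compact_continuous_image tower_continuous[OF w]) auto
  then obtain b where b: "\<And>t. t \<in> {s..E} \<Longrightarrow> \<bar>w 0 t\<bar> \<le> b"
    using bounded_real compact_imp_bounded by (metis image_eqI)
  have b0: "b \<ge> 0" using b[of s] L E_def by force
  \<comment> \<open>A time before \<open>E\<close> at which the subsolution exceeds the bound of \<open>w 0\<close>.\<close>
  define x where "x = min L (((b + 1) / c) powr (- 1 / m))"
  have x: "0 < x" "x \<le> L" using L b0 c by (auto simp: x_def)
  have "(((b + 1) / c) powr (- 1 / m)) powr (- m) \<le> x powr (- m)"
    using x m by (intro powr_mono2') (auto simp: x_def)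
  moreover have "(((b + 1) / c) powr (- 1 / m)) powr (- m) = (b + 1) / c"
    using m b0 c by (simp add: powr_powr)
  ultimately have "(b + 1) / c \<le> x powr (- m)" by simp
  then have "b + 1 \<le> c * x powr (- m)" using c by (simp add: pos_divide_le_eq mult.commute)
  also have "\<dots> = U 0 (E - x)" by (simp add: U_def)
  also have "\<dots> < w 0 (E - x)" using x by (intro ahead) (auto simp: E_def)
  also have "\<dots> \<le> b" using b[of "E - x"] x by (auto simp: E_def)
  finally show False by simp
qed

section \<open>Comparison for factored fourth-order equations\<close>

text \<open>The mean value theorem in a form that covers \<open>x = y\<close> and the endpoint \<open>0\<close>.\<close>

lemma powr_difference_quotient:
  fixes x y p :: real
  assumes p: "p > 1" and xy: "0 \<le> x" "0 \<le> y"
  shows "\<exists>\<xi>. min x y \<le> \<xi> \<and> \<xi> \<le> max x y \<and> x powr p - y powr p = p * \<xi> powr (p - 1) * (x - y)"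
proof -
  have *: "\<exists>\<xi>. a \<le> \<xi> \<and> \<xi> \<le> b \<and> b powr p - a powr p = p * \<xi> powr (p - 1) * (b - a)"
    if ab: "0 \<le> a" "a < b" for a b :: real
  proof -
    have "\<exists>l z. a < z \<and> z < b \<and> ((\<lambda>x. x powr p) has_real_derivative l) (at z) \<and>
      b powr p - a powr p = (b - a) * l"
    proof (rule MVT)
      show "continuous_on {a..b} (\<lambda>x. x powr p)"
        using p ab by (intro continuous_on_powr') (auto intro!: continuous_intros)
      show "(\<lambda>x. x powr p) differentiable at z" if "a < z" "z < b" for z
        using that ab has_real_derivative_powr[of z p] by (auto simp: real_differentiable_def)
    qed (use ab in auto)
    then obtain l z where z: "a < z" "z < b" "((\<lambda>x. x powr p) has_real_derivative l) (at z)"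
      "b powr p - a powr p = (b - a) * l" by blast
    then have "l = p * z powr (p - 1)"
      using ab has_real_derivative_powr[of z p] DERIV_unique by force
    then show ?thesis using z by (intro exI[of _ z]) auto
  qed
  consider "x = y" | "x < y" | "y < x" by linarith
  then show ?thesis
  proof cases
    case 1 then show ?thesis by auto
  next
    case 2
    then obtain \<xi> where "x \<le> \<xi>" "\<xi> \<le> y" "y powr p - x powr p = p * \<xi> powr (p - 1) * (y - x)"
      using *[of x y] xy by auto
    then show ?thesis using 2 by (intro exI[of _ \<xi>]) (auto simp: algebra_simps)
  next
    case 3
    then show ?thesis using *[of y x] xy by auto
  qed
qed

lemma powr_superadditive:
  fixes x y p :: real
  assumes p: "p > 1" and xy: "0 \<le> y" "y \<le> x"
  shows "(x - y) powr p \<le> x powr p - y powr p"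
proof -
  have split: "z powr p = z * z powr (p - 1)" if "z \<ge> 0" for z :: real
    using that p by (cases "z = 0") (auto simp: powr_diff)
  have "(x - y) * (x - y) powr (p - 1) \<le> (x - y) * x powr (p - 1)"
    using p xy by (intro mult_left_mono powr_mono2) auto
  moreover have "y * y powr (p - 1) \<le> y * x powr (p - 1)"
    using p xy by (intro mult_left_mono powr_mono2) auto
  ultimately show ?thesis using split[of x] split[of y] split[of "x - y"] xy
    by (simp add: algebra_simps)
qed

text \<open>The equation \<open>v'''' - A v'' + B v = C v\<^sup>p\<close>, whose linear part factors as \<open>(\<partial>\<^sup>2 - la) (\<partial>\<^sup>2 - lb)\<close>.\<close>

locale fourth_order_ode =
  fixes A B C p la lb :: real
  assumes la: "la > 0" and lb: "lb > 0" and A_eq: "A = la + lb" and B_eq: "B = la * lb"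
    and C: "C > 0" and p: "p > 1"
begin

definition solution :: "(nat \<Rightarrow> real \<Rightarrow> real) \<Rightarrow> bool" where
  "solution v \<longleftrightarrow> tower v \<and> (\<forall>t. v 0 t \<ge> 0) \<and>
     (\<forall>t. v 4 t = A * v 2 t - B * v 0 t + C * v 0 t powr p)"

text \<open>Differences of two solutions and solutions of the linearized equation have in common that they solve a
linear equation with some nonnegative, locally bounded potential \<open>q\<close>. The potential is
quantified at each time, as the comparison only uses its sign and its bounds.\<close>

definition driven :: "(nat \<Rightarrow> real \<Rightarrow> real) \<Rightarrow> bool" where
  "driven w \<longleftrightarrow> tower w \<and> (\<forall>R. \<exists>Q. \<forall>t. \<bar>t\<bar> \<le> R \<longrightarrow>
     (\<exists>q. 0 \<le> q \<and> q \<le> Q \<and> w 4 t = A * w 2 t - B * w 0 t + q * w 0 t))"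

lemma A_pos: "A > 0" and B_pos: "B > 0"
  using la lb by (auto simp: A_eq B_eq)

lemma solution_reflect: "solution v \<Longrightarrow> solution (reflect s v)"
  unfolding solution_def using tower_reflect by (auto simp: reflect_def)

lemma driven_reflect:
  assumes "driven w" shows "driven (reflect s w)"
  unfolding driven_def
proof (intro conjI allI)
  show "tower (reflect s w)" using assms tower_reflect unfolding driven_def by blast
  fix R
  obtain Q where Q: "\<And>t. \<bar>t\<bar> \<le> 2 * \<bar>s\<bar> + R \<Longrightarrow>
      \<exists>q. 0 \<le> q \<and> q \<le> Q \<and> w 4 t = A * w 2 t - B * w 0 t + q * w 0 t"
    using assms unfolding driven_def by meson
  have "\<exists>q. 0 \<le> q \<and> q \<le> Q \<and> reflect s w 4 t = A * reflect s w 2 t - B * reflect s w 0 t + q * reflect s w 0 t"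
    if "\<bar>t\<bar> \<le> R" for t
    using Q[of "2 * s - t"] that unfolding reflect_def by auto
  then show "\<exists>Q. \<forall>t. \<bar>t\<bar> \<le> R \<longrightarrow> (\<exists>q. 0 \<le> q \<and> q \<le> Q \<and>
      reflect s w 4 t = A * reflect s w 2 t - B * reflect s w 0 t + q * reflect s w 0 t)" by blast
qed

lemma driven_scale:
  assumes "driven w" shows "driven (\<lambda>i t. c * w i t)"
  unfolding driven_def
proof (intro conjI allI)
  show "tower (\<lambda>i t. c * w i t)"
    using assms tower_lincomb[of w w c 0] unfolding driven_def by simp
  fix R
  obtain Q where Q: "\<And>t. \<bar>t\<bar> \<le> R \<Longrightarrow>
      \<exists>q. 0 \<le> q \<and> q \<le> Q \<and> w 4 t = A * w 2 t - B * w 0 t + q * w 0 t"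
    using assms unfolding driven_def by meson
  have "\<exists>q. 0 \<le> q \<and> q \<le> Q \<and> c * w 4 t = A * (c * w 2 t) - B * (c * w 0 t) + q * (c * w 0 t)"
    if t: "\<bar>t\<bar> \<le> R" for t
  proof -
    obtain q where q: "0 \<le> q" "q \<le> Q" "w 4 t = A * w 2 t - B * w 0 t + q * w 0 t"
      using Q[OF t] by blast
    moreover have "c * w 4 t = A * (c * w 2 t) - B * (c * w 0 t) + q * (c * w 0 t)"
      unfolding q(3) by (simp add: algebra_simps)
    ultimately show ?thesis by blast
  qed
  then show "\<exists>Q. \<forall>t. \<bar>t\<bar> \<le> R \<longrightarrow> (\<exists>q. 0 \<le> q \<and> q \<le> Q \<and>
      c * w 4 t = A * (c * w 2 t) - B * (c * w 0 t) + q * (c * w 0 t))" by blast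
qed

lemma solution_diff_quotient:
  assumes v: "solution v" and u: "solution u" and M: "v 0 t \<le> M" "u 0 t \<le> M"
  shows "\<exists>q. 0 \<le> q \<and> q \<le> C * p * M powr (p - 1) \<and>
    v 4 t - u 4 t = A * (v 2 t - u 2 t) - B * (v 0 t - u 0 t) + q * (v 0 t - u 0 t)"
proof -
  have nn: "0 \<le> v 0 t" "0 \<le> u 0 t" using v u unfolding solution_def by auto
  obtain \<xi> where \<xi>: "min (v 0 t) (u 0 t) \<le> \<xi>" "\<xi> \<le> max (v 0 t) (u 0 t)"
    "v 0 t powr p - u 0 t powr p = p * \<xi> powr (p - 1) * (v 0 t - u 0 t)"
    using powr_difference_quotient[OF p nn] by blast
  have "\<xi> powr (p - 1) \<le> M powr (p - 1)" using \<xi> nn M p by (intro powr_mono2) auto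
  then have "C * p * \<xi> powr (p - 1) \<le> C * p * M powr (p - 1)" using C p by simp
  moreover have "v 4 t - u 4 t = A * (v 2 t - u 2 t) - B * (v 0 t - u 0 t) + C * (v 0 t powr p - u 0 t powr p)"
  proof -
    have "v 4 t = A * v 2 t - B * v 0 t + C * v 0 t powr p"
      "u 4 t = A * u 2 t - B * u 0 t + C * u 0 t powr p"
      using v u unfolding solution_def by auto
    then show ?thesis by (simp only:) (simp add: algebra_simps)
  qed
  ultimately show ?thesis using \<xi>(3) C p
    by (intro exI[of _ "C * p * \<xi> powr (p - 1)"]) auto
qed

lemma driven_solution_diff:
  assumes v: "solution v" and u: "solution u"
  shows "driven (\<lambda>i t. v i t - u i t)"
  unfolding driven_def
proof (intro conjI allI)
  have tow: "tower v" "tower u" using v u unfolding solution_def by auto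
  then show "tower (\<lambda>i t. v i t - u i t)" by (rule tower_diff)
  fix R
  have "compact ((\<lambda>t. max (v 0 t) (u 0 t)) ` {- R..R})"
    by (intro compact_continuous_image continuous_on_max tower_continuous tow) auto
  then obtain M where "\<forall>x\<in>(\<lambda>t. max (v 0 t) (u 0 t)) ` {- R..R}. \<bar>x\<bar> \<le> M"
    using compact_imp_bounded bounded_real by metis
  then have M: "v 0 t \<le> M" "u 0 t \<le> M" if "\<bar>t\<bar> \<le> R" for t
    using that by (force simp: abs_le_iff)+
  show "\<exists>Q. \<forall>t. \<bar>t\<bar> \<le> R \<longrightarrow> (\<exists>q. 0 \<le> q \<and> q \<le> Q \<and>
      v 4 t - u 4 t = A * (v 2 t - u 2 t) - B * (v 0 t - u 0 t) + q * (v 0 t - u 0 t))"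
    using solution_diff_quotient[OF v u M] by blast
qed

text \<open>With \<open>z = w'' - la w\<close> the linear equation becomes the cooperative system \<open>w'' = la w + z\<close>,
\<open>z'' = lb z + q w\<close>, and the cone says that \<open>w, w', z, z'\<close> are nonnegative.\<close>

definition in_cone :: "(nat \<Rightarrow> real \<Rightarrow> real) \<Rightarrow> real \<Rightarrow> bool" where
  "in_cone w t \<longleftrightarrow> 0 \<le> w 0 t \<and> 0 \<le> w 1 t \<and> la * w 0 t \<le> w 2 t \<and> la * w 1 t \<le> w 3 t"

text \<open>The system is cooperative, so strictly positive data stay positive. For data in the closed cone the
same argument applies after adding a multiple of \<open>exp (\<nu> t)\<close>, with \<open>\<nu>\<close> above the row sums of the system, to each of
the four functions.\<close>

lemma cone_invariant:
  assumes w: "driven w" and s: "in_cone w s" and t: "s \<le> t"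
  shows "in_cone w t"
proof -
  have tow: "tower w" using w by (simp add: driven_def)
  obtain Q0 where Q0: "\<And>r. \<bar>r\<bar> \<le> \<bar>s\<bar> + \<bar>t\<bar> \<Longrightarrow>
      \<exists>q. 0 \<le> q \<and> q \<le> Q0 \<and> w 4 r = A * w 2 r - B * w 0 r + q * w 0 r"
    using w unfolding driven_def by meson
  define Q where "Q = max Q0 0"
  have Q: "\<exists>q. 0 \<le> q \<and> q \<le> Q \<and> w 4 r = A * w 2 r - B * w 0 r + q * w 0 r"
    if "s \<le> r" "r \<le> t" for r
  proof -
    have "\<bar>r\<bar> \<le> \<bar>s\<bar> + \<bar>t\<bar>" using that by linarith
    then obtain q where "0 \<le> q" "q \<le> Q0" "w 4 r = A * w 2 r - B * w 0 r + q * w 0 r"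
      using Q0 by blast
    then show ?thesis unfolding Q_def by (intro exI[of _ q]) auto
  qed
  define \<nu> where "\<nu> = 1 + la + lb + Q"
  have pert: "- d * exp (\<nu> * (t - s)) < (if i = 0 then w 0 t else if i = 1 then w 1 t
      else if i = 2 then w 2 t - la * w 0 t else w 3 t - la * w 1 t)" if d: "d > 0" and i: "i < (4::nat)" for d i
  proof -
    define e where "e r = d * exp (\<nu> * (r - s))" for r
    define X where "X i r = e r + (if i = 0 then w 0 r else if i = 1 then w 1 r
      else if i = 2 then w 2 r - la * w 0 r else w 3 r - la * w 1 r)" for i :: nat and r
    define X' where "X' i r = \<nu> * e r + (if i = 0 then w 1 r else if i = 1 then w 2 r
      else if i = 2 then w 3 r - la * w 1 r else w 4 r - la * w 2 r)" for i :: nat and r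
    have "X i t > 0"
    proof (rule positivity_propagates[of "{..<4}" s t X X' t i])
      have e': "(e has_real_derivative \<nu> * e r) (at r)" for r
        unfolding e_def by (auto intro!: derivative_eq_intros)
      show "(X i has_real_derivative X' i r) (at r)" if "i \<in> {..<4}" for i r
        using that unfolding X_def X'_def
        by (auto intro!: derivative_eq_intros e' tower_derivs[OF tow] simp del: One_nat_def)
      show "X i s > 0" if "i \<in> {..<4}" for i
        using s d unfolding X_def in_cone_def e_def by auto
      show "X' i r \<ge> 0" if i: "i \<in> {..<4}" and r: "s \<le> r" "r \<le> t"
        and P: "\<And>j. j \<in> {..<4} \<Longrightarrow> X j r > 0" for i r
      proof -
        have e: "e r > 0" using d by (simp add: e_def)
        have P0: "w 0 r > - e r" and P1: "w 1 r > - e r" and P2: "w 2 r - la * w 0 r > - e r"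
          and P3: "w 3 r - la * w 1 r > - e r"
          using P[of 0] P[of 1] P[of 2] P[of 3] unfolding X_def by auto
        obtain q where q: "0 \<le> q" "q \<le> Q" "w 4 r = A * w 2 r - B * w 0 r + q * w 0 r"
          using Q r by blast
        have m0: "la * w 0 r \<ge> - (la * e r)" and mb: "lb * (w 2 r - la * w 0 r) \<ge> - (lb * e r)"
          using mult_left_mono[OF less_imp_le[OF P0], of la] la
            mult_left_mono[OF less_imp_le[OF P2], of lb] lb by auto
        have mq: "q * w 0 r \<ge> - (Q * e r)"
        proof -
          have "q * w 0 r \<ge> q * (- e r)" using q P0 by (intro mult_left_mono) auto
          moreover have "q * e r \<le> Q * e r" using q e by simp
          ultimately show ?thesis by simp
        qed
        have pos: "e r \<ge> 0" "la * e r \<ge> 0" "lb * e r \<ge> 0" "Q * e r \<ge> 0"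
          using e la lb by (auto simp: Q_def)
        have \<nu>e: "\<nu> * e r = e r + la * e r + lb * e r + Q * e r"
          by (simp add: \<nu>_def algebra_simps)
        have eq: "w 4 r - la * w 2 r = lb * (w 2 r - la * w 0 r) + q * w 0 r"
          using q(3) by (simp add: A_eq B_eq algebra_simps)
        consider "i = 0" | "i = 1" | "i = 2" | "i = 3" using i unfolding less_4_cases lessThan_iff by blast
        then show ?thesis
        proof cases
          case 1 then show ?thesis using P1 pos unfolding X'_def \<nu>e by simp
        next
          case 2 then show ?thesis using P2 m0 pos unfolding X'_def \<nu>e by simp
        next
          case 3 then show ?thesis using P3 pos unfolding X'_def \<nu>e by simp
        next
          case 4 then show ?thesis using mb mq pos eq unfolding X'_def \<nu>e by simp
        qed
      qed
    qed (use t i in auto)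
    then show ?thesis unfolding X_def e_def by simp
  qed
  have "0 \<le> (if i = 0 then w 0 t else if i = 1 then w 1 t
      else if i = 2 then w 2 t - la * w 0 t else w 3 t - la * w 1 t)" (is "0 \<le> ?x")
    if i: "i < (4::nat)" for i
  proof (rule field_le_epsilon)
    fix \<delta> :: real assume "\<delta> > 0"
    then have "- (\<delta> * exp (- (\<nu> * (t - s)))) * exp (\<nu> * (t - s)) < ?x"
      by (intro pert i) simp
    moreover have "- (\<delta> * exp (- (\<nu> * (t - s)))) * exp (\<nu> * (t - s)) = - \<delta>"
      by (simp only: exp_minus) simp
    ultimately show "0 \<le> ?x + \<delta>" by linarith
  qed
  from this[of 0] this[of 1] this[of 2] this[of 3] show ?thesis
    by (simp add: in_cone_def)
qed

lemma cone_nonneg: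
  assumes "driven w" "in_cone w s" "s \<le> t" "i \<le> 4"
  shows "w i t \<ge> 0"
proof -
  have c: "in_cone w t" using cone_invariant assms by blast
  obtain q where q: "0 \<le> q" "w 4 t = A * w 2 t - B * w 0 t + q * w 0 t"
    using assms(1) unfolding driven_def by (meson order_refl)
  have "w 4 t = A * (w 2 t - la * w 0 t) + la * la * w 0 t + q * w 0 t"
    using q by (simp add: A_eq B_eq algebra_simps)
  also have "\<dots> \<ge> 0"
    using c q A_pos la unfolding in_cone_def by (intro add_nonneg_nonneg mult_nonneg_nonneg) auto
  finally have 4: "w 4 t \<ge> 0" .
  have 0: "la * w 0 t \<ge> 0" "la * w 1 t \<ge> 0" using c la unfolding in_cone_def by auto
  consider "i = 0" | "i = 1" | "i = 2" | "i = 3" | "i = 4" using \<open>i \<le> 4\<close> by force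
  then show ?thesis using c 0 4 unfolding in_cone_def by cases auto
qed

text \<open>Positivity of one derivative passes down to \<open>w\<close> by integration and from there, through the equation, to
the fourth derivative and back to all the others.\<close>

lemma cone_strict:
  assumes w: "driven w" and c: "in_cone w s" and j: "j < 4" "w j s > 0" and t: "s < t" and i: "i < 4"
  shows "w i t > 0"
proof -
  have der: "(w k has_real_derivative w (Suc k) r) (at r)" if "k < 4" for k r
    using w that unfolding driven_def tower_def by blast
  have nn: "w k r \<ge> 0" if "k \<le> 4" "s \<le> r" for k r using cone_nonneg[OF w c] that by auto
  have mono: "w k s' \<le> w k r" if "k < 4" "s \<le> s'" "s' \<le> r" for k r s'
    by (rule mono_of_nonneg_deriv[where f' = "w (Suc k)"]) (use that der nn in auto)
  have step: "w k r > 0" if k: "k < 4" and pos: "\<And>r. s < r \<Longrightarrow> w (Suc k) r > 0" and r: "s < r" for k r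
  proof -
    have "w k s < w k r"
      by (rule DERIV_pos_imp_increasing_open[OF r])
        (use k der pos in \<open>auto intro!: continuous_at_imp_continuous_on DERIV_isCont\<close>)
    then show ?thesis using nn[of k s] k by simp
  qed
  have down: "w (j - d) r > 0" if "s < r" "d \<le> j" for d r
    using that
  proof (induction d arbitrary: r)
    case 0 then show ?case using mono[of j s r] j by simp
  next
    case (Suc d)
    then show ?case using step[of "j - Suc d" r] j by (simp add: Suc_diff_Suc)
  qed
  have 0: "w 0 r > 0" if "s < r" for r using down[of r j] that by simp
  have 4: "w 4 r > 0" if r: "s < r" for r
  proof -
    have c: "in_cone w r" using cone_invariant[OF w c] r by simp
    obtain q where q: "0 \<le> q" "w 4 r = A * w 2 r - B * w 0 r + q * w 0 r"
      using w unfolding driven_def by (meson order_refl)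
    have "0 < la * la * w 0 r" using 0[OF r] la by simp
    also have "\<dots> \<le> A * (w 2 r - la * w 0 r) + la * la * w 0 r + q * w 0 r"
      using c q A_pos unfolding in_cone_def by simp
    also have "\<dots> = w 4 r" using q by (simp add: A_eq B_eq algebra_simps)
    finally show ?thesis .
  qed
  have 3: "w 3 r > 0" if "s < r" for r using step[of 3 r] 4 that by simp
  have 2: "w 2 r > 0" if "s < r" for r using step[of 2 r] 3 that by (simp add: eval_nat_numeral)
  have 1: "w 1 r > 0" if "s < r" for r using step[of 1 r] 2 that by (simp add: eval_nat_numeral)
  show ?thesis using 0 1 2 3 t i unfolding less_4_cases by auto
qed

lemma driven_forward_unique:
  assumes w: "driven w" and init: "\<And>i. i < 4 \<Longrightarrow> w i s = 0" and t: "s \<le> t" and i: "i < 4"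
  shows "w i t = 0"
proof (rule ccontr)
  assume nz: "w i t \<noteq> 0"
  have c: "in_cone w s" "in_cone (\<lambda>i t. - 1 * w i t) s" using init unfolding in_cone_def by auto
  have "w i t \<ge> 0" "- 1 * w i t \<ge> 0"
    using cone_nonneg[OF w c(1) t, of i] cone_nonneg[OF driven_scale[OF w] c(2) t, of i] i by auto
  then show False using nz by simp
qed

lemma driven_unique:
  assumes w: "driven w" and init: "\<And>i. i < 4 \<Longrightarrow> w i s = 0" and i: "i < 4"
  shows "w i t = 0"
proof (cases "s \<le> t")
  case True then show ?thesis using driven_forward_unique[OF w init] i by blast
next
  case False
  have "reflect s w i (2 * s - t) = 0"
    by (rule driven_forward_unique[OF driven_reflect[OF w], of s s])
      (use False init i in \<open>auto simp: reflect_def\<close>)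
  then show ?thesis by (simp add: reflect_def)
qed

text \<open>By superadditivity of \<open>x \<mapsto> x\<^sup>p\<close> the difference \<open>w\<close> satisfies \<open>w'''' \<ge> C w\<^sup>p\<close> in the cone, so it
would blow up in finite time unless it vanishes.\<close>

lemma solutions_cannot_separate:
  assumes v: "solution v" and u: "solution u" and c: "in_cone (\<lambda>i t. v i t - u i t) s" and i: "i < 4"
  shows "v i s = u i s"
proof (rule ccontr)
  assume ne: "v i s \<noteq> u i s"
  define w where "w = (\<lambda>i t. v i t - u i t)"
  have w: "driven w" unfolding w_def by (rule driven_solution_diff[OF v u])
  have c: "in_cone w s" using c by (simp add: w_def)
  have "w i s > 0" using cone_nonneg[OF w c, of s i] i ne by (auto simp: w_def)
  then have pos: "w j (s + 1) > 0" if "j < 4" for j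
    using cone_strict[OF w c i] that by simp
  show False
  proof (rule no_global_blowup[of w C p "s + 1"])
    show "tower w" using w by (simp add: driven_def)
    fix t assume t: "s + 1 \<le> t" "0 \<le> w 0 t"
    have ct: "in_cone w t" using cone_invariant[OF w c] t by simp
    have "C * w 0 t powr p \<le> C * (v 0 t powr p - u 0 t powr p)"
      using powr_superadditive[OF p, of "u 0 t" "v 0 t"] t u C unfolding w_def solution_def by simp
    also have "\<dots> \<le> A * (w 2 t - la * w 0 t) + la * la * w 0 t + C * (v 0 t powr p - u 0 t powr p)"
      using ct A_pos la unfolding in_cone_def by simp
    also have "\<dots> = w 4 t"
    proof -
      have "v 4 t = A * v 2 t - B * v 0 t + C * v 0 t powr p"
        "u 4 t = A * u 2 t - B * u 0 t + C * u 0 t powr p"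
        using v u unfolding solution_def by auto
      then show ?thesis unfolding w_def by (simp only:) (simp add: A_eq B_eq algebra_simps)
    qed
    finally show "C * w 0 t powr p \<le> w 4 t" .
  qed (use C p pos in auto)
qed

text \<open>After exchanging the solutions and reflecting at \<open>s\<close>, the second and third derivatives of the difference
are nonnegative at \<open>s\<close>, which puts it into the cone.\<close>

lemma solution_eqI:
  assumes v: "solution v" and u: "solution u" and eq: "v 0 s = u 0 s" "v 1 s = u 1 s" and i: "i < 4"
  shows "v i t = u i t"
proof -
  have ordered: "v i t = u i t" if v: "solution v" and u: "solution u"
      and eq: "v 0 s = u 0 s" "v 1 s = u 1 s" and le: "u 2 s \<le> v 2 s" for v u
  proof -
    have "v j s = u j s" if j: "j < 4" for j
    proof (cases "u 3 s \<le> v 3 s")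
      case True
      then show ?thesis
        by (intro solutions_cannot_separate[OF v u _ j]) (use eq le in \<open>auto simp: in_cone_def\<close>)
    next
      case False
      have "reflect s v j s = reflect s u j s"
        by (rule solutions_cannot_separate[OF solution_reflect[OF v] solution_reflect[OF u] _ j])
          (use eq le False in \<open>auto simp: in_cone_def reflect_def\<close>)
      then show ?thesis by (simp add: reflect_def)
    qed
    then show ?thesis
      using driven_unique[OF driven_solution_diff[OF v u], of s i t] i by simp
  qed
  show ?thesis
  proof (cases "u 2 s \<le> v 2 s")
    case True then show ?thesis using ordered[OF v u eq] by blast
  next
    case False then show ?thesis using ordered[OF u v] eq by simp
  qed
qed

lemma solution_symmetric:
  assumes v: "solution v" and crit: "v 1 s = 0" and i: "i < 4"
  shows "v i (2 * s - t) = (- 1) ^ i * v i t"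
proof -
  have "reflect s v i t = v i t"
    by (rule solution_eqI[OF solution_reflect[OF v] v, where s = s])
      (use crit i in \<open>auto simp: reflect_def\<close>)
  then have "(- 1) ^ i * ((- 1) ^ i * v i (2 * s - t)) = (- 1) ^ i * v i t"
    by (simp add: reflect_def)
  then show ?thesis by (simp add: mult.assoc[symmetric] power_mult_distrib[symmetric])
qed

text \<open>As in \<open>solution_eqI\<close>, one may assume that \<open>w\<close> is in the cone at \<open>s\<close>. There \<open>w''\<close> is nondecreasing and,
unless \<open>w\<close> vanishes, eventually positive, which makes \<open>w\<close> grow at least quadratically.\<close>

lemma driven_growth:
  assumes w: "driven w" and init: "w 0 s = 0" "w 1 s = 0"
    and growth: "\<And>t. \<bar>w 0 t\<bar> \<le> K * (1 + \<bar>t\<bar>)" and i: "i < 4"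
  shows "w i t = 0"
proof -
  have escape: False if w: "driven w" and c: "in_cone w s" and j: "j < 4" "w j s > 0"
      and growth: "\<And>t. \<bar>w 0 t\<bar> \<le> K * (1 + \<bar>t\<bar>)" for w K j
  proof -
    have tow: "tower w" using w by (simp add: driven_def)
    have pos: "w k r > 0" if "k < 4" "s < r" for k r using cone_strict[OF w c j] that by blast
    define b where "b = w 2 (s + 1)"
    have b: "b > 0" using pos[of 2 "s + 1"] by (simp add: b_def)
    have w2: "w 2 r \<ge> b" if "s + 1 \<le> r" for r unfolding b_def
      by (rule mono_of_nonneg_deriv[where f' = "w 3"])
        (use that pos[of 3] in \<open>auto intro!: tower_derivs[OF tow] less_imp_le\<close>)
    have w1: "w 1 r \<ge> b * (r - (s + 1))" if "s + 1 \<le> r" for r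
      using linear_lower_bound[of "s + 1" r "w 1" "w 2" b] that w2 tower_derivs[OF tow]
        pos[of 1 "s + 1"] by auto
    define S where "S = s + 1 + (\<bar>K\<bar> + 1) / b"
    have S: "S > s + 1" using b by (simp add: S_def)
    have w1': "w 1 r \<ge> \<bar>K\<bar> + 1" if "S \<le> r" for r
    proof -
      have "b * (r - (s + 1)) \<ge> b * (S - (s + 1))" using that b by simp
      also have "b * (S - (s + 1)) = \<bar>K\<bar> + 1" using b by (simp add: S_def)
      finally show ?thesis using w1[of r] that S by simp
    qed
    have w0: "w 0 r \<ge> (\<bar>K\<bar> + 1) * (r - S)" if "S \<le> r" for r
      using linear_lower_bound[of S r "w 0" "w 1" "\<bar>K\<bar> + 1"] that w1' tower_derivs[OF tow]
        pos[of 0 S] S by auto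
    \<comment> \<open>A time at which slope \<open>|K| + 1\<close> has overtaken the bound \<open>K (1 + r)\<close>.\<close>
    define r where "r = \<bar>S\<bar> + (\<bar>K\<bar> + 1) * (1 + \<bar>S\<bar>)"
    have "0 \<le> (\<bar>K\<bar> + 1) * (1 + \<bar>S\<bar>)" by simp
    then have rS: "r \<ge> S" "r \<ge> 0" unfolding r_def by linarith+
    have "w 0 r \<le> K * (1 + r)" using growth[of r] rS by (simp add: abs_le_iff)
    moreover have "K * (1 + r) \<le> \<bar>K\<bar> * (1 + r)" using rS by (intro mult_right_mono) auto
    ultimately have "(\<bar>K\<bar> + 1) * (r - S) \<le> \<bar>K\<bar> * (1 + r)"
      using w0[OF rS(1)] by linarith
    then have "r \<le> \<bar>K\<bar> + (\<bar>K\<bar> + 1) * S" by (simp add: algebra_simps)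
    also have "\<dots> \<le> \<bar>K\<bar> + (\<bar>K\<bar> + 1) * \<bar>S\<bar>" by (intro add_left_mono mult_left_mono) auto
    also have "\<dots> < r" unfolding r_def by (simp add: algebra_simps)
    finally show False by simp
  qed
  have reflected: "\<bar>reflect s w 0 t\<bar> \<le> (\<bar>K\<bar> * (1 + 2 * \<bar>s\<bar>)) * (1 + \<bar>t\<bar>)" if "\<And>t. \<bar>w 0 t\<bar> \<le> K * (1 + \<bar>t\<bar>)" for w t
  proof -
    have "\<bar>reflect s w 0 t\<bar> \<le> K * (1 + \<bar>2 * s - t\<bar>)" using that by (simp add: reflect_def)
    also have "\<dots> \<le> \<bar>K\<bar> * (1 + \<bar>2 * s - t\<bar>)" by (intro mult_right_mono) auto
    also have "\<dots> \<le> \<bar>K\<bar> * ((1 + 2 * \<bar>s\<bar>) * (1 + \<bar>t\<bar>))"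
    proof (rule mult_left_mono)
      have "1 + \<bar>2 * s - t\<bar> \<le> 1 + 2 * \<bar>s\<bar> + \<bar>t\<bar>" by linarith
      also have "\<dots> \<le> (1 + 2 * \<bar>s\<bar>) * (1 + \<bar>t\<bar>)" by (simp add: algebra_simps)
      finally show "1 + \<bar>2 * s - t\<bar> \<le> (1 + 2 * \<bar>s\<bar>) * (1 + \<bar>t\<bar>)" .
    qed simp
    finally show ?thesis by (simp add: mult.assoc)
  qed
  have ordered: "w j s = 0" if w: "driven w" and init: "w 0 s = 0" "w 1 s = 0" and le: "0 \<le> w 2 s"
      and growth: "\<And>t. \<bar>w 0 t\<bar> \<le> K * (1 + \<bar>t\<bar>)" and j: "j < 4" for w j
  proof (rule ccontr)
    assume nz: "w j s \<noteq> 0"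
    show False
    proof (cases "0 \<le> w 3 s")
      case True
      have c: "in_cone w s" using True init le by (simp add: in_cone_def)
      have "w j s \<ge> 0" using cone_nonneg[OF w c, of s j] j by simp
      then have pos: "w j s > 0" using nz by simp
      show False by (rule escape[OF w c j pos growth])
    next
      case False
      have c: "in_cone (reflect s w) s" using False init le by (simp add: in_cone_def reflect_def)
      have "reflect s w j s > 0"
      proof -
        have "reflect s w j s \<ge> 0" using cone_nonneg[OF driven_reflect[OF w] c, of s j] j by simp
        moreover have "reflect s w j s \<noteq> 0" using nz by (simp add: reflect_def)
        ultimately show ?thesis by simp
      qed
      note pos = this
      have grow: "\<bar>reflect s w 0 t\<bar> \<le> (\<bar>K\<bar> * (1 + 2 * \<bar>s\<bar>)) * (1 + \<bar>t\<bar>)" for t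
        by (rule reflected) (rule growth)
      show False by (rule escape[OF driven_reflect[OF w] c j pos grow])
    qed
  qed
  have "w j s = 0" if j: "j < 4" for j
  proof (cases "0 \<le> w 2 s")
    case True then show ?thesis using ordered[OF w init True growth j] by simp
  next
    case False
    then show ?thesis using ordered[OF driven_scale[OF w, of "- 1"] _ _ _ _ j] init growth by simp
  qed
  then show ?thesis using driven_unique[OF w] i by blast
qed

end

section \<open>Shape and a priori bounds of Delaunay solutions\<close>

lemma local_decrease:
  assumes w: "tower w" and s: "w 1 s = 0" "w 2 s \<le> 0" "w 3 s = 0" "w 4 s < 0"
  shows "\<exists>d>0. \<forall>t. s < t \<and> t < s + d \<longrightarrow> w 1 t < 0"
proof -
  have fall: "f t < 0" if der: "\<And>r. (f has_real_derivative f' r) (at r)" and s: "f s \<le> 0"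
      and neg: "\<And>r. s < r \<Longrightarrow> r < t \<Longrightarrow> f' r < 0" and t: "s < t" for f f' :: "real \<Rightarrow> real" and t
  proof -
    have "f t < f s"
    proof (rule DERIV_neg_imp_decreasing_open[OF t])
      show "\<exists>y. DERIV f x :> y \<and> y < 0" if "s < x" "x < t" for x using der neg that by blast
      show "continuous_on {s..t} f"
        using DERIV_isCont[OF der] by (simp add: continuous_at_imp_continuous_on)
    qed
    then show ?thesis using s by simp
  qed
  obtain d where d: "d > 0" "\<And>h. 0 < h \<Longrightarrow> h < d \<Longrightarrow> w 3 (s + h) < w 3 s"
    using DERIV_neg_dec_right[OF tower_derivs(4)[OF w] s(4)] by blast
  have 3: "w 3 t < 0" if "s < t" "t < s + d" for t using d(2)[of "t - s"] s(3) that by simp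
  have 2: "w 2 t < 0" if t: "s < t" "t < s + d" for t
    by (rule fall[of "w 2" "w 3"]) (use t s 3 tower_derivs[OF w] in auto)
  have 1: "w 1 t < 0" if t: "s < t" "t < s + d" for t
    by (rule fall[of "w 1" "w 2"]) (use t s 2 tower_derivs[OF w] in auto)
  show ?thesis using d(1) 1 by blast
qed

text \<open>The number \<open>ebar\<close> is the positive constant solution.\<close>

locale delaunay_ode = fourth_order_ode +
  fixes ebar :: real
  assumes ebar: "ebar > 0" "C * ebar powr (p - 1) = B"
begin

text \<open>The case \<open>e = ebar\<close> is left out: the cylinder is treated by hand, and all members of the remaining
family oscillate.\<close>

definition delaunay :: "real \<Rightarrow> (nat \<Rightarrow> real \<Rightarrow> real) \<Rightarrow> bool" where
  "delaunay e v \<longleftrightarrow> 0 < e \<and> e < ebar \<and> solution v \<and> v 0 0 = e \<and> (\<forall>t. e \<le> v 0 t)"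

definition pot :: "real \<Rightarrow> real" where
  "pot x = B / 2 * x ^ 2 - C / (p + 1) * x powr (p + 1)"

text \<open>The conserved Hamiltonian of the equation, with potential \<open>pot\<close>.\<close>

definition energy :: "(nat \<Rightarrow> real \<Rightarrow> real) \<Rightarrow> real \<Rightarrow> real" where
  "energy v t = v 1 t * v 3 t - (v 2 t)^2 / 2 - A / 2 * (v 1 t)^2 + pot (v 0 t)"

lemma delaunay_tower: "delaunay e v \<Longrightarrow> tower v"
  by (simp add: delaunay_def solution_def)

lemma delaunay_pos: "delaunay e v \<Longrightarrow> v 0 t > 0"
  unfolding delaunay_def by (meson less_le_trans)

lemma delaunay_ode:
  "delaunay e v \<Longrightarrow> v 4 t = A * v 2 t - B * v 0 t + C * v 0 t powr p"
  by (simp add: delaunay_def solution_def)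

lemma pot_deriv:
  assumes x: "x > 0"
  shows "(pot has_real_derivative B * x - C * x powr p) (at x)"
proof -
  have "((\<lambda>x. B / 2 * x ^ 2 - C / (p + 1) * x powr (p + 1)) has_real_derivative
      B / 2 * (2 * x) - C / (p + 1) * ((p + 1) * x powr (p + 1 - 1))) (at x)"
    using x by (auto intro!: derivative_eq_intros)
  then show ?thesis using p by (simp add: pot_def[abs_def])
qed

lemma force_factor: "x > 0 \<Longrightarrow> C * x powr p - B * x = x * (C * x powr (p - 1) - C * ebar powr (p - 1))"
  using ebar by (simp add: powr_diff algebra_simps)

lemma force_sign:
  assumes "x > 0"
  shows "x < ebar \<Longrightarrow> C * x powr p < B * x" "x \<le> ebar \<Longrightarrow> C * x powr p \<le> B * x"
proof -
  show "C * x powr p < B * x" if "x < ebar"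
  proof -
    have "x powr (p - 1) < ebar powr (p - 1)" using that assms p by (intro powr_less_mono2) auto
    then have "x * (C * x powr (p - 1) - C * ebar powr (p - 1)) < 0"
      using assms C by (simp add: mult_pos_neg)
    then show ?thesis using force_factor[OF assms] by simp
  qed
  then show "C * x powr p \<le> B * x" if "x \<le> ebar"
    using that force_factor[OF assms] by (cases "x = ebar") auto
qed

lemma pot_mono:
  assumes "0 < x" "x \<le> y" "y \<le> ebar"
  shows "pot x \<le> pot y"
  by (rule mono_of_nonneg_deriv[where f' = "\<lambda>x. B * x - C * x powr p"])
    (use assms in \<open>auto intro!: pot_deriv force_sign\<close>)

lemma pot_nonneg:
  assumes x: "0 < x" "x \<le> ebar" shows "0 \<le> pot x"
proof -
  have "x powr (p + 1) = x powr p * x" using x by (simp add: powr_add)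
  then have "pot x = x * (B * x / 2 - C * x powr p / (p + 1))"
    by (simp add: pot_def power2_eq_square algebra_simps)
  moreover have "C * x powr p / (p + 1) \<le> B * x / 2"
    using force_sign(2)[of x] x p C B_pos by (intro frac_le) auto
  ultimately show ?thesis using x by simp
qed

lemma energy_constant:
  assumes v: "delaunay e v" shows "energy v t = energy v s"
proof -
  note D = tower_derivs[OF delaunay_tower[OF v]]
  have "(energy v has_real_derivative 0) (at t)" for t
  proof -
    have P: "((\<lambda>t. pot (v 0 t)) has_real_derivative (B * v 0 t - C * v 0 t powr p) * v 1 t) (at t)"
      by (rule DERIV_chain2[OF pot_deriv[OF delaunay_pos[OF v]] D(1)])
    have "((\<lambda>t. v 1 t * v 3 t - (v 2 t)^2 / 2 - A / 2 * (v 1 t)^2 + pot (v 0 t)) has_real_derivative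
       (v 2 t * v 3 t + v 1 t * v 4 t - v 2 t * v 3 t - A * v 1 t * v 2 t
         + (B * v 0 t - C * v 0 t powr p) * v 1 t)) (at t)"
      by (auto intro!: derivative_eq_intros D P simp: algebra_simps simp del: One_nat_def)
    moreover have "v 2 t * v 3 t + v 1 t * v 4 t - v 2 t * v 3 t - A * v 1 t * v 2 t
         + (B * v 0 t - C * v 0 t powr p) * v 1 t = 0"
      unfolding delaunay_ode[OF v] by (simp add: algebra_simps)
    ultimately show ?thesis by (simp add: energy_def[abs_def])
  qed
  then show ?thesis using DERIV_isconst_all by blast
qed

lemma delaunay_deriv0:
  assumes v: "delaunay e v" shows "v 1 0 = 0"
  using DERIV_local_min[OF tower_derivs(1)[OF delaunay_tower[OF v], of 0], of 1] v
  unfolding delaunay_def by auto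

lemma delaunay_even:
  assumes v: "delaunay e v" and i: "i < 4" shows "v i (- t) = (- 1) ^ i * v i t"
  using solution_symmetric[of v 0 i t] v delaunay_deriv0[OF v] i unfolding delaunay_def by simp

lemma delaunay_third0: "delaunay e v \<Longrightarrow> v 3 0 = 0"
  using delaunay_even[of e v 3 0] by simp

text \<open>Below \<open>ebar\<close> the force is negative, so \<open>v''(0) \<le> 0\<close> would give \<open>v''''(0) < 0\<close> and the point \<open>0\<close> would
not be a minimum.\<close>

lemma delaunay_second0_pos:
  assumes v: "delaunay e v" shows "v 2 0 > 0"
proof (rule ccontr)
  assume "\<not> v 2 0 > 0"
  then have 2: "v 2 0 \<le> 0" by simp
  have e: "0 < e" "e < ebar" "v 0 0 = e" using v by (auto simp: delaunay_def)
  have "A * v 2 0 \<le> 0" using 2 A_pos by (simp add: mult_nonneg_nonpos)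
  then have "v 4 0 < 0" unfolding delaunay_ode[OF v] using force_sign(1)[of e] e by simp
  then obtain d where d: "d > 0" "\<And>t. 0 < t \<Longrightarrow> t < d \<Longrightarrow> v 1 t < 0"
    using local_decrease[OF delaunay_tower[OF v] delaunay_deriv0[OF v] 2 delaunay_third0[OF v]] by auto
  have "v 0 (d / 2) < v 0 0"
  proof (rule DERIV_neg_imp_decreasing_open[where f = "v 0"])
    show "\<exists>y. DERIV (v 0) x :> y \<and> y < 0" if "0 < x" "x < d / 2" for x
      using tower_derivs(1)[OF delaunay_tower[OF v]] d that by (intro exI[of _ "v 1 x"]) auto
  qed (use d tower_continuous[OF delaunay_tower[OF v]] in auto)
  then show False using v unfolding delaunay_def by (metis not_le)
qed

lemma solution_zero: "solution (\<lambda>i t. 0)"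
  unfolding solution_def tower_def using p by auto

text \<open>Comparison with the zero solution.\<close>

lemma delaunay_second0_less:
  assumes v: "delaunay e v" shows "v 2 0 < la * e"
proof (rule ccontr)
  assume "\<not> v 2 0 < la * e"
  then have "in_cone (\<lambda>i t. v i t - 0) 0"
    using v delaunay_deriv0[OF v] delaunay_third0[OF v] unfolding in_cone_def delaunay_def by auto
  then have "v 0 0 = 0"
    using solutions_cannot_separate[OF _ solution_zero, of v 0 0] v unfolding delaunay_def by simp
  then show False using v by (auto simp: delaunay_def)
qed

lemma energy_at_critical:
  assumes v: "delaunay e v" and s: "v 1 s = 0"
  shows "pot (v 0 s) = pot e - (v 2 0)^2 / 2 + (v 2 s)^2 / 2"
  using energy_constant[OF v, of s 0] v delaunay_deriv0[OF v] s by (simp add: energy_def delaunay_def)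

text \<open>If an increasing solution exceeds \<open>ebar\<close>, the force is bounded below by a positive constant and pushes \<open>v\<close> into
the cone relative to the zero solution. Otherwise \<open>k = v''' - A v'\<close> is nonincreasing, and nonnegative because
\<open>v\<close> is bounded; conservation of energy then keeps \<open>|v''|\<close> above its value at \<open>0\<close>, so \<open>v\<close> is unbounded after
all.\<close>

lemma delaunay_not_monotone:
  assumes v: "delaunay e v" and inc: "\<And>t. t > 0 \<Longrightarrow> v 1 t > 0"
  shows False
proof -
  note D = tower_derivs[OF delaunay_tower[OF v]]
  have e: "0 < e" "e < ebar" "v 0 0 = e" using v by (auto simp: delaunay_def)
  have inc': "v 1 t \<ge> 0" if "t \<ge> 0" for t using inc[of t] that delaunay_deriv0[OF v] by (cases "t = 0") auto
  have mono: "v 0 s \<le> v 0 t" if "0 \<le> s" "s \<le> t" for s t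
    by (rule mono_of_nonneg_deriv[where f' = "v 1"]) (use that inc' D in auto)
  define k where "k t = v 3 t - A * v 1 t" for t
  define j where "j t = v 2 t - A * v 0 t" for t
  have k': "(k has_real_derivative C * v 0 t powr p - B * v 0 t) (at t)" for t
  proof -
    have "(k has_real_derivative v 4 t - A * v 2 t) (at t)"
      unfolding k_def by (rule derivative_eq_intros D refl)+ simp
    then show ?thesis using delaunay_ode[OF v, of t] by simp
  qed
  have j': "(j has_real_derivative k t) (at t)" for t
    unfolding j_def k_def by (rule derivative_eq_intros D refl)+ simp
  show False
  proof (cases "\<exists>t0>0. v 0 t0 > ebar")
    case True
    then obtain t0 where t0: "t0 > 0" "v 0 t0 > ebar" by blast
    define c where "c = ebar * (C * v 0 t0 powr (p - 1) - C * ebar powr (p - 1))"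
    have "ebar powr (p - 1) < v 0 t0 powr (p - 1)" using t0 ebar p by (intro powr_less_mono2) auto
    then have d: "C * v 0 t0 powr (p - 1) - C * ebar powr (p - 1) > 0" using C by simp
    then have c: "c > 0" using ebar by (simp add: c_def)
    have f: "C * v 0 t powr p - B * v 0 t \<ge> c" if "t0 \<le> t" for t
    proof -
      have le: "v 0 t0 \<le> v 0 t" using mono that t0 by simp
      have "v 0 t0 powr (p - 1) \<le> v 0 t powr (p - 1)"
        using le t0 ebar p by (intro powr_mono2) auto
      then have "C * v 0 t0 powr (p - 1) \<le> C * v 0 t powr (p - 1)" using C by simp
      then have "c \<le> v 0 t * (C * v 0 t powr (p - 1) - C * ebar powr (p - 1))"
        unfolding c_def using le t0 ebar d by (intro mult_mono) auto
      then show ?thesis using force_factor[OF delaunay_pos[OF v]] by simp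
    qed
    have kb: "k t \<ge> k t0 + c * (t - t0)" if "t0 \<le> t" for t
      by (rule linear_lower_bound[where f' = "\<lambda>t. C * v 0 t powr p - B * v 0 t"]) (use that k' f in auto)
    \<comment> \<open>From \<open>t1\<close> on \<open>k \<ge> 1\<close>, and from \<open>t2\<close> on also \<open>j \<ge> 0\<close>.\<close>
    define t1 where "t1 = t0 + (1 + \<bar>k t0\<bar>) / c"
    have t1: "t1 \<ge> t0" using c by (simp add: t1_def)
    have k1: "k t \<ge> 1" if "t1 \<le> t" for t
    proof -
      have "c * (t1 - t0) \<le> c * (t - t0)" using that c by simp
      moreover have "c * (t1 - t0) = 1 + \<bar>k t0\<bar>" using c by (simp add: t1_def)
      ultimately show ?thesis using kb[of t] that t1 by linarith
    qed
    have jb: "j t \<ge> j t1 + 1 * (t - t1)" if "t1 \<le> t" for t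
      by (rule linear_lower_bound[where f' = k]) (use that j' k1 in auto)
    define t2 where "t2 = t1 + \<bar>j t1\<bar>"
    have jk: "j t2 \<ge> 0" "k t2 \<ge> 0" using jb[of t2] k1[of t2] unfolding t2_def by auto
    have "t2 \<ge> 0" unfolding t2_def using t1 t0 by simp
    have "la * v 0 t2 \<le> A * v 0 t2" "la * v 1 t2 \<le> A * v 1 t2"
      using lb inc'[OF \<open>t2 \<ge> 0\<close>] delaunay_pos[OF v, of t2] by (intro mult_right_mono; simp add: A_eq)+
    then have "la * v 0 t2 \<le> v 2 t2" "la * v 1 t2 \<le> v 3 t2"
      using jk unfolding j_def k_def by linarith+
    then have "in_cone (\<lambda>i t. v i t - 0) t2"
      unfolding in_cone_def using inc'[OF \<open>t2 \<ge> 0\<close>] delaunay_pos[OF v, of t2]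
      by simp
    then have "v 0 t2 = 0"
      using solutions_cannot_separate[OF _ solution_zero, of v t2 0] v unfolding delaunay_def by simp
    then show False using delaunay_pos[OF v, of t2] by simp
  next
    case False
    have le: "v 0 t \<le> ebar" if "t \<ge> 0" for t
      using False that e by (metis less_eq_real_def not_le)
    have k0: "k t \<ge> 0" if t: "t \<ge> 0" for t
    proof (rule ccontr)
      assume "\<not> k t \<ge> 0"
      then have neg: "k t < 0" by simp
      have kb: "- k r \<ge> - k t" if "t \<le> r" for r
        by (rule mono_of_nonneg_deriv[where f' = "\<lambda>r. - (C * v 0 r powr p - B * v 0 r)"])
          (use that t in \<open>auto intro!: derivative_eq_intros k' force_sign(2) delaunay_pos[OF v] le\<close>)
      have jb: "- j r \<ge> - j t + - k t * (r - t)" if "t \<le> r" for r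
        by (rule linear_lower_bound[where f' = "\<lambda>r. - k r"])
          (use that kb in \<open>auto intro!: derivative_eq_intros j'\<close>)
      define r0 where "r0 = t + (\<bar>j t\<bar> + A * ebar + 1) / - k t"
      have num: "\<bar>j t\<bar> + A * ebar + 1 > 0" using A_pos ebar by (simp add: add_nonneg_pos)
      have r0: "r0 \<ge> t" using neg num by (simp add: r0_def divide_nonneg_neg)
      have v2: "- v 2 r \<ge> 1" if "r0 \<le> r" for r
      proof -
        have "- k t * (r0 - t) \<le> - k t * (r - t)" using that neg by simp
        moreover have "- k t * (r0 - t) = \<bar>j t\<bar> + A * ebar + 1" using neg by (simp add: r0_def)
        moreover have "A * v 0 r \<le> A * ebar" using le[of r] that r0 t A_pos by simp
        ultimately show ?thesis using jb[of r] that r0 by (simp add: j_def) 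
      qed
      define r1 where "r1 = r0 + v 1 r0 + 1"
      have "v 1 r0 \<ge> 0" using inc' r0 t by simp
      then have r1: "r1 \<ge> r0" "r1 > 0" using r0 t by (auto simp: r1_def)
      have "- v 1 r0 + 1 * (r1 - r0) \<le> - v 1 r1"
        by (rule linear_lower_bound[where f' = "\<lambda>r. - v 2 r"])
          (use r1 v2 in \<open>auto intro!: derivative_eq_intros D simp del: One_nat_def\<close>)
      then show False using inc[of r1] r1 by (simp add: r1_def)
    qed
    define b where "b = v 2 0"
    have b: "b > 0" using delaunay_second0_pos[OF v] by (simp add: b_def)
    have sq: "(v 2 t)^2 \<ge> b^2" if t: "t \<ge> 0" for t
    proof -
      have "energy v t = energy v 0" by (rule energy_constant[OF v])
      then have "v 1 t * v 3 t - (v 2 t)^2 / 2 - A / 2 * (v 1 t)^2 + pot (v 0 t) = pot e - b^2 / 2"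
        using delaunay_deriv0[OF v] e by (simp add: energy_def b_def)
      moreover have "pot e \<le> pot (v 0 t)"
        using mono[of 0 t] le[OF t] t e by (intro pot_mono) auto
      moreover have "v 1 t * v 3 t = v 1 t * k t + A * (v 1 t)^2"
        by (simp add: k_def algebra_simps power2_eq_square)
      moreover have "v 1 t * k t \<ge> 0" "A * (v 1 t)^2 \<ge> 0" using inc'[OF t] k0[OF t] A_pos by auto
      ultimately show ?thesis by (simp add: field_simps)
    qed
    have v2: "v 2 t \<ge> b" if t: "t \<ge> 0" for t
    proof (rule ccontr)
      assume "\<not> v 2 t \<ge> b"
      have "\<bar>b\<bar> \<le> \<bar>v 2 t\<bar>" using sq[OF t] by (simp add: abs_le_square_iff)
      then have "v 2 t \<le> 0" using b \<open>\<not> v 2 t \<ge> b\<close> by linarith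
      then obtain r where "0 \<le> r" "v 2 r = 0"
        using IVT2'[of "v 2" t 0 0] t b tower_continuous[OF delaunay_tower[OF v]] by (auto simp: b_def)
      then show False using sq[of r] b by simp
    qed
    have v1: "v 1 t \<ge> b * t" if t: "t \<ge> 0" for t
      using linear_lower_bound[of 0 t "v 1" "v 2" b] t v2 D delaunay_deriv0[OF v] by auto
    have "v 0 1 + b * ((1 + ebar / b) - 1) \<le> v 0 (1 + ebar / b)"
    proof (rule linear_lower_bound[where f' = "v 1"])
      show "b \<le> v 1 r" if "1 \<le> r" for r
      proof -
        have "b * 1 \<le> b * r" using that b by simp
        then show ?thesis using v1[of r] that by linarith
      qed
    qed (use b ebar D in auto)
    then have "v 0 1 + ebar \<le> v 0 (1 + ebar / b)" using b by simp
    then show False using le[of "1 + ebar / b"] delaunay_pos[OF v, of 1] b ebar by (simp add: add_nonneg_nonneg)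
  qed
qed

text \<open>At the first zero \<open>\<tau>\<close> of \<open>v'\<close> the second derivative could only vanish if \<open>v(\<tau>) > ebar\<close>, by
conservation of energy. Then \<open>v''''(\<tau>) > 0\<close> and \<open>v\<close> would increase after \<open>\<tau>\<close>, against the symmetry about \<open>\<tau>\<close>.\<close>

lemma delaunay_first_maximum:
  assumes v: "delaunay e v"
  shows "\<exists>\<tau>>0. v 1 \<tau> = 0 \<and> v 2 \<tau> < 0"
proof -
  note D = tower_derivs[OF delaunay_tower[OF v]]
  have e: "0 < e" "e < ebar" "v 0 0 = e" using v by (auto simp: delaunay_def)
  obtain d where d: "d > 0" "\<And>h. 0 < h \<Longrightarrow> h < d \<Longrightarrow> v 1 (0 + h) > v 1 0"
    using DERIV_pos_inc_right[OF D(2) delaunay_second0_pos[OF v]] by blast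
  then have start: "v 1 t > 0" if "0 < t" "t < d" for t using that delaunay_deriv0[OF v] by simp
  define Z where "Z = {t \<in> {d/2..}. v 1 t \<le> 0}"
  have ex: "\<exists>t>0. v 1 t \<le> 0" using delaunay_not_monotone[OF v] not_le by blast
  then obtain z where z: "z > 0" "v 1 z \<le> 0" by blast
  have "z \<ge> d" using start[of z] z by (meson not_le order.asym)
  then have zZ: "z \<in> Z" using z d by (auto simp: Z_def)
  have "closed Z" unfolding Z_def
    by (intro continuous_on_closed_Collect_le tower_continuous[OF delaunay_tower[OF v]] continuous_intros) auto
  moreover have bdd: "bdd_below Z" by (rule bdd_belowI[of _ "d/2"]) (auto simp: Z_def)
  ultimately have "Inf Z \<in> Z" using zZ closed_contains_Inf by blast
  define \<tau> where "\<tau> = Inf Z"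
  have \<tau>: "\<tau> \<in> Z" using \<open>Inf Z \<in> Z\<close> by (simp add: \<tau>_def)
  then have \<tau>pos: "\<tau> > 0" "v 1 \<tau> \<le> 0" using d by (auto simp: Z_def)
  have before: "v 1 t > 0" if "0 < t" "t < \<tau>" for t
  proof (rule ccontr)
    assume n: "\<not> v 1 t > 0"
    then have "t \<ge> d" using start[of t] that by (meson not_le)
    then have "t \<in> Z" using n d by (auto simp: Z_def)
    then have "\<tau> \<le> t" unfolding \<tau>_def using bdd by (rule cInf_lower)
    then show False using that by simp
  qed
  have crit: "v 1 \<tau> = 0"
  proof (rule ccontr)
    assume "v 1 \<tau> \<noteq> 0"
    then have neg: "v 1 \<tau> < 0" using \<tau>pos by simp
    have lt: "\<tau> / 2 < \<tau>" "0 < \<tau> / 2" using \<tau>pos by auto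
    obtain r where "\<tau> / 2 \<le> r" "r \<le> \<tau>" "v 1 r = 0"
      using IVT2'[of "v 1" \<tau> 0 "\<tau> / 2"] neg before[of "\<tau> / 2"] lt
        tower_continuous[OF delaunay_tower[OF v]] by auto
    then show False using before[of r] neg lt by (cases "r = \<tau>") auto
  qed
  have sym: "v i (2 * \<tau> - t) = (- 1) ^ i * v i t" if "i < 4" for i t
    using solution_symmetric[of v \<tau> i t] v crit that by (simp add: delaunay_def)
  have v3: "v 3 \<tau> = 0" using sym[of 3 \<tau>] by simp
  have "v 2 \<tau> \<le> 0"
  proof (rule ccontr)
    assume "\<not> v 2 \<tau> \<le> 0"
    then have "v 2 \<tau> > 0" by simp
    then obtain d' where d': "d' > 0" "\<And>h. 0 < h \<Longrightarrow> h < d' \<Longrightarrow> v 1 (\<tau> - h) < v 1 \<tau>"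
      using DERIV_pos_inc_left[OF D(2)] by blast
    define h where "h = min (d' / 2) (\<tau> / 2)"
    have "0 < h" "h < d'" "h < \<tau>" using d' \<tau>pos by (auto simp: h_def)
    then show False using d'(2)[of h] before[of "\<tau> - h"] crit by simp
  qed
  moreover have "v 2 \<tau> \<noteq> 0"
  proof
    assume v2: "v 2 \<tau> = 0"
    have E: "pot (v 0 \<tau>) < pot e"
      using energy_at_critical[OF v crit] v2 delaunay_second0_pos[OF v] by simp
    have ge: "e \<le> v 0 \<tau>" using v by (simp add: delaunay_def)
    have big: "v 0 \<tau> > ebar"
    proof (rule ccontr)
      assume "\<not> v 0 \<tau> > ebar"
      then show False using pot_mono[of e "v 0 \<tau>"] E ge e by simp
    qed
    have "ebar powr (p - 1) < v 0 \<tau> powr (p - 1)" using big ebar p by (intro powr_less_mono2) auto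
    then have "v 0 \<tau> * (C * v 0 \<tau> powr (p - 1) - C * ebar powr (p - 1)) > 0"
      using C delaunay_pos[OF v, of \<tau>] by simp
    then have "v 4 \<tau> > 0"
      using force_factor[OF delaunay_pos[OF v, of \<tau>]] delaunay_ode[OF v, of \<tau>] v2 by simp
    moreover have "tower (\<lambda>i t. - v i t)"
      using tower_lincomb[OF delaunay_tower[OF v] delaunay_tower[OF v], of "- 1" 0] by simp
    ultimately obtain d' where d': "d' > 0" "\<And>t. \<tau> < t \<Longrightarrow> t < \<tau> + d' \<Longrightarrow> - v 1 t < 0"
      using local_decrease[of "\<lambda>i t. - v i t" \<tau>] crit v2 v3 by auto
    define h where "h = min (d' / 2) (\<tau> / 2)"
    have h: "0 < h" "h < d'" "h < \<tau>" using d' \<tau>pos by (auto simp: h_def)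
    have "v 1 (\<tau> + h) = - v 1 (\<tau> - h)" using sym[of 1 "\<tau> - h"] by (simp add: algebra_simps)
    then show False using before[of "\<tau> - h"] d'(2)[of "\<tau> + h"] h by simp
  qed
  ultimately show ?thesis using \<tau>pos crit by auto
qed

lemma symmetric_imp_periodic:
  assumes v: "delaunay e v" and crit: "v 1 s = 0" and i: "i < 4"
  shows "v i (t + 2 * s) = v i t"
proof -
  have "v i (2 * s - (- t)) = (- 1) ^ i * v i (- t)"
    using solution_symmetric[of v s i "- t"] v crit i by (simp add: delaunay_def)
  also have "\<dots> = (- 1) ^ i * ((- 1) ^ i * v i t)" using delaunay_even[OF v i] by simp
  also have "\<dots> = v i t" by (simp add: mult.assoc[symmetric] power_mult_distrib[symmetric])
  finally show ?thesis by (simp add: add.commute)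
qed

lemma periodic_reduce:
  fixes f :: "real \<Rightarrow> 'b"
  assumes per: "\<And>t. f (t + P) = f t" and P: "P > 0"
  shows "\<exists>r. 0 \<le> r \<and> r \<le> P \<and> f t = f r"
proof -
  have nat: "f (t + real n * P) = f t" for n t
  proof (induction n)
    case (Suc n)
    have "f (t + real (Suc n) * P) = f ((t + real n * P) + P)" by (simp add: algebra_simps)
    then show ?case using per Suc by simp
  qed simp
  have int: "f (t - of_int k * P) = f t" for k t
  proof (cases "k \<ge> 0")
    case True
    then have "t - of_int k * P + real (nat k) * P = t" by simp
    then show ?thesis using nat[of "t - of_int k * P" "nat k"] by (simp only:)
  next
    case False
    then have "t + real (nat (- k)) * P = t - of_int k * P" by simp
    then show ?thesis using nat[of t "nat (- k)"] by (simp only:)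
  qed
  define r where "r = t - of_int \<lfloor>t / P\<rfloor> * P"
  have "0 \<le> r" "r \<le> P" unfolding r_def
    using floor_divide_lower[OF P, of t] floor_divide_upper[OF P, of t] by (auto simp: algebra_simps)
  then show ?thesis using int[of t "\<lfloor>t / P\<rfloor>"] unfolding r_def by (intro exI[of _ "t - of_int \<lfloor>t / P\<rfloor> * P"]) simp
qed

text \<open>At a maximum of \<open>v\<close> the potential is at least the energy, which is bounded below uniformly in the
necksize, whereas the potential tends to minus infinity.\<close>

lemma delaunay_uniform_bound: "\<exists>M>0. \<forall>e v t. delaunay e v \<longrightarrow> v 0 t \<le> M"
proof -
  define R where "R = (la * ebar)^2 / 2 + 1"
  have R: "R > 0" by (simp add: R_def add_nonneg_pos)
  \<comment> \<open>Beyond \<open>M\<close> the superlinear term of the potential outweighs the quadratic one by \<open>R x\<^sup>2\<close>.\<close>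
  define M where "M = max 1 (((p + 1) / C * (B / 2 + R)) powr (1 / (p - 1)))"
  have pos: "(p + 1) / C * (B / 2 + R) > 0" using p C B_pos R by simp
  have far: "pot x < - ((la * ebar)^2 / 2)" if x: "x > M" for x
  proof -
    have x1: "x > 1" and "x \<ge> ((p + 1) / C * (B / 2 + R)) powr (1 / (p - 1))" using x by (auto simp: M_def)
    then have "(((p + 1) / C * (B / 2 + R)) powr (1 / (p - 1))) powr (p - 1) \<le> x powr (p - 1)"
      using p by (intro powr_mono2) auto
    then have "\<bar>(p + 1) / C * (B / 2 + R)\<bar> \<le> x powr (p - 1)" using p by (simp add: powr_powr)
    then have "(p + 1) / C * (B / 2 + R) \<le> x powr (p - 1)" by linarith
    then have "B / 2 + R \<le> C / (p + 1) * x powr (p - 1)" using C p by (simp add: field_simps)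
    then have "(B / 2 + R) * x^2 \<le> C / (p + 1) * x powr (p - 1) * x^2" by (intro mult_right_mono) auto
    also have "x powr (p - 1) * x^2 = x powr (p + 1)"
      using x1 powr_add[of x "p - 1" 2] by (simp add: powr_realpow add.commute)
    then have "C / (p + 1) * x powr (p - 1) * x^2 = C / (p + 1) * x powr (p + 1)" by (simp add: mult.assoc)
    finally have "pot x \<le> - R * x^2" by (simp add: pot_def algebra_simps)
    also have "\<dots> \<le> - R * 1" using R x1 by (intro mult_left_mono_neg) auto
    finally show ?thesis by (simp add: R_def)
  qed
  have "v 0 t \<le> M" if v: "delaunay e v" for e v t
  proof -
    have e: "0 < e" "e < ebar" using v by (auto simp: delaunay_def)
    obtain \<tau> where \<tau>: "\<tau> > 0" "v 1 \<tau> = 0" using delaunay_first_maximum[OF v] by blast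
    have "\<exists>s\<in>{0..2 * \<tau>}. \<forall>r\<in>{0..2 * \<tau>}. v 0 r \<le> v 0 s"
      by (intro continuous_attains_sup tower_continuous[OF delaunay_tower[OF v]]) (use \<tau> in auto)
    then obtain s where s: "\<And>r. 0 \<le> r \<Longrightarrow> r \<le> 2 * \<tau> \<Longrightarrow> v 0 r \<le> v 0 s"
      by (meson atLeastAtMost_iff)
    have top: "v 0 r \<le> v 0 s" for r
      using periodic_reduce[of "v 0" "2 * \<tau>" r] symmetric_imp_periodic[OF v \<tau>(2), of 0] \<tau> s by auto
    have "v 1 s = 0"
      using DERIV_local_max[OF tower_derivs(1)[OF delaunay_tower[OF v], of s], of 1] top by auto
    then have "pot (v 0 s) \<ge> pot e - (v 2 0)^2 / 2" using energy_at_critical[OF v] by simp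
    moreover have "pot e \<ge> 0" using pot_nonneg e by simp
    moreover have "(v 2 0)^2 \<le> (la * ebar)^2"
    proof (rule power_mono)
      have "la * e \<le> la * ebar" using e la by simp
      then show "v 2 0 \<le> la * ebar" using delaunay_second0_less[OF v] by linarith
      show "0 \<le> v 2 0" using delaunay_second0_pos[OF v] by simp
    qed
    ultimately have "\<not> v 0 s > M" using far[of "v 0 s"] by auto
    then show ?thesis using top[of t] by simp
  qed
  moreover have "M > 0" unfolding M_def by simp
  ultimately show ?thesis by blast
qed

text \<open>If \<open>v''(0)\<close> grew too fast with the necksize, the difference of two solutions would start in the
cone. If it fell too fast, the reversed difference, scaled to the data \<open>-1, 0, k, 0\<close> with \<open>k\<close> large, would
reach the cone at time \<open>1\<close>.\<close>

lemma second0_lipschitz: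
  "\<exists>K>0. \<forall>e1 v1 e2 v2. delaunay e1 v1 \<and> delaunay e2 v2 \<longrightarrow> \<bar>v1 2 0 - v2 2 0\<bar> \<le> K * \<bar>e1 - e2\<bar>"
proof -
  obtain M where M: "\<And>e v t. delaunay e v \<Longrightarrow> v 0 t \<le> M"
    using delaunay_uniform_bound by blast
  define Q where "Q = C * p * M powr (p - 1)"
  have Q: "Q \<ge> 0" using C p by (simp add: Q_def)
  define c where "c = 5 + 3 * Q / lb"
  have c: "c \<ge> 5" "lb * (c - 1) \<ge> 3 * Q" using Q lb by (auto simp: c_def field_simps)
  define K where "K = 2 * la + c"
  have K: "K \<ge> la" "K > 0" using la c by (auto simp: K_def)
  have main: "\<bar>v1 2 0 - v2 2 0\<bar> \<le> K * (e1 - e2)" if v: "delaunay e1 v1" "delaunay e2 v2" and lt: "e2 < e1"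
    for e1 v1 e2 v2
  proof -
    have d: "e1 - e2 > 0" using lt by simp
    have sol: "solution v1" "solution v2" and v0: "v1 0 0 = e1" "v2 0 0 = e2"
      using v by (auto simp: delaunay_def)
    note crit = delaunay_deriv0[OF v(1)] delaunay_deriv0[OF v(2)] delaunay_third0[OF v(1)] delaunay_third0[OF v(2)]
    have up: "v1 2 0 - v2 2 0 \<le> la * (e1 - e2)"
    proof (rule ccontr)
      assume "\<not> ?thesis"
      then have "in_cone (\<lambda>i t. v1 i t - v2 i t) 0" using d v0 crit by (auto simp: in_cone_def)
      then show False using solutions_cannot_separate[OF sol, of 0 0] v0 d by simp
    qed
    have low: "v2 2 0 - v1 2 0 \<le> K * (e1 - e2)"
    proof (rule ccontr)
      assume n: "\<not> ?thesis"
      define u where "u = (\<lambda>i t. (1 / (e1 - e2)) * (v2 i t - v1 i t))"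
      have tow: "tower u" unfolding u_def
        using tower_lincomb[OF delaunay_tower[OF v(2)] delaunay_tower[OF v(1)],
            of "1 / (e1 - e2)" "- (1 / (e1 - e2))"] by (simp add: algebra_simps)
      note D = tower_derivs[OF tow]
      have u0: "u 0 0 = - 1" "u 1 0 = 0" "u 3 0 = 0"
        using v0 crit d by (auto simp: u_def field_simps)
      have u2: "u 2 0 > K" using n d by (simp add: u_def field_simps)
      have eq: "\<exists>q. 0 \<le> q \<and> q \<le> Q \<and> u 4 t = A * u 2 t - B * u 0 t + q * u 0 t" for t
      proof -
        obtain q where q: "0 \<le> q" "q \<le> Q"
          "v2 4 t - v1 4 t = A * (v2 2 t - v1 2 t) - B * (v2 0 t - v1 0 t) + q * (v2 0 t - v1 0 t)"
          using solution_diff_quotient[OF sol(2,1), of t M] M[OF v(1)] M[OF v(2)] unfolding Q_def by blast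
        have "u 4 t = A * u 2 t - B * u 0 t + q * u 0 t"
          unfolding u_def q(3) by (simp only: distrib_left right_diff_distrib mult.left_commute)
        then show ?thesis using q(1,2) by blast
      qed
      \<comment> \<open>The linear terms in \<open>t\<close> turn the closed conditions at time \<open>0\<close> into open ones that persist up to time \<open>1\<close>.\<close>
      define X where "X i t = (if i = 0 then u 0 t + 2 + t else if i = 1 then u 1 t + 1
        else if i = 2 then u 2 t - la * u 0 t - 3 * la - c + t else u 3 t - la * u 1 t + 1)" for i :: nat and t
      define X' where "X' i t = (if i = 0 then u 1 t + 1 else if i = 1 then u 2 t
        else if i = 2 then u 3 t - la * u 1 t + 1 else u 4 t - la * u 2 t)" for i :: nat and t
      have rate: "X' i t \<ge> 0 \<and> u 2 t \<ge> 4" if i: "i < 4" and t: "0 \<le> t" "t \<le> 1"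
        and P: "\<And>j. j < 4 \<Longrightarrow> X j t > 0" for i t
      proof -
        have P0: "u 0 t > - 3" and P1: "u 1 t > - 1" and P2: "u 2 t - la * u 0 t > 3 * la + c - 1"
          and P3: "u 3 t - la * u 1 t > - 1"
          using P[of 0] P[of 1] P[of 2] P[of 3] t unfolding X_def by auto
        obtain q where q: "0 \<le> q" "q \<le> Q" "u 4 t = A * u 2 t - B * u 0 t + q * u 0 t" using eq by blast
        have "la * u 0 t \<ge> la * - 3" using P0 la by (intro mult_left_mono) auto
        then have 1: "u 2 t \<ge> 4" using P2 c by linarith
        have "q * u 0 t \<ge> q * - 3" using P0 q by (intro mult_left_mono) auto
        then have "q * u 0 t \<ge> - 3 * Q" using q by linarith
        moreover have "lb * (u 2 t - la * u 0 t) \<ge> lb * (c - 1)"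
          using P2 lb la by (intro mult_left_mono) auto
        moreover have "u 4 t - la * u 2 t = lb * (u 2 t - la * u 0 t) + q * u 0 t"
          using q(3) by (simp add: A_eq B_eq algebra_simps)
        ultimately have 3: "u 4 t - la * u 2 t \<ge> 0" using c by linarith
        show ?thesis using P1 P3 1 3 unfolding X'_def by auto
      qed
      have pos: "X i t > 0" if "i < 4" "0 \<le> t" "t \<le> 1" for i t
      proof (rule positivity_propagates[of "{..<4}" 0 1 X X' t i])
        show "(X i has_real_derivative X' i t) (at t)" for i t
          unfolding X_def X'_def
          by (auto intro!: derivative_eq_intros D simp del: One_nat_def)
        show "X i 0 > 0" if "i \<in> {..<4}" for i
          using u0 u2 that unfolding X_def K_def by auto
      qed (use that rate in auto)
      have rate': "X' i t \<ge> 0" "u 2 t \<ge> 4" if "i < 4" "0 \<le> t" "t \<le> 1" for i t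
        using rate[OF that] pos that by auto
      have w1: "u 1 t \<ge> 4 * t" if "0 \<le> t" "t \<le> 1" for t
        using linear_lower_bound[of 0 t "u 1" "u 2" 4] that rate'(2)[of 0] D u0 by auto
      have "u 0 0 - 2 * 0^2 \<le> u 0 1 - 2 * 1^2"
        by (rule mono_of_nonneg_deriv[where f' = "\<lambda>t. u 1 t - 4 * t"])
          (use w1 in \<open>auto intro!: derivative_eq_intros D simp del: One_nat_def\<close>)
      then have end0: "u 0 1 \<ge> 1" using u0 by simp
      have "u 3 0 - la * u 1 0 \<le> u 3 1 - la * u 1 1"
        by (rule mono_of_nonneg_deriv[where f' = "\<lambda>t. u 4 t - la * u 2 t"])
          (use rate'(1)[of 3] in \<open>auto intro!: derivative_eq_intros D simp: X'_def simp del: One_nat_def\<close>)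
      then have "in_cone u 1"
        using end0 w1[of 1] pos[of 2 1] u0 la c unfolding in_cone_def X_def by auto
      then have "in_cone (\<lambda>i t. v2 i t - v1 i t) 1"
        using d unfolding in_cone_def u_def by (simp add: divide_simps)
      then have "v2 0 1 = v1 0 1" using solutions_cannot_separate[OF sol(2,1), of 1 0] by simp
      then show False using end0 by (simp add: u_def)
    qed
    have "la * (e1 - e2) \<le> K * (e1 - e2)" using K d by (intro mult_right_mono) auto
    then show ?thesis using up low by linarith
  qed
  have "\<bar>v1 2 0 - v2 2 0\<bar> \<le> K * \<bar>e1 - e2\<bar>" if v: "delaunay e1 v1" "delaunay e2 v2" for e1 v1 e2 v2
  proof -
    consider "e2 < e1" | "e1 < e2" | "e1 = e2" by linarith
    then show ?thesis
    proof cases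
      case 1 then show ?thesis using main[OF v] by simp
    next
      case 2 then show ?thesis using main[OF v(2,1)] by (simp add: abs_minus_commute)
    next
      case 3
      have "v1 2 0 = v2 2 0"
        by (rule solution_eqI[where s = 0])
          (use v 3 delaunay_deriv0[OF v(1)] delaunay_deriv0[OF v(2)] in \<open>auto simp: delaunay_def\<close>)
      then show ?thesis using 3 by simp
    qed
  qed
  then show ?thesis using K(2) by blast
qed

end

section \<open>Difference quotients in the necksize\<close>

lemma tower_limit:
  fixes f :: "nat \<Rightarrow> nat \<Rightarrow> real \<Rightarrow> real"
  assumes tow: "\<And>n. tower (f n)"
    and cauchy: "\<And>T \<delta> i. \<delta> > 0 \<Longrightarrow> i \<le> 4 \<Longrightarrow>
      \<exists>N. \<forall>n\<ge>N. \<forall>m\<ge>N. \<forall>t. \<bar>t\<bar> \<le> T \<longrightarrow> \<bar>f n i t - f m i t\<bar> < \<delta>"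
  shows "\<exists>g. tower g \<and> (\<forall>i\<le>4. \<forall>t. (\<lambda>n. f n i t) \<longlonglongrightarrow> g i t)"
proof -
  define g where "g i t = lim (\<lambda>n. f n i t)" for i t
  have lim: "(\<lambda>n. f n i t) \<longlonglongrightarrow> g i t" if i: "i \<le> 4" for i t
  proof -
    have "Cauchy (\<lambda>n. f n i t)"
    proof (rule CauchyI)
      fix \<delta> :: real assume "\<delta> > 0"
      then obtain N where "\<forall>n\<ge>N. \<forall>m\<ge>N. \<forall>s. \<bar>s\<bar> \<le> \<bar>t\<bar> \<longrightarrow> \<bar>f n i s - f m i s\<bar> < \<delta>"
        using cauchy[of \<delta> i "\<bar>t\<bar>"] i by blast
      then show "\<exists>M. \<forall>m\<ge>M. \<forall>n\<ge>M. norm (f m i t - f n i t) < \<delta>"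
        by (intro exI[of _ N]) auto
    qed
    then show ?thesis unfolding g_def using Cauchy_convergent convergent_LIMSEQ_iff by blast
  qed
  have unif: "\<exists>N. \<forall>n\<ge>N. \<forall>t. \<bar>t\<bar> \<le> T \<longrightarrow> \<bar>f n i t - g i t\<bar> \<le> \<delta>" if \<delta>: "\<delta> > 0" and i: "i \<le> 4" for i T \<delta>
  proof -
    obtain N where N: "\<And>n m t. n \<ge> N \<Longrightarrow> m \<ge> N \<Longrightarrow> \<bar>t\<bar> \<le> T \<Longrightarrow> \<bar>f n i t - f m i t\<bar> < \<delta>"
      using cauchy[OF \<delta> i, of T] by blast
    have "\<bar>f n i t - g i t\<bar> \<le> \<delta>" if n: "n \<ge> N" and t: "\<bar>t\<bar> \<le> T" for n t
    proof (rule LIMSEQ_le_const2)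
      show "(\<lambda>m. \<bar>f n i t - f m i t\<bar>) \<longlonglongrightarrow> \<bar>f n i t - g i t\<bar>" by (intro tendsto_intros lim i)
      show "\<exists>M. \<forall>m\<ge>M. \<bar>f n i t - f m i t\<bar> \<le> \<delta>"
        using N[OF n _ t] by (meson less_imp_le)
    qed
    then show ?thesis by blast
  qed
  have "(g i has_real_derivative g (Suc i) t) (at t)" if i: "i < 4" for i t
  proof -
    define S where "S = {t - 1<..<t + 1}"
    have "\<exists>G. \<forall>x\<in>S. (\<lambda>n. f n i x) \<longlonglongrightarrow> G x \<and> (G has_derivative (\<lambda>h. g (Suc i) x * h)) (at x within S)"
    proof (rule has_derivative_sequence[where ?x0.0 = t and l = "g i t" and f' = "\<lambda>n x h. f n (Suc i) x * h"])
      show "convex S" "t \<in> S" by (auto simp: S_def)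
      show "(f n i has_derivative (\<lambda>h. f n (Suc i) x * h)) (at x within S)" for n x
        using tow[of n] i unfolding tower_def has_field_derivative_def
        by (blast intro: has_derivative_at_withinI)
      show "(\<lambda>n. f n i t) \<longlonglongrightarrow> g i t" using lim i by simp
      fix \<delta> :: real assume "\<delta> > 0"
      then obtain N where N: "\<And>n x. n \<ge> N \<Longrightarrow> \<bar>x\<bar> \<le> \<bar>t\<bar> + 1 \<Longrightarrow> \<bar>f n (Suc i) x - g (Suc i) x\<bar> \<le> \<delta>"
        using unif[of \<delta> "Suc i" "\<bar>t\<bar> + 1"] i by auto
      have "norm (f n (Suc i) x * h - g (Suc i) x * h) \<le> \<delta> * norm h" if "n \<ge> N" "x \<in> S" for n x h
      proof -
        have "\<bar>f n (Suc i) x - g (Suc i) x\<bar> * \<bar>h\<bar> \<le> \<delta> * \<bar>h\<bar>"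
          using N[of n x] that by (intro mult_right_mono) (auto simp: S_def)
        then show ?thesis by (simp add: left_diff_distrib[symmetric] abs_mult)
      qed
      then show "\<forall>\<^sub>F n in sequentially. \<forall>x\<in>S. \<forall>h. norm (f n (Suc i) x * h - g (Suc i) x * h) \<le> \<delta> * norm h"
        unfolding eventually_sequentially by blast
    qed
    then obtain G where G: "\<And>x. x \<in> S \<Longrightarrow> (\<lambda>n. f n i x) \<longlonglongrightarrow> G x"
      "\<And>x. x \<in> S \<Longrightarrow> (G has_derivative (\<lambda>h. g (Suc i) x * h)) (at x within S)" by blast
    have S: "open S" "t \<in> S" by (auto simp: S_def)
    have eq: "G x = g i x" if "x \<in> S" for x using G(1)[OF that] lim[of i x] i LIMSEQ_unique by auto
    have "(G has_derivative (\<lambda>h. g (Suc i) t * h)) (at t)" using G(2)[of t] S at_within_open by metis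
    then have "(g i has_derivative (\<lambda>h. g (Suc i) t * h)) (at t)"
      by (rule has_derivative_transform_within_open[OF _ S]) (use eq in auto)
    then show ?thesis by (simp add: has_field_derivative_def)
  qed
  then show ?thesis using lim unfolding tower_def by blast
qed

text \<open>A function whose increments over one period \<open>P\<close> are bounded grows at most linearly.\<close>

lemma quasi_periodic_growth:
  fixes f :: "real \<Rightarrow> real"
  assumes cont: "continuous_on {0..P} f" and P: "P > 0" and c: "\<And>t. \<bar>f (t + P) - f t\<bar> \<le> c"
  shows "\<exists>K. \<forall>t. \<bar>f t\<bar> \<le> K * (1 + \<bar>t\<bar>)"
proof -
  have "compact (f ` {0..P})" by (intro compact_continuous_image cont) auto
  then obtain b where "\<forall>x\<in>f ` {0..P}. \<bar>x\<bar> \<le> b"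
    using compact_imp_bounded bounded_real by metis
  then have b: "\<bar>f r\<bar> \<le> b" if "0 \<le> r" "r \<le> P" for r using that by auto
  have b0: "b \<ge> 0" using b[of 0] P by force
  have c0: "c \<ge> 0" using c[of 0] by linarith
  have step: "\<bar>f (t + real n * P) - f t\<bar> \<le> real n * c" for t n
  proof (induction n)
    case (Suc n)
    have "f (t + real (Suc n) * P) = f ((t + real n * P) + P)" by (simp add: algebra_simps)
    then show ?case using Suc c[of "t + real n * P"] by (simp add: algebra_simps)
  qed simp
  define K where "K = b + c * (1 / P + 1)"
  have "\<bar>f t\<bar> \<le> K * (1 + \<bar>t\<bar>)" for t
  proof -
    define k where "k = \<lfloor>t / P\<rfloor>"
    define r where "r = t - of_int k * P"
    have r: "0 \<le> r" "r \<le> P" unfolding r_def k_def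
      using floor_divide_lower[OF P, of t] floor_divide_upper[OF P, of t] by (auto simp: algebra_simps)
    have k: "\<bar>of_int k\<bar> \<le> \<bar>t\<bar> / P + (1::real)"
    proof -
      have "\<bar>t / P\<bar> = \<bar>t\<bar> / P" using P by simp
      then show ?thesis unfolding k_def by linarith
    qed
    have "\<bar>f t - f r\<bar> \<le> \<bar>of_int k\<bar> * c"
    proof (cases "k \<ge> 0")
      case True
      then have "r + real (nat k) * P = t" by (simp add: r_def)
      then have "\<bar>f t - f r\<bar> \<le> real (nat k) * c" using step[of r "nat k"] by simp
      then show ?thesis using True by simp
    next
      case False
      then have "t + real (nat (- k)) * P = r" by (simp add: r_def)
      then have "\<bar>f r - f t\<bar> \<le> real (nat (- k)) * c" using step[of t "nat (- k)"] by simp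
      then show ?thesis using False by simp
    qed
    also have "\<dots> \<le> (\<bar>t\<bar> / P + 1) * c" using k c0 by (intro mult_right_mono) auto
    finally have 1: "\<bar>f t\<bar> \<le> b + (\<bar>t\<bar> / P + 1) * c" using b[OF r] by linarith
    have "K * (1 + \<bar>t\<bar>) = b + (\<bar>t\<bar> / P + 1) * c + (b * \<bar>t\<bar> + c / P + c * \<bar>t\<bar>)"
      using P by (simp add: K_def field_simps)
    moreover have "0 \<le> b * \<bar>t\<bar> + c / P + c * \<bar>t\<bar>" using b0 c0 P by simp
    ultimately show ?thesis using 1 by linarith
  qed
  then show ?thesis by blast
qed

context delaunay_ode
begin

definition jacobi :: "(real \<Rightarrow> real) \<Rightarrow> (nat \<Rightarrow> real \<Rightarrow> real) \<Rightarrow> bool" where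
  "jacobi q f \<longleftrightarrow> tower f \<and> (\<forall>t. f 4 t = A * f 2 t - B * f 0 t + q t * f 0 t)"

lemma symplectic_pairing_deriv:
  assumes f: "tower f" and g: "tower g"
  shows "(symplectic_pairing A f g has_real_derivative
    f 0 t * (g 4 t - A * g 2 t) - (f 4 t - A * f 2 t) * g 0 t) (at t)"
proof -
  have "(symplectic_pairing A f g has_real_derivative
    (f 1 t * g 3 t + f 0 t * g 4 t) - (f 2 t * g 2 t + f 1 t * g 3 t) + (f 3 t * g 1 t + f 2 t * g 2 t)
    - (f 4 t * g 0 t + f 3 t * g 1 t) - A * ((f 1 t * g 1 t + f 0 t * g 2 t) - (f 2 t * g 0 t + f 1 t * g 1 t))) (at t)"
    unfolding symplectic_pairing_def[abs_def]
    by (auto intro!: derivative_eq_intros tower_derivs[OF f] tower_derivs[OF g] simp: algebra_simps simp del: One_nat_def)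
  then show ?thesis by (simp add: algebra_simps)
qed

lemma symplectic_pairing_constant:
  assumes f: "jacobi q f" and g: "jacobi q g" shows "symplectic_pairing A f g t = symplectic_pairing A f g s"
proof -
  have "(symplectic_pairing A f g has_real_derivative 0) (at t)" for t
    using symplectic_pairing_deriv[of f g t] f g unfolding jacobi_def by (simp add: algebra_simps)
  then show ?thesis using DERIV_isconst_all by blast
qed

lemma jacobi_lincomb:
  assumes "jacobi q f" "jacobi q g" shows "jacobi q (\<lambda>i t. a * f i t + b * g i t)"
  unfolding jacobi_def
proof (intro conjI allI)
  show "tower (\<lambda>i t. a * f i t + b * g i t)"
    using assms tower_lincomb unfolding jacobi_def by blast
  fix t
  have "f 4 t = A * f 2 t - B * f 0 t + q t * f 0 t" "g 4 t = A * g 2 t - B * g 0 t + q t * g 0 t"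
    using assms unfolding jacobi_def by auto
  then show "a * f 4 t + b * g 4 t = A * (a * f 2 t + b * g 2 t) - B * (a * f 0 t + b * g 0 t)
      + q t * (a * f 0 t + b * g 0 t)"
    by (simp only:) (simp add: algebra_simps)
qed

lemma jacobi_driven:
  assumes f: "jacobi q f" and q: "\<And>t. 0 \<le> q t" "\<And>t. q t \<le> Q"
  shows "driven f"
  unfolding driven_def using f q unfolding jacobi_def by blast

definition linearized_potential :: "(nat \<Rightarrow> real \<Rightarrow> real) \<Rightarrow> real \<Rightarrow> real" where
  "linearized_potential v t = C * p * v 0 t powr (p - 1)"

lemma linearized_potential_bounds: "\<exists>Q\<ge>0. \<forall>e v t. delaunay e v \<longrightarrow> 0 \<le> linearized_potential v t \<and> linearized_potential v t \<le> Q"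
proof -
  obtain M where M: "\<And>e v t. delaunay e v \<Longrightarrow> v 0 t \<le> M" using delaunay_uniform_bound by blast
  have "linearized_potential v t \<le> C * p * M powr (p - 1)" if "delaunay e v" for e v t
    unfolding linearized_potential_def using M[OF that, of t] delaunay_pos[OF that, of t] C p
    by (intro mult_left_mono powr_mono2) auto
  moreover have "0 \<le> linearized_potential v t" for v t
    unfolding linearized_potential_def using C p by simp
  moreover have "C * p * M powr (p - 1) \<ge> 0" using C p by simp
  ultimately show ?thesis by blast
qed

lemma delaunay_jacobi_driven:
  assumes "delaunay e v" "jacobi (linearized_potential v) f" shows "driven f"
  using jacobi_driven[OF assms(2)] linearized_potential_bounds assms(1) by blast

text \<open>The derivative \<open>v'\<close>, which solves the linearized equation since the equation is autonomous. Its own fourth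
derivative is written down from the equation, because the tower of \<open>v\<close> ends at \<open>v''''\<close>.\<close>

definition translation_field :: "(nat \<Rightarrow> real \<Rightarrow> real) \<Rightarrow> nat \<Rightarrow> real \<Rightarrow> real" where
  "translation_field v i t = (if i < 4 then v (Suc i) t
     else A * v 3 t - B * v 1 t + linearized_potential v t * v 1 t)"

lemma translation_field_jacobi:
  assumes v: "delaunay e v" shows "jacobi (linearized_potential v) (translation_field v)"
proof -
  note D = tower_derivs[OF delaunay_tower[OF v]]
  have v4: "v 4 = (\<lambda>t. A * v 2 t - B * v 0 t + C * v 0 t powr p)" using delaunay_ode[OF v] by auto
  have "((\<lambda>t. v 0 t powr p) has_real_derivative p * v 0 t powr (p - 1) * v 1 t) (at t)" for t
    by (rule DERIV_chain2[OF has_real_derivative_powr[OF delaunay_pos[OF v]] D(1)])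
  then have 5: "(v 4 has_real_derivative A * v 3 t - B * v 1 t + linearized_potential v t * v 1 t) (at t)" for t
    unfolding v4 linearized_potential_def
    by (auto intro!: derivative_eq_intros D simp: algebra_simps delaunay_pos[OF v] simp del: One_nat_def)
  have low: "translation_field v i = v (Suc i)" if "i < 4" for i
    using that by (simp add: translation_field_def fun_eq_iff)
  have high: "translation_field v 4 = (\<lambda>t. A * v 3 t - B * v 1 t + linearized_potential v t * v 1 t)"
    by (simp add: translation_field_def fun_eq_iff)
  have "tower (translation_field v)"
    unfolding tower_def
  proof (intro allI impI)
    fix i :: nat and t assume i: "i < 4"
    show "(translation_field v i has_real_derivative translation_field v (Suc i) t) (at t)"
    proof (cases "i = 3")
      case True
      then show ?thesis using 5[of t] low[of 3] high by simp
    next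
      case False
      then have "Suc i < 4" using i by simp
      then show ?thesis using low[OF i] low[of "Suc i"] delaunay_tower[OF v] unfolding tower_def by simp
    qed
  qed
  moreover have "v (Suc 0) = v 1" "v (Suc 2) = v 3" by (simp_all add: eval_nat_numeral)
  ultimately show ?thesis unfolding jacobi_def high using low[of 0] low[of 2] by simp
qed

lemma delaunay_even4:
  assumes v: "delaunay e v" and i: "i \<le> 4" shows "v i (- t) = (- 1) ^ i * v i t"
proof (cases "i = 4")
  case True
  have "v 2 (- t) = v 2 t" "v 0 (- t) = v 0 t" using delaunay_even[OF v, of 2 t] delaunay_even[OF v, of 0 t] by auto
  then have "v 4 (- t) = v 4 t"
    unfolding delaunay_ode[OF v, of "- t"] delaunay_ode[OF v, of t] by (simp only:)
  then show ?thesis using True by simp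
qed (use delaunay_even[OF v] i in auto)

end

locale delaunay_family = delaunay_ode +
  fixes V :: "real \<Rightarrow> nat \<Rightarrow> real \<Rightarrow> real"
  assumes family: "\<And>e. 0 < e \<Longrightarrow> e < ebar \<Longrightarrow> delaunay e (V e)"
begin

definition dquot :: "real \<Rightarrow> real \<Rightarrow> nat \<Rightarrow> real \<Rightarrow> real" where
  "dquot e h i t = (V (e + h) i t - V e i t) / h"

text \<open>Increments of the necksize that stay within the family.\<close>

definition step :: "real \<Rightarrow> real \<Rightarrow> bool" where
  "step e h \<longleftrightarrow> 0 < e \<and> e < ebar \<and> h \<noteq> 0 \<and> 0 < e + h \<and> e + h < ebar"

lemma step_delaunay: "step e h \<Longrightarrow> delaunay e (V e)" "step e h \<Longrightarrow> delaunay (e + h) (V (e + h))"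
  using family by (auto simp: step_def)

lemma dquot_tower:
  assumes "step e h" shows "tower (dquot e h)"
proof -
  have "tower (\<lambda>i t. (1 / h) * V (e + h) i t + (- (1 / h)) * V e i t)"
    using step_delaunay[OF assms] by (intro tower_lincomb delaunay_tower)
  moreover have "(\<lambda>i t. (1 / h) * V (e + h) i t + (- (1 / h)) * V e i t) = dquot e h"
    by (auto simp: dquot_def fun_eq_iff diff_divide_distrib)
  ultimately show ?thesis by simp
qed

lemma dquot_init:
  assumes h: "step e h"
  shows "dquot e h 0 0 = 1" "dquot e h 1 0 = 0" "dquot e h 3 0 = 0"
  using h step_delaunay[OF h, THEN delaunay_deriv0] step_delaunay[OF h, THEN delaunay_third0]
    step_delaunay[OF h] unfolding dquot_def delaunay_def step_def by auto

lemma dquot_even: "step e h \<Longrightarrow> i \<le> 4 \<Longrightarrow> dquot e h i (- t) = (- 1) ^ i * dquot e h i t"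
  using step_delaunay[of e h, THEN delaunay_even4[of _ _ i t]] unfolding dquot_def
  by (simp add: algebra_simps diff_divide_distrib)

text \<open>The difference quotient solves the linear equation with a potential that is the linearized one at a point
between the two solutions.\<close>

lemma dquot_equation:
  assumes h: "step e h"
  shows "\<exists>\<xi>. min (V (e + h) 0 t) (V e 0 t) \<le> \<xi> \<and> \<xi> \<le> max (V (e + h) 0 t) (V e 0 t) \<and>
    dquot e h 4 t = A * dquot e h 2 t - B * dquot e h 0 t + C * p * \<xi> powr (p - 1) * dquot e h 0 t"
proof -
  note v = step_delaunay[OF h]
  obtain \<xi> where \<xi>: "min (V (e + h) 0 t) (V e 0 t) \<le> \<xi>" "\<xi> \<le> max (V (e + h) 0 t) (V e 0 t)"
    "V (e + h) 0 t powr p - V e 0 t powr p = p * \<xi> powr (p - 1) * (V (e + h) 0 t - V e 0 t)"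
    using powr_difference_quotient[OF p] v delaunay_pos by (meson less_imp_le)
  have diff4: "V (e + h) 4 t - V e 4 t = A * (V (e + h) 2 t - V e 2 t) - B * (V (e + h) 0 t - V e 0 t)
      + C * (V (e + h) 0 t powr p - V e 0 t powr p)"
    unfolding delaunay_ode[OF v(1)] delaunay_ode[OF v(2)] by (simp add: algebra_simps)
  then have "(V (e + h) 4 t - V e 4 t) / h = (A * (V (e + h) 2 t - V e 2 t) - B * (V (e + h) 0 t - V e 0 t)
      + C * (p * \<xi> powr (p - 1) * (V (e + h) 0 t - V e 0 t))) / h" unfolding \<xi>(3) by simp
  then have "dquot e h 4 t = A * dquot e h 2 t - B * dquot e h 0 t + C * p * \<xi> powr (p - 1) * dquot e h 0 t"
    unfolding dquot_def by (simp only: add_divide_distrib diff_divide_distrib[of "_ * _"] times_divide_eq_right mult.assoc)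
  then show ?thesis using \<xi> by blast
qed

lemma dquot_equation_bound:
  "\<exists>Q\<ge>0. \<forall>e h t. step e h \<longrightarrow> (\<exists>q. 0 \<le> q \<and> q \<le> Q \<and>
     dquot e h 4 t = A * dquot e h 2 t - B * dquot e h 0 t + q * dquot e h 0 t)"
proof -
  obtain M where M: "\<And>e v t. delaunay e v \<Longrightarrow> v 0 t \<le> M" using delaunay_uniform_bound by blast
  have "\<exists>q. 0 \<le> q \<and> q \<le> C * p * M powr (p - 1) \<and>
     dquot e h 4 t = A * dquot e h 2 t - B * dquot e h 0 t + q * dquot e h 0 t" if h: "step e h" for e h t
  proof -
    note v = step_delaunay[OF h]
    obtain \<xi> where \<xi>: "min (V (e + h) 0 t) (V e 0 t) \<le> \<xi>" "\<xi> \<le> max (V (e + h) 0 t) (V e 0 t)"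
      "dquot e h 4 t = A * dquot e h 2 t - B * dquot e h 0 t + C * p * \<xi> powr (p - 1) * dquot e h 0 t"
      using dquot_equation[OF h] by blast
    have "0 \<le> \<xi>" "\<xi> \<le> M" using \<xi>(1,2) M[OF v(1), of t] M[OF v(2), of t]
        delaunay_pos[OF v(1), of t] delaunay_pos[OF v(2), of t] by linarith+
    then have "\<xi> powr (p - 1) \<le> M powr (p - 1)" using p by (intro powr_mono2) auto
    then show ?thesis using \<xi>(3) C p by (intro exI[of _ "C * p * \<xi> powr (p - 1)"]) auto
  qed
  moreover have "C * p * M powr (p - 1) \<ge> 0" using C p by simp
  ultimately show ?thesis by blast
qed

lemma dquot_bound:
  "\<exists>K>0. \<exists>\<nu>\<ge>0. \<forall>e h i t. step e h \<and> i < 4 \<longrightarrow> \<bar>dquot e h i t\<bar> \<le> K * exp (\<nu> * \<bar>t\<bar>)"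
proof -
  obtain Q where Q: "Q \<ge> 0" "\<And>e h t. step e h \<Longrightarrow> (\<exists>q. 0 \<le> q \<and> q \<le> Q \<and>
     dquot e h 4 t = A * dquot e h 2 t - B * dquot e h 0 t + q * dquot e h 0 t)"
    using dquot_equation_bound by blast
  obtain K where K: "K > 0" "\<And>e1 v1 e2 v2. delaunay e1 v1 \<Longrightarrow> delaunay e2 v2 \<Longrightarrow>
      \<bar>v1 2 0 - v2 2 0\<bar> \<le> K * \<bar>e1 - e2\<bar>" using second0_lipschitz by blast
  define k where "k = A + B + Q"
  have k: "k \<ge> 0" using A_pos B_pos Q by (simp add: k_def)
  have fwd: "\<bar>dquot e h i t\<bar> \<le> (K + 2) * exp ((4 * k + 1) * t)" if h: "step e h" and i: "i < 4" and t: "t \<ge> 0" for e h i t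
  proof -
    have "\<bar>dquot e h i t\<bar> < (K + 2) * exp ((4 * k + 1) * (t - 0))"
    proof (rule gronwall_tower[OF dquot_tower[OF h] k, of 0 "K + 2" 0 t])
      fix r :: real
      obtain q where q: "0 \<le> q" "q \<le> Q" "dquot e h 4 r = A * dquot e h 2 r - B * dquot e h 0 r + q * dquot e h 0 r"
        using Q(2)[OF h] by blast
      have "\<bar>dquot e h 4 r\<bar> \<le> A * \<bar>dquot e h 2 r\<bar> + B * \<bar>dquot e h 0 r\<bar> + q * \<bar>dquot e h 0 r\<bar>"
      proof -
        have "\<bar>A * dquot e h 2 r\<bar> = A * \<bar>dquot e h 2 r\<bar>" "\<bar>B * dquot e h 0 r\<bar> = B * \<bar>dquot e h 0 r\<bar>"
          "\<bar>q * dquot e h 0 r\<bar> = q * \<bar>dquot e h 0 r\<bar>" using A_pos B_pos q(1) by (simp_all add: abs_mult)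
        then show ?thesis unfolding q(3) by linarith
      qed
      also have "\<dots> \<le> k * \<bar>dquot e h 2 r\<bar> + k * \<bar>dquot e h 0 r\<bar>"
      proof -
        have "A * \<bar>dquot e h 2 r\<bar> \<le> k * \<bar>dquot e h 2 r\<bar>"
          using B_pos Q by (intro mult_right_mono) (auto simp: k_def)
        moreover have "(B + q) * \<bar>dquot e h 0 r\<bar> \<le> k * \<bar>dquot e h 0 r\<bar>"
          using A_pos q by (intro mult_right_mono) (auto simp: k_def)
        ultimately show ?thesis by (simp add: algebra_simps)
      qed
      also have "\<dots> \<le> k * (\<bar>dquot e h 0 r\<bar> + \<bar>dquot e h 1 r\<bar> + \<bar>dquot e h 2 r\<bar> + \<bar>dquot e h 3 r\<bar>)"
        using k by (simp add: algebra_simps)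
      finally show "\<bar>dquot e h 4 r\<bar> \<le> k * (\<bar>dquot e h 0 r\<bar> + \<bar>dquot e h 1 r\<bar> + \<bar>dquot e h 2 r\<bar> + \<bar>dquot e h 3 r\<bar>) + 0"
        by simp
    next
      have "\<bar>dquot e h 2 0\<bar> \<le> K"
        using K(2)[OF step_delaunay(2)[OF h] step_delaunay(1)[OF h]] h
        by (simp add: dquot_def step_def field_simps)
      then show "\<bar>dquot e h j 0\<bar> < K + 2" if "j < 4" for j
        using that dquot_init[OF h] K(1) unfolding less_4_cases by auto
    qed (use K i t in auto)
    then show ?thesis by simp
  qed
  have "\<bar>dquot e h i t\<bar> \<le> (K + 2) * exp ((4 * k + 1) * \<bar>t\<bar>)" if h: "step e h" and i: "i < 4" for e h i t
  proof (cases "t \<ge> 0")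
    case True then show ?thesis using fwd[OF h i] by simp
  next
    case False
    have "\<bar>dquot e h i (- (- t))\<bar> = \<bar>dquot e h i (- t)\<bar>"
      unfolding dquot_even[OF h less_imp_le[OF i], of "- t"] by (simp add: abs_mult)
    then show ?thesis using fwd[OF h i, of "- t"] False by simp
  qed
  moreover have "K + 2 > 0" "4 * k + 1 \<ge> 0" using K k by auto
  ultimately show ?thesis by blast
qed

text \<open>The potentials of two difference quotients differ little if the increments are small, since both are close
to the linearized potential; the Gronwall estimate then compares the quotients by their
second derivatives at \<open>0\<close>, the only free initial value.\<close>

lemma dquot_close:
  assumes e: "0 < e" "e < ebar" and \<delta>: "\<delta> > 0" and T: "T \<ge> 0"
  shows "\<exists>\<eta>>0. \<forall>h h' i t. step e h \<and> step e h' \<and> \<bar>h\<bar> < \<eta> \<and> \<bar>h'\<bar> < \<eta> \<and>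
    \<bar>dquot e h 2 0 - dquot e h' 2 0\<bar> < \<eta> \<and> i \<le> 4 \<and> \<bar>t\<bar> \<le> T \<longrightarrow> \<bar>dquot e h i t - dquot e h' i t\<bar> < \<delta>"
proof -
  obtain M where M: "M > 0" "\<And>e v t. delaunay e v \<Longrightarrow> v 0 t \<le> M" using delaunay_uniform_bound by blast
  obtain K \<nu> where K: "K > 0" "\<nu> \<ge> 0" "\<And>e h i t. step e h \<Longrightarrow> i < 4 \<Longrightarrow> \<bar>dquot e h i t\<bar> \<le> K * exp (\<nu> * \<bar>t\<bar>)"
    using dquot_bound by blast
  define KT where "KT = K * exp (\<nu> * T)"
  have KT: "KT > 0" using K by (simp add: KT_def)
  have KTb: "\<bar>dquot e h i t\<bar> \<le> KT" if "step e h" "i < 4" "\<bar>t\<bar> \<le> T" for h i t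
  proof -
    have "K * exp (\<nu> * \<bar>t\<bar>) \<le> KT" unfolding KT_def using K(1,2) that by (simp add: mult_left_mono)
    then show ?thesis using K(3)[of e h i t] that by linarith
  qed
  define Q where "Q = C * p * M powr (p - 1)"
  define k where "k = A + B + Q"
  have Q: "Q \<ge> 0" using C p by (simp add: Q_def)
  have k: "k > 0" using A_pos B_pos Q by (simp add: k_def)
  \<comment> \<open>With this choice closeness of the first four components also gives closeness of the fourth derivative, by the equation.\<close>
  define \<delta>' where "\<delta>' = \<delta> / (4 * k + 2)"
  have \<delta>': "\<delta>' > 0" "(4 * k + 1) * \<delta>' < \<delta>" "\<delta>' < \<delta>"
  proof -
    show "\<delta>' > 0" using \<delta> k by (simp add: \<delta>'_def)
    moreover have "(4 * k + 2) * \<delta>' = \<delta>" using k by (simp add: \<delta>'_def)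
    moreover have "k * \<delta>' > 0" using calculation(1) k by simp
    ultimately show "(4 * k + 1) * \<delta>' < \<delta>" "\<delta>' < \<delta>" by (auto simp: algebra_simps)
  qed
  define m where "m = \<delta>' / exp ((4 * k + 1) * T)"
  have m: "m > 0" "m * exp ((4 * k + 1) * T) = \<delta>'" using \<delta>' by (auto simp: m_def)
  have m\<delta>: "m \<le> \<delta>'"
  proof -
    have "m * 1 \<le> m * exp ((4 * k + 1) * T)" using m(1) k T by (intro mult_left_mono) auto
    then show ?thesis using m(2) by simp
  qed
  define \<delta>1 where "\<delta>1 = m / (2 * C * p * KT)"
  have \<delta>1: "\<delta>1 > 0" "C * p * (2 * \<delta>1) * KT = m" using m C p KT by (auto simp: \<delta>1_def)
  have "uniformly_continuous_on {0..M} (\<lambda>x. x powr (p - 1))"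
    using p by (intro compact_uniformly_continuous continuous_on_powr') (auto intro!: continuous_intros)
  then obtain d where d: "d > 0" "\<And>x y. x \<in> {0..M} \<Longrightarrow> y \<in> {0..M} \<Longrightarrow> \<bar>y - x\<bar> < d \<Longrightarrow>
      \<bar>y powr (p - 1) - x powr (p - 1)\<bar> < \<delta>1"
    using \<delta>1(1) unfolding uniformly_continuous_on_def dist_real_def by metis
  define \<eta> where "\<eta> = min m (d / KT)"
  have \<eta>: "\<eta> > 0" using m d KT by (simp add: \<eta>_def)
  have near: "\<exists>q. 0 \<le> q \<and> q \<le> Q \<and> \<bar>q - linearized_potential (V e) t\<bar> \<le> C * p * \<delta>1 \<and>
      dquot e h 4 t = A * dquot e h 2 t - B * dquot e h 0 t + q * dquot e h 0 t"
    if h: "step e h" "\<bar>h\<bar> < \<eta>" and t: "\<bar>t\<bar> \<le> T" for h t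
  proof -
    note v = step_delaunay[OF h(1)]
    obtain \<xi> where \<xi>: "min (V (e + h) 0 t) (V e 0 t) \<le> \<xi>" "\<xi> \<le> max (V (e + h) 0 t) (V e 0 t)"
      "dquot e h 4 t = A * dquot e h 2 t - B * dquot e h 0 t + C * p * \<xi> powr (p - 1) * dquot e h 0 t"
      using dquot_equation[OF h(1)] by blast
    have in_range: "0 \<le> \<xi>" "\<xi> \<le> M" "0 \<le> V e 0 t" "V e 0 t \<le> M"
      using \<xi>(1,2) M(2)[OF v(1), of t] M(2)[OF v(2), of t]
        delaunay_pos[OF v(1), of t] delaunay_pos[OF v(2), of t] by linarith+
    have "\<bar>\<xi> - V e 0 t\<bar> \<le> \<bar>V (e + h) 0 t - V e 0 t\<bar>" using \<xi>(1,2) by linarith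
    also have "\<dots> = \<bar>h\<bar> * \<bar>dquot e h 0 t\<bar>" using h by (simp add: dquot_def step_def)
    also have "\<dots> \<le> \<bar>h\<bar> * KT" using KTb[OF h(1), of 0 t] t by (intro mult_left_mono) auto
    also have "\<dots> < (d / KT) * KT" using h(2) KT unfolding \<eta>_def by (intro mult_strict_right_mono) auto
    finally have "\<bar>\<xi> - V e 0 t\<bar> < d" using KT by simp
    then have "\<bar>\<xi> powr (p - 1) - V e 0 t powr (p - 1)\<bar> < \<delta>1" using d(2) in_range by simp
    then have "C * p * \<bar>\<xi> powr (p - 1) - V e 0 t powr (p - 1)\<bar> \<le> C * p * \<delta>1" using C p by simp
    then have "\<bar>C * p * \<xi> powr (p - 1) - linearized_potential (V e) t\<bar> \<le> C * p * \<delta>1"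
      using C p by (simp add: linearized_potential_def right_diff_distrib[symmetric] abs_mult)
    moreover have "\<xi> powr (p - 1) \<le> M powr (p - 1)" using p in_range by (intro powr_mono2) auto
    ultimately show ?thesis using \<xi>(3) C p
      by (intro exI[of _ "C * p * \<xi> powr (p - 1)"]) (auto simp: Q_def)
  qed
  have fwd: "\<bar>dquot e h i t - dquot e h' i t\<bar> < \<delta>"
    if h: "step e h" "step e h'" "\<bar>h\<bar> < \<eta>" "\<bar>h'\<bar> < \<eta>" "\<bar>dquot e h 2 0 - dquot e h' 2 0\<bar> < \<eta>"
      and i: "i \<le> 4" and t: "0 \<le> t" "t \<le> T" for h h' i t
  proof -
    define w where "w = (\<lambda>i t. dquot e h i t - dquot e h' i t)"
    have tow: "tower w" unfolding w_def by (intro tower_diff dquot_tower h)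
    have eq: "\<bar>w 4 r\<bar> \<le> k * (\<bar>w 0 r\<bar> + \<bar>w 1 r\<bar> + \<bar>w 2 r\<bar> + \<bar>w 3 r\<bar>) + m" if r: "0 \<le> r" "r \<le> T" for r
    proof -
      have rT: "\<bar>r\<bar> \<le> T" using r by simp
      obtain q where q: "0 \<le> q" "q \<le> Q" "\<bar>q - linearized_potential (V e) r\<bar> \<le> C * p * \<delta>1"
        "dquot e h 4 r = A * dquot e h 2 r - B * dquot e h 0 r + q * dquot e h 0 r"
        using near[OF h(1,3) rT] by blast
      obtain q' where q': "\<bar>q' - linearized_potential (V e) r\<bar> \<le> C * p * \<delta>1"
        "dquot e h' 4 r = A * dquot e h' 2 r - B * dquot e h' 0 r + q' * dquot e h' 0 r"
        using near[OF h(2,4) rT] by blast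
      have "w 4 r = A * w 2 r - B * w 0 r + q * w 0 r + (q - q') * dquot e h' 0 r"
        unfolding w_def q(4) q'(2) by (simp add: algebra_simps)
      then have "\<bar>w 4 r\<bar> \<le> \<bar>A * w 2 r\<bar> + \<bar>B * w 0 r\<bar> + \<bar>q * w 0 r\<bar> + \<bar>(q - q') * dquot e h' 0 r\<bar>" by linarith
      moreover have "\<bar>A * w 2 r\<bar> \<le> k * \<bar>w 2 r\<bar>"
        using A_pos B_pos Q by (auto simp: abs_mult k_def intro!: mult_right_mono)
      moreover have "\<bar>B * w 0 r\<bar> + \<bar>q * w 0 r\<bar> \<le> k * \<bar>w 0 r\<bar>"
      proof -
        have "(B + q) * \<bar>w 0 r\<bar> \<le> k * \<bar>w 0 r\<bar>"
          using A_pos q by (intro mult_right_mono) (auto simp: k_def)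
        then show ?thesis using B_pos q by (simp add: abs_mult algebra_simps)
      qed
      moreover have "\<bar>(q - q') * dquot e h' 0 r\<bar> \<le> m"
      proof -
        have "\<bar>q - q'\<bar> \<le> C * p * (2 * \<delta>1)" using q(3) q'(1) by (simp add: algebra_simps)
        then have "\<bar>q - q'\<bar> * \<bar>dquot e h' 0 r\<bar> \<le> C * p * (2 * \<delta>1) * KT"
          using KTb[OF h(2), of 0 r] rT C p \<delta>1 by (intro mult_mono) auto
        then show ?thesis using \<delta>1 by (simp add: abs_mult)
      qed
      moreover have "k * \<bar>w 1 r\<bar> \<ge> 0" "k * \<bar>w 3 r\<bar> \<ge> 0" using k by auto
      ultimately show ?thesis unfolding distrib_left by linarith
    qed
    have low: "\<bar>w j r\<bar> < \<delta>'" if j: "j < 4" and r: "0 \<le> r" "r \<le> T" for j r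
    proof -
      have "\<bar>w j r\<bar> < m * exp ((4 * k + 1) * (r - 0))"
      proof (rule gronwall_tower[OF tow _ _ _ eq, of m 0 T])
        show "\<bar>w j 0\<bar> < m" if "j < 4" for j
          using that h(5) m dquot_init[OF h(1)] dquot_init[OF h(2)] unfolding less_4_cases w_def \<eta>_def by auto
      qed (use k m j r in auto)
      also have "\<dots> \<le> m * exp ((4 * k + 1) * T)" using m(1) k r by (intro mult_left_mono) auto
      finally show ?thesis using m(2) by simp
    qed
    show ?thesis
    proof (cases "i = 4")
      case True
      have "k * (\<bar>w 0 t\<bar> + \<bar>w 1 t\<bar> + \<bar>w 2 t\<bar> + \<bar>w 3 t\<bar>) \<le> k * (4 * \<delta>')"
        using low[of 0 t] low[of 1 t] low[of 2 t] low[of 3 t] t k by (intro mult_left_mono) auto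
      then have "\<bar>w 4 t\<bar> \<le> (4 * k + 1) * \<delta>'" using eq[OF t] m\<delta> by (simp add: algebra_simps)
      then show ?thesis using \<delta>'(2) True by (simp add: w_def)
    next
      case False
      then show ?thesis using low[of i t] i t \<delta>'(3) by (simp add: w_def)
    qed
  qed
  have "\<bar>dquot e h i t - dquot e h' i t\<bar> < \<delta>"
    if h: "step e h" "step e h'" "\<bar>h\<bar> < \<eta>" "\<bar>h'\<bar> < \<eta>" "\<bar>dquot e h 2 0 - dquot e h' 2 0\<bar> < \<eta>"
      and i: "i \<le> 4" and t: "\<bar>t\<bar> \<le> T" for h h' i t
  proof (cases "t \<ge> 0")
    case True then show ?thesis using fwd[OF h i] t by simp
  next
    case False
    have "dquot e h i t = (- 1) ^ i * dquot e h i (- t)" "dquot e h' i t = (- 1) ^ i * dquot e h' i (- t)"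
      using dquot_even[OF h(1) i, of "- t"] dquot_even[OF h(2) i, of "- t"] by simp_all
    then have "dquot e h i t - dquot e h' i t = (- 1) ^ i * (dquot e h i (- t) - dquot e h' i (- t))"
      by (simp only: right_diff_distrib)
    then have "\<bar>dquot e h i t - dquot e h' i t\<bar> = \<bar>dquot e h i (- t) - dquot e h' i (- t)\<bar>"
      by (simp only: abs_mult power_abs) simp
    then show ?thesis using fwd[OF h i, of "- t"] False t by simp
  qed
  then show ?thesis using \<eta> by blast
qed

end

section \<open>The necksize derivative and its pairing with the translation field\<close>

context delaunay_family
begin

text \<open>The properties that single out \<open>d/de V e\<close>. The value of the second derivative at \<open>0\<close> is
determined by the growth condition.\<close>

definition necksize_field :: "real \<Rightarrow> (nat \<Rightarrow> real \<Rightarrow> real) \<Rightarrow> bool" where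
  "necksize_field e \<phi> \<longleftrightarrow> jacobi (linearized_potential (V e)) \<phi> \<and>
     \<phi> 0 0 = 1 \<and> \<phi> 1 0 = 0 \<and> \<phi> 3 0 = 0 \<and> (\<exists>K. \<forall>t. \<bar>\<phi> 0 t\<bar> \<le> K * (1 + \<bar>t\<bar>))"

lemma necksize_field_unique:
  assumes e: "0 < e" "e < ebar" and f: "necksize_field e f" and g: "necksize_field e g" and i: "i < 4"
  shows "f i t = g i t"
proof -
  define w where "w = (\<lambda>i t. 1 * f i t + (- 1) * g i t)"
  have "jacobi (linearized_potential (V e)) w"
    unfolding w_def using f g by (intro jacobi_lincomb) (auto simp: necksize_field_def)
  then have w: "driven w" by (rule delaunay_jacobi_driven[OF family[OF e]])
  obtain K where K: "\<And>t. \<bar>f 0 t\<bar> \<le> K * (1 + \<bar>t\<bar>)" using f by (auto simp: necksize_field_def)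
  obtain L where L: "\<And>t. \<bar>g 0 t\<bar> \<le> L * (1 + \<bar>t\<bar>)" using g by (auto simp: necksize_field_def)
  have "w i t = 0"
  proof (rule driven_growth[OF w _ _ _ i])
    show "w 0 0 = 0" "w 1 0 = 0" using f g by (auto simp: w_def necksize_field_def)
    show "\<bar>w 0 t\<bar> \<le> (K + L) * (1 + \<bar>t\<bar>)" for t
      using K[of t] L[of t] unfolding w_def distrib_right by linarith
  qed
  then show ?thesis by (simp add: w_def)
qed

text \<open>The maximum is nondegenerate and the solutions depend on the necksize in a Lipschitz way up to
second order, so the critical point moves by at most a multiple of the increment.\<close>

lemma nearby_maximum:
  assumes e: "0 < e" "e < ebar" and \<tau>: "V e 1 \<tau> = 0" "V e 2 \<tau> < 0"
  shows "\<exists>L>0. \<exists>\<eta>>0. \<forall>h. step e h \<and> \<bar>h\<bar> < \<eta> \<longrightarrow> (\<exists>s. \<bar>s - \<tau>\<bar> \<le> L * \<bar>h\<bar> \<and> V (e + h) 1 s = 0)"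
proof -
  obtain K \<nu> where K: "K > 0" "\<nu> \<ge> 0" "\<And>e h i t. step e h \<Longrightarrow> i < 4 \<Longrightarrow> \<bar>dquot e h i t\<bar> \<le> K * exp (\<nu> * \<bar>t\<bar>)"
    using dquot_bound by blast
  define K1 where "K1 = K * exp (\<nu> * (\<bar>\<tau>\<bar> + 1))"
  have K1: "K1 > 0" using K by (simp add: K1_def)
  have K1b: "\<bar>dquot e h i t\<bar> \<le> K1" if "step e h" "i < 4" "\<bar>t - \<tau>\<bar> \<le> 1" for h i t
  proof -
    have "\<bar>t\<bar> \<le> \<bar>\<tau>\<bar> + 1" using that(3) by linarith
    then have "K * exp (\<nu> * \<bar>t\<bar>) \<le> K1" unfolding K1_def using K(1,2) by (simp add: mult_left_mono)
    then show ?thesis using K(3)[of e h i t] that by linarith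
  qed
  define m where "m = - V e 2 \<tau> / 4"
  have m: "m > 0" using \<tau> by (simp add: m_def)
  have "continuous_on UNIV (V e 2)" using tower_continuous delaunay_tower[OF family[OF e]] by simp
  then have "isCont (V e 2) \<tau>" by (simp add: continuous_on_eq_continuous_at)
  then obtain d where d: "d > 0" "\<And>t. \<bar>t - \<tau>\<bar> < d \<Longrightarrow> \<bar>V e 2 t - V e 2 \<tau>\<bar> < m"
    using m unfolding continuous_at_eps_delta dist_real_def by metis
  define \<delta> where "\<delta> = min 1 (d / 2)"
  have \<delta>: "0 < \<delta>" "\<delta> \<le> 1" "\<delta> < d" using d by (auto simp: \<delta>_def)
  define L where "L = K1 / m"
  have L: "L > 0" "m * L = K1" using K1 m by (auto simp: L_def)
  define \<eta> where "\<eta> = min (m / K1) (\<delta> / L)"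
  have \<eta>: "\<eta> > 0" using m K1 \<delta> L by (simp add: \<eta>_def)
  have "\<exists>s. \<bar>s - \<tau>\<bar> \<le> L * \<bar>h\<bar> \<and> V (e + h) 1 s = 0" if h: "step e h" "\<bar>h\<bar> < \<eta>" for h
  proof -
    have h0: "h \<noteq> 0" using h by (simp add: step_def)
    have Vh: "V (e + h) i t = V e i t + h * dquot e h i t" for i t
      using h0 by (simp add: dquot_def)
    have tow: "tower (V (e + h))" by (rule delaunay_tower[OF step_delaunay(2)[OF h(1)]])
    have hK: "\<bar>h\<bar> * K1 \<le> m" using h(2) K1 by (simp add: \<eta>_def pos_less_divide_eq)
    have hL: "L * \<bar>h\<bar> \<le> \<delta>" using h(2) L by (simp add: \<eta>_def pos_less_divide_eq mult.commute)
    have hL0: "L * \<bar>h\<bar> > 0" using L h0 by simp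
    have v2: "- V (e + h) 2 t \<ge> m" if t: "\<bar>t - \<tau>\<bar> \<le> L * \<bar>h\<bar>" for t
    proof -
      have "\<bar>V e 2 t - V e 2 \<tau>\<bar> < m" using d(2)[of t] t hL \<delta> by linarith
      moreover have "\<bar>h * dquot e h 2 t\<bar> \<le> \<bar>h\<bar> * K1"
        unfolding abs_mult using K1b[OF h(1), of 2 t] t hL \<delta> by (intro mult_left_mono) auto
      moreover have "V e 2 \<tau> = - 4 * m" by (simp add: m_def)
      ultimately show ?thesis using hK unfolding Vh by linarith
    qed
    have at: "\<bar>V (e + h) 1 \<tau>\<bar> \<le> m * (L * \<bar>h\<bar>)"
    proof -
      have "\<bar>h * dquot e h 1 \<tau>\<bar> \<le> \<bar>h\<bar> * K1"
        unfolding abs_mult using K1b[OF h(1), of 1 \<tau>] by (intro mult_left_mono) auto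
      then show ?thesis using \<tau>(1) L(2) unfolding Vh by (simp add: mult.assoc[symmetric] mult.commute)
    qed
    have der: "((\<lambda>t. - V (e + h) 1 t) has_real_derivative - V (e + h) 2 t) (at t)" for t
      by (auto intro!: derivative_eq_intros tower_derivs[OF tow] simp del: One_nat_def)
    have "- V (e + h) 1 (\<tau> - L * \<bar>h\<bar>) + m * (\<tau> - (\<tau> - L * \<bar>h\<bar>)) \<le> - V (e + h) 1 \<tau>"
      by (rule linear_lower_bound[where f' = "\<lambda>t. - V (e + h) 2 t"]) (use hL0 der v2 in auto)
    then have left: "V (e + h) 1 (\<tau> - L * \<bar>h\<bar>) \<ge> 0" using at by (simp add: abs_le_iff)
    have "- V (e + h) 1 \<tau> + m * ((\<tau> + L * \<bar>h\<bar>) - \<tau>) \<le> - V (e + h) 1 (\<tau> + L * \<bar>h\<bar>)"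
      by (rule linear_lower_bound[where f' = "\<lambda>t. - V (e + h) 2 t"]) (use hL0 der v2 in auto)
    then have right: "V (e + h) 1 (\<tau> + L * \<bar>h\<bar>) \<le> 0" using at by (simp add: abs_le_iff)
    obtain s where "\<tau> - L * \<bar>h\<bar> \<le> s" "s \<le> \<tau> + L * \<bar>h\<bar>" "V (e + h) 1 s = 0"
      using IVT2'[of "V (e + h) 1" "\<tau> + L * \<bar>h\<bar>" 0 "\<tau> - L * \<bar>h\<bar>"] left right hL0 tower_continuous[OF tow]
      by auto
    then show ?thesis by (intro exI[of _ s]) (auto simp: abs_le_iff)
  qed
  then show ?thesis using L \<eta> by blast
qed

text \<open>The solution of necksize \<open>e + h\<close> has the period \<open>2 s\<close> with \<open>|s - \<tau>| \<le> L |h|\<close>. Over the period \<open>2 \<tau>\<close>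
of the unperturbed solution the difference quotient hence changes by at most \<open>2 L sup |v'|\<close>, in the limit.\<close>

lemma dquot_limit_growth:
  assumes e: "0 < e" "e < ebar" and h: "\<And>n. step e (h n)" "h \<longlonglongrightarrow> 0"
    and lim: "\<And>t. (\<lambda>n. dquot e (h n) 0 t) \<longlonglongrightarrow> f t" and cont: "continuous_on UNIV f"
  shows "\<exists>K. \<forall>t. \<bar>f t\<bar> \<le> K * (1 + \<bar>t\<bar>)"
proof -
  have v: "delaunay e (V e)" by (rule family[OF e])
  obtain \<tau> where \<tau>: "\<tau> > 0" "V e 1 \<tau> = 0" "V e 2 \<tau> < 0" using delaunay_first_maximum[OF v] by blast
  obtain L \<eta> where L: "L > 0" "\<eta> > 0"
    "\<And>h. step e h \<Longrightarrow> \<bar>h\<bar> < \<eta> \<Longrightarrow> \<exists>s. \<bar>s - \<tau>\<bar> \<le> L * \<bar>h\<bar> \<and> V (e + h) 1 s = 0"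
    using nearby_maximum[OF e \<tau>(2,3)] by blast
  obtain K \<nu> where K: "K > 0" "\<nu> \<ge> 0" "\<And>e h i t. step e h \<Longrightarrow> i < 4 \<Longrightarrow> \<bar>dquot e h i t\<bar> \<le> K * exp (\<nu> * \<bar>t\<bar>)"
    using dquot_bound by blast
  have "compact (V e 1 ` {0..2 * \<tau>})"
    by (intro compact_continuous_image tower_continuous delaunay_tower[OF v]) auto
  then obtain S where "\<forall>x\<in>V e 1 ` {0..2 * \<tau>}. \<bar>x\<bar> \<le> S"
    using compact_imp_bounded bounded_real by metis
  then have S: "\<bar>V e 1 r\<bar> \<le> S" for r
    using periodic_reduce[of "V e 1" "2 * \<tau>" r] symmetric_imp_periodic[OF v \<tau>(2), of 1] \<tau>(1) by auto
  have diff: "\<bar>f (t + 2 * \<tau>) - f t\<bar> \<le> 2 * L * S" for t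
  proof -
    define R where "R = \<bar>t\<bar> + 2 * \<tau> + 2 * L * \<eta>"
    define KR where "KR = K * exp (\<nu> * R)"
    have bound: "\<bar>dquot e (h n) 0 (t + 2 * \<tau>) - dquot e (h n) 0 t\<bar> \<le> 2 * L * (S + \<bar>h n\<bar> * KR)"
      if n: "\<bar>h n\<bar> < \<eta>" for n
    proof -
      define k where "k = h n"
      have k: "step e k" "\<bar>k\<bar> < \<eta>" "k \<noteq> 0" using h(1)[of n] n by (auto simp: k_def step_def)
      obtain s where s: "\<bar>s - \<tau>\<bar> \<le> L * \<bar>k\<bar>" "V (e + k) 1 s = 0" using L(3)[OF k(1,2)] by blast
      note vk = step_delaunay(2)[OF k(1)]
      have "V (e + k) 0 (t + 2 * s) = V (e + k) 0 t" by (rule symmetric_imp_periodic[OF vk s(2)]) simp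
      moreover have "V e 0 (t + 2 * \<tau>) = V e 0 t" by (rule symmetric_imp_periodic[OF v \<tau>(2)]) simp
      ultimately have "dquot e k 0 (t + 2 * \<tau>) - dquot e k 0 t
          = (V (e + k) 0 (t + 2 * \<tau>) - V (e + k) 0 (t + 2 * s)) / k"
        unfolding dquot_def by (simp add: diff_divide_distrib)
      moreover have "\<bar>V (e + k) 0 (t + 2 * \<tau>) - V (e + k) 0 (t + 2 * s)\<bar>
          \<le> (S + \<bar>k\<bar> * KR) * \<bar>(t + 2 * \<tau>) - (t + 2 * s)\<bar>"
      proof -
        have hk: "L * \<bar>k\<bar> \<le> L * \<eta>" using k L by simp
        define I where "I = {t + 2 * \<tau> - 2 * L * \<bar>k\<bar>..t + 2 * \<tau> + 2 * L * \<bar>k\<bar>}"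
        have der: "(V (e + k) 0 has_field_derivative V (e + k) 1 r) (at r within I)" for r
          using tower_derivs(1)[OF delaunay_tower[OF vk]] has_field_derivative_at_within by blast
        have b: "norm (V (e + k) 1 r) \<le> S + \<bar>k\<bar> * KR" if "r \<in> I" for r
        proof -
          have "\<bar>r\<bar> \<le> R" using that hk L(1) k \<tau>(1) unfolding I_def R_def atLeastAtMost_iff by linarith
          then have "K * exp (\<nu> * \<bar>r\<bar>) \<le> KR" unfolding KR_def using K(1,2) by (simp add: mult_left_mono)
          then have "\<bar>dquot e k 1 r\<bar> \<le> KR" using K(3)[OF k(1), of 1 r] by simp
          then have "\<bar>k * dquot e k 1 r\<bar> \<le> \<bar>k\<bar> * KR" unfolding abs_mult by (intro mult_left_mono) auto
          moreover have "V (e + k) 1 r = V e 1 r + k * dquot e k 1 r" using k(3) by (simp add: dquot_def)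
          ultimately show ?thesis using S[of r] by simp
        qed
        have sI: "t + 2 * \<tau> \<in> I" "t + 2 * s \<in> I"
          using s(1) L(1) unfolding I_def by (simp_all add: abs_le_iff)
        have cv: "convex I" unfolding I_def by simp
        have "norm (V (e + k) 0 (t + 2 * \<tau>) - V (e + k) 0 (t + 2 * s))
            \<le> (S + \<bar>k\<bar> * KR) * norm ((t + 2 * \<tau>) - (t + 2 * s))"
          by (rule field_differentiable_bound[OF cv der b sI(1) sI(2)])
        then show ?thesis by simp
      qed
      moreover have "(S + \<bar>k\<bar> * KR) * \<bar>(t + 2 * \<tau>) - (t + 2 * s)\<bar> \<le> (S + \<bar>k\<bar> * KR) * (2 * (L * \<bar>k\<bar>))"
      proof (rule mult_left_mono)
        show "0 \<le> S + \<bar>k\<bar> * KR" using S[of 0] K by (simp add: KR_def add_nonneg_nonneg)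
        show "\<bar>(t + 2 * \<tau>) - (t + 2 * s)\<bar> \<le> 2 * (L * \<bar>k\<bar>)" using s(1) by linarith
      qed
      ultimately have "dquot e k 0 (t + 2 * \<tau>) - dquot e k 0 t
          = (V (e + k) 0 (t + 2 * \<tau>) - V (e + k) 0 (t + 2 * s)) / k"
        "\<bar>V (e + k) 0 (t + 2 * \<tau>) - V (e + k) 0 (t + 2 * s)\<bar> \<le> (S + \<bar>k\<bar> * KR) * (2 * (L * \<bar>k\<bar>))"
        by linarith+
      then have "\<bar>dquot e k 0 (t + 2 * \<tau>) - dquot e k 0 t\<bar> \<le> (S + \<bar>k\<bar> * KR) * (2 * (L * \<bar>k\<bar>)) / \<bar>k\<bar>"
        by (simp only: abs_divide) (rule divide_right_mono, simp_all)
      also have "\<dots> = 2 * L * (S + \<bar>k\<bar> * KR)" using k(3) by simp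
      finally show ?thesis by (simp add: k_def)
    qed
    have "(\<lambda>n. 2 * L * (S + \<bar>h n\<bar> * KR)) \<longlonglongrightarrow> 2 * L * (S + \<bar>0\<bar> * KR)"
      by (intro tendsto_intros h(2))
    moreover have "(\<lambda>n. \<bar>dquot e (h n) 0 (t + 2 * \<tau>) - dquot e (h n) 0 t\<bar>) \<longlonglongrightarrow> \<bar>f (t + 2 * \<tau>) - f t\<bar>"
      by (intro tendsto_intros lim)
    moreover have "\<forall>\<^sub>F n in sequentially. \<bar>h n\<bar> < \<eta>"
      by (rule order_tendstoD(2)[OF tendsto_rabs_zero[OF h(2)] L(2)])
    then have "\<forall>\<^sub>F n in sequentially. \<bar>dquot e (h n) 0 (t + 2 * \<tau>) - dquot e (h n) 0 t\<bar> \<le> 2 * L * (S + \<bar>h n\<bar> * KR)"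
      by (rule eventually_mono) (rule bound)
    ultimately have "\<bar>f (t + 2 * \<tau>) - f t\<bar> \<le> 2 * L * (S + \<bar>0\<bar> * KR)"
      using tendsto_le[OF sequentially_bot] by blast
    then show ?thesis by simp
  qed
  show ?thesis
    by (rule quasi_periodic_growth[of "2 * \<tau>"]) (use continuous_on_subset[OF cont] \<tau>(1) diff in auto)
qed

text \<open>The second derivatives at \<open>0\<close> of the difference quotients are bounded; along a subsequence on
which they converge the quotients are Cauchy, locally uniformly with four derivatives.\<close>

lemma dquot_subsequence:
  assumes e: "0 < e" "e < ebar" and h: "\<And>n. step e (h n)" "h \<longlonglongrightarrow> 0"
  shows "\<exists>r f. strict_mono r \<and> necksize_field e f \<and> (\<forall>t. (\<lambda>n. dquot e (h (r n)) 0 t) \<longlonglongrightarrow> f 0 t)"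
proof -
  have v: "delaunay e (V e)" by (rule family[OF e])
  obtain K \<nu> where K: "K > 0" "\<nu> \<ge> 0" "\<And>e h i t. step e h \<Longrightarrow> i < 4 \<Longrightarrow> \<bar>dquot e h i t\<bar> \<le> K * exp (\<nu> * \<bar>t\<bar>)"
    using dquot_bound by blast
  have "dquot e (h n) 2 0 \<in> {- K..K}" for n using K(3)[OF h(1)[of n], of 2 0] by (simp add: abs_le_iff)
  then obtain b r where r: "strict_mono r" "((\<lambda>n. dquot e (h n) 2 0) \<circ> r) \<longlonglongrightarrow> b"
    using compact_imp_seq_compact[of "{- K..K}"] unfolding seq_compact_def
    by (metis compact_Icc)
  define k where "k n = h (r n)" for n
  have k: "\<And>n. step e (k n)" "k \<longlonglongrightarrow> 0"
    using h(1) LIMSEQ_subseq_LIMSEQ[OF h(2) r(1)] by (auto simp: k_def[abs_def] o_def)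
  have b: "(\<lambda>n. dquot e (k n) 2 0) \<longlonglongrightarrow> b" using r(2) by (simp add: k_def o_def)
  have "\<exists>g. tower g \<and> (\<forall>i\<le>4. \<forall>t. (\<lambda>n. dquot e (k n) i t) \<longlonglongrightarrow> g i t)"
  proof (rule tower_limit)
    show "tower (dquot e (k n))" for n by (rule dquot_tower[OF k(1)])
    fix T \<delta> :: real and i :: nat assume \<delta>: "\<delta> > 0" and i: "i \<le> 4"
    obtain \<eta> where \<eta>: "\<eta> > 0" "\<And>h h' t. step e h \<Longrightarrow> step e h' \<Longrightarrow> \<bar>h\<bar> < \<eta> \<Longrightarrow> \<bar>h'\<bar> < \<eta> \<Longrightarrow>
      \<bar>dquot e h 2 0 - dquot e h' 2 0\<bar> < \<eta> \<Longrightarrow> \<bar>t\<bar> \<le> \<bar>T\<bar> \<Longrightarrow> \<bar>dquot e h i t - dquot e h' i t\<bar> < \<delta>"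
      using dquot_close[OF e \<delta>, of "\<bar>T\<bar>"] i by (metis abs_ge_zero)
    obtain N1 where N1: "\<And>n. n \<ge> N1 \<Longrightarrow> \<bar>k n\<bar> < \<eta>" using LIMSEQ_D[OF k(2) \<eta>(1)] by auto
    have "Cauchy (\<lambda>n. dquot e (k n) 2 0)" using b by (rule LIMSEQ_imp_Cauchy)
    from CauchyD[OF this \<eta>(1)] obtain N2 where N2: "\<And>m n. m \<ge> N2 \<Longrightarrow> n \<ge> N2 \<Longrightarrow> \<bar>dquot e (k m) 2 0 - dquot e (k n) 2 0\<bar> < \<eta>"
      unfolding real_norm_def by blast
    show "\<exists>N. \<forall>n\<ge>N. \<forall>m\<ge>N. \<forall>t. \<bar>t\<bar> \<le> T \<longrightarrow> \<bar>dquot e (k n) i t - dquot e (k m) i t\<bar> < \<delta>"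
      by (intro exI[of _ "max N1 N2"] allI impI \<eta>(2) k(1) N1 N2) auto
  qed
  then obtain f where f: "tower f" "\<And>i t. i \<le> 4 \<Longrightarrow> (\<lambda>n. dquot e (k n) i t) \<longlonglongrightarrow> f i t" by blast
  have eq: "f 4 t = A * f 2 t - B * f 0 t + linearized_potential (V e) t * f 0 t" for t
  proof -
    have "\<exists>\<xi>. \<forall>n. min (V (e + k n) 0 t) (V e 0 t) \<le> \<xi> n \<and> \<xi> n \<le> max (V (e + k n) 0 t) (V e 0 t) \<and>
      dquot e (k n) 4 t = A * dquot e (k n) 2 t - B * dquot e (k n) 0 t + C * p * \<xi> n powr (p - 1) * dquot e (k n) 0 t"
      using dquot_equation[OF k(1)] by (intro choice) blast
    then obtain \<xi> where \<xi>: "\<And>n. min (V (e + k n) 0 t) (V e 0 t) \<le> \<xi> n" "\<And>n. \<xi> n \<le> max (V (e + k n) 0 t) (V e 0 t)"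
      "\<And>n. dquot e (k n) 4 t = A * dquot e (k n) 2 t - B * dquot e (k n) 0 t + C * p * \<xi> n powr (p - 1) * dquot e (k n) 0 t"
      by blast
    have "(\<lambda>n. V e 0 t + k n * dquot e (k n) 0 t) \<longlonglongrightarrow> V e 0 t + 0 * f 0 t"
      by (intro tendsto_intros k(2) f(2)) simp
    moreover have "V e 0 t + k n * dquot e (k n) 0 t = V (e + k n) 0 t" for n
      using k(1)[of n] by (simp add: dquot_def step_def)
    ultimately have Vk: "(\<lambda>n. V (e + k n) 0 t) \<longlonglongrightarrow> V e 0 t" by simp
    have "\<xi> \<longlonglongrightarrow> V e 0 t"
    proof (rule tendsto_sandwich)
      show "(\<lambda>n. min (V (e + k n) 0 t) (V e 0 t)) \<longlonglongrightarrow> V e 0 t"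
        using tendsto_min[OF Vk tendsto_const[of "V e 0 t"]] by simp
      show "(\<lambda>n. max (V (e + k n) 0 t) (V e 0 t)) \<longlonglongrightarrow> V e 0 t"
        using tendsto_max[OF Vk tendsto_const[of "V e 0 t"]] by simp
    qed (use \<xi> in auto)
    from tendsto_powr[OF this tendsto_const[of "p - 1"]]
    have "(\<lambda>n. \<xi> n powr (p - 1)) \<longlonglongrightarrow> V e 0 t powr (p - 1)"
      using delaunay_pos[OF v, of t] by simp
    then have "(\<lambda>n. A * dquot e (k n) 2 t - B * dquot e (k n) 0 t + C * p * \<xi> n powr (p - 1) * dquot e (k n) 0 t)
       \<longlonglongrightarrow> A * f 2 t - B * f 0 t + C * p * V e 0 t powr (p - 1) * f 0 t"
      by (intro tendsto_add tendsto_diff tendsto_mult tendsto_const f(2)) auto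
    then have "(\<lambda>n. dquot e (k n) 4 t) \<longlonglongrightarrow> A * f 2 t - B * f 0 t + linearized_potential (V e) t * f 0 t"
      unfolding \<xi>(3)[symmetric] linearized_potential_def by (simp add: mult.assoc)
    then show ?thesis using f(2)[of 4 t] LIMSEQ_unique by blast
  qed
  have "f 0 0 = 1" "f 1 0 = 0" "f 3 0 = 0"
    using f(2)[of 0 0] f(2)[of 1 0] f(2)[of 3 0] dquot_init[OF k(1)] by (auto simp: LIMSEQ_const_iff)
  moreover have "\<exists>K. \<forall>t. \<bar>f 0 t\<bar> \<le> K * (1 + \<bar>t\<bar>)"
    by (rule dquot_limit_growth[OF e k]) (use f tower_continuous in auto)
  ultimately have "necksize_field e f" unfolding necksize_field_def jacobi_def using f(1) eq by blast
  then show ?thesis using r(1) f(2)[of 0] unfolding k_def by blast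
qed

lemma necksize_derivative:
  assumes e: "0 < e" "e < ebar"
  shows "\<exists>f. necksize_field e f \<and> (\<forall>t. ((\<lambda>e. V e 0 t) has_real_derivative f 0 t) (at e))"
proof -
  define d where "d = min e (ebar - e) / 2"
  have d: "d > 0" using e by (simp add: d_def)
  have small: "step e h" if "h \<noteq> 0" "\<bar>h\<bar> \<le> d" for h
    using that e d unfolding step_def d_def by (auto simp: abs_le_iff min_def split: if_splits)
  have h0: "(\<lambda>n. d / real (Suc n)) \<longlonglongrightarrow> 0" by (rule LIMSEQ_Suc[OF lim_const_over_n])
  have "step e (d / real (Suc n))" for n
    by (rule small) (use d in \<open>auto simp: divide_le_eq\<close>)
  then obtain f where f: "necksize_field e f" using dquot_subsequence[OF e _ h0] by blast
  have "((\<lambda>h. dquot e h 0 t) \<longlongrightarrow> f 0 t) (at 0)" for t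
  proof (rule ccontr)
    assume "\<not> ?thesis"
    then obtain \<delta> where \<delta>: "\<delta> > 0" "\<And>s. s > 0 \<Longrightarrow> \<exists>h. h \<noteq> 0 \<and> \<bar>h\<bar> < s \<and> \<not> \<bar>dquot e h 0 t - f 0 t\<bar> < \<delta>"
      unfolding LIM_eq by auto
    have "\<exists>h. \<forall>n. h n \<noteq> 0 \<and> \<bar>h n\<bar> < d / real (Suc n) \<and> \<not> \<bar>dquot e (h n) 0 t - f 0 t\<bar> < \<delta>"
      using \<delta>(2) d by (intro choice allI) auto
    then obtain h where h: "\<And>n. h n \<noteq> 0" "\<And>n. \<bar>h n\<bar> < d / real (Suc n)"
      "\<And>n. \<not> \<bar>dquot e (h n) 0 t - f 0 t\<bar> < \<delta>" by blast
    have "d / real (Suc n) \<le> d" for n using d by (auto simp: divide_le_eq)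
    then have st: "step e (h n)" for n using small[of "h n"] h(1,2)[of n] by (meson less_imp_le order_trans)
    have "h \<longlonglongrightarrow> 0" using h0 h(2) by (intro Lim_null_comparison[OF _ h0]) (auto intro!: always_eventually less_imp_le)
    then obtain r g where g: "strict_mono r" "necksize_field e g" "\<And>t. (\<lambda>n. dquot e (h (r n)) 0 t) \<longlonglongrightarrow> g 0 t"
      using dquot_subsequence[where h = h, OF e st] by blast
    have "g 0 t = f 0 t" using necksize_field_unique[OF e g(2) f] by simp
    then obtain n where "\<bar>dquot e (h (r n)) 0 t - f 0 t\<bar> < \<delta>"
      using LIMSEQ_D[OF g(3)[of t] \<delta>(1)] by auto
    then show False using h(3) by blast
  qed
  then have "((\<lambda>e. V e 0 t) has_real_derivative f 0 t) (at e)" for t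
    unfolding DERIV_def dquot_def .
  then show ?thesis using f by blast
qed


text \<open>If the Wronskian vanished at \<open>t\<close>, a nontrivial combination of the two fields would vanish to first order at
\<open>t\<close>, and it has linear growth.\<close>

lemma jacobi_fields_independent:
  assumes e: "0 < e" "e < ebar" and f: "necksize_field e f"
  shows "V e 1 t * f 1 t - V e 2 t * f 0 t \<noteq> 0"
proof
  assume zero: "V e 1 t * f 1 t - V e 2 t * f 0 t = 0"
  have v: "delaunay e (V e)" by (rule family[OF e])
  define q where "q = linearized_potential (V e)"
  define g where "g = translation_field (V e)"
  have g: "jacobi q g" unfolding q_def g_def by (rule translation_field_jacobi[OF v])
  have fj: "jacobi q f" using f by (simp add: necksize_field_def q_def)
  have g01: "g 0 = V e 1" "g 1 = V e 2" "g 2 = V e 3"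
    by (simp_all add: g_def translation_field_def fun_eq_iff eval_nat_numeral)
  obtain \<tau> where \<tau>: "\<tau> > 0" "V e 1 \<tau> = 0" using delaunay_first_maximum[OF v] by blast
  have gper: "V e 1 (r + 2 * \<tau>) - V e 1 r = 0" for r
    using symmetric_imp_periodic[OF v \<tau>(2), of 1 r] by simp
  obtain Kg where Kg: "\<And>r. \<bar>V e 1 r\<bar> \<le> Kg * (1 + \<bar>r\<bar>)"
    using quasi_periodic_growth[of "2 * \<tau>" "V e 1" 0] gper \<tau>(1) tower_continuous[OF delaunay_tower[OF v]] by auto
  obtain Kf where Kf: "\<And>r. \<bar>f 0 r\<bar> \<le> Kf * (1 + \<bar>r\<bar>)" using f by (auto simp: necksize_field_def)
  have second: "V e 2 0 > 0" by (rule delaunay_second0_pos[OF v])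
  have none: "\<alpha> = 0 \<and> \<gamma> = 0" if c: "\<alpha> * V e 1 t + \<gamma> * f 0 t = 0" "\<alpha> * V e 2 t + \<gamma> * f 1 t = 0" for \<alpha> \<gamma>
  proof -
    define w where "w = (\<lambda>i t. \<alpha> * g i t + \<gamma> * f i t)"
    have w: "driven w" unfolding w_def
      by (rule delaunay_jacobi_driven[OF v]) (use jacobi_lincomb[OF g fj] in \<open>simp add: q_def\<close>)
    have "w i r = 0" if i: "i < 4" for i r
    proof (rule driven_growth[OF w _ _ _ i])
      show "w 0 t = 0" "w 1 t = 0" using c by (simp_all add: w_def g01 del: One_nat_def)
      show "\<bar>w 0 r\<bar> \<le> (\<bar>\<alpha>\<bar> * Kg + \<bar>\<gamma>\<bar> * Kf) * (1 + \<bar>r\<bar>)" for r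
      proof -
        have "\<bar>w 0 r\<bar> \<le> \<bar>\<alpha>\<bar> * \<bar>V e 1 r\<bar> + \<bar>\<gamma>\<bar> * \<bar>f 0 r\<bar>"
          unfolding w_def g01 by (metis abs_mult abs_triangle_ineq)
        moreover have "\<bar>\<alpha>\<bar> * \<bar>V e 1 r\<bar> \<le> \<bar>\<alpha>\<bar> * (Kg * (1 + \<bar>r\<bar>))" using Kg by (intro mult_left_mono) auto
        moreover have "\<bar>\<gamma>\<bar> * \<bar>f 0 r\<bar> \<le> \<bar>\<gamma>\<bar> * (Kf * (1 + \<bar>r\<bar>))" using Kf by (intro mult_left_mono) auto
        ultimately show ?thesis by (simp only: distrib_right mult.assoc)
      qed
    qed
    then have "w 0 0 = 0" "w 1 0 = 0" by auto
    then show ?thesis using f second delaunay_deriv0[OF v] by (auto simp: w_def g01 necksize_field_def simp del: One_nat_def)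
  qed
  have "f 0 t = 0 \<and> V e 1 t = 0"
    using none[of "f 0 t" "- V e 1 t"] zero by (auto simp: algebra_simps)
  moreover have "f 1 t = 0 \<and> V e 2 t = 0"
    using none[of "f 1 t" "- V e 2 t"] zero calculation by (auto simp: algebra_simps)
  ultimately show False using none[of 1 0] by simp
qed

text \<open>Let \<open>W\<close> be the Wronskian of \<open>v'\<close> and \<open>f\<close>, and \<open>U = W v'' - W' v' + E v\<close> the Wronskian of \<open>v'\<close>, \<open>f\<close>, \<open>v\<close>, so
that \<open>T v = U / W\<close> for the operator \<open>T\<close> that annihilates \<open>v'\<close> and \<open>f\<close>. If the pairing vanishes,
then \<open>L = T\<^sup>* T\<close> for the linearized operator \<open>L\<close>, and \<open>N = (v U' - v' U) / W\<close> is the boundary term in \<open>N' = v L v - (T v)\<^sup>2\<close>. Here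
\<open>v L v = C (1 - p) v\<^sup>p\<^sup>+\<^sup>1 < 0\<close>, so \<open>N\<close> decreases strictly, but it vanishes at both ends of half
a period by symmetry.\<close>

lemma symplectic_pairing_nonzero:
  assumes e: "0 < e" "e < ebar" and f: "necksize_field e f"
  shows "symplectic_pairing A (translation_field (V e)) f t \<noteq> 0"
proof
  assume zero: "symplectic_pairing A (translation_field (V e)) f t = 0"
  define v where "v = V e"
  define q where "q = linearized_potential v"
  define g where "g = translation_field v"
  have v: "delaunay e v" using family[OF e] by (simp add: v_def)
  have gj: "jacobi q g" unfolding q_def g_def by (rule translation_field_jacobi[OF v])
  have fj: "jacobi q f" using f by (simp add: necksize_field_def q_def v_def)
  have g: "g 0 = v 1" "g 1 = v 2" "g 2 = v 3" "g 3 = v 4"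
    by (simp_all add: g_def translation_field_def fun_eq_iff eval_nat_numeral)
  have "symplectic_pairing A g f s = 0" for s
    using symplectic_pairing_constant[OF gj fj, of s t] zero by (simp add: g_def v_def)
  then have symp: "v 1 s * f 3 s - v 2 s * f 2 s + v 3 s * f 1 s - v 4 s * f 0 s
      - A * (v 1 s * f 1 s - v 2 s * f 0 s) = 0" for s
    by (simp only: symplectic_pairing_def g)
  have ft: "tower f" and gt: "tower g" using fj gj by (auto simp: jacobi_def)
  note D = tower_derivs[OF delaunay_tower[OF v]] tower_derivs[OF ft] tower_derivs(4)[OF gt, unfolded g]
  have f4: "f 4 t = A * f 2 t - B * f 0 t + q t * f 0 t" for t using fj by (simp add: jacobi_def)
  have g4: "g 4 t = A * v 3 t - B * v 1 t + q t * v 1 t" for t using gj g by (simp add: jacobi_def)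
  define W where "W t = v 1 t * f 1 t - v 2 t * f 0 t" for t
  define W1 where "W1 t = v 1 t * f 2 t - v 3 t * f 0 t" for t
  define E where "E t = v 2 t * f 2 t - v 3 t * f 1 t" for t
  define E1 where "E1 t = v 2 t * f 3 t - v 4 t * f 1 t" for t
  define E2 where "E2 t = v 3 t * f 3 t - v 4 t * f 2 t + A * E t - (q t - B) * W t" for t
  define U where "U t = W t * v 2 t - W1 t * v 1 t + E t * v 0 t" for t
  define U1 where "U1 t = W t * v 3 t - (E t + A * W t) * v 1 t + E1 t * v 0 t" for t
  define U2 where "U2 t = W1 t * v 3 t + W t * v 4 t - (E1 t + A * W1 t) * v 1 t - (E t + A * W t) * v 2 t
      + (E2 t * v 0 t + E1 t * v 1 t)" for t
  define N where "N t = (v 0 t * U1 t - v 1 t * U t) / W t" for t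
  have W0: "W t \<noteq> 0" for t using jacobi_fields_independent[OF e f] by (simp add: W_def v_def)
  have DW: "(W has_real_derivative W1 t) (at t)" for t
    unfolding W_def[abs_def] W1_def
    by (auto intro!: derivative_eq_intros D simp: algebra_simps simp del: One_nat_def)
  have DW1: "(W1 has_real_derivative 2 * E t + A * W t) (at t)" for t
  proof -
    have "(W1 has_real_derivative v 2 t * f 2 t + v 1 t * f 3 t - v 4 t * f 0 t - v 3 t * f 1 t) (at t)"
      unfolding W1_def[abs_def]
      by (auto intro!: derivative_eq_intros D simp: algebra_simps simp del: One_nat_def)
    moreover have "v 2 t * f 2 t + v 1 t * f 3 t - v 4 t * f 0 t - v 3 t * f 1 t = 2 * E t + A * W t"
      using symp[of t] by (simp add: E_def W_def algebra_simps)
    ultimately show ?thesis by simp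
  qed
  have DE: "(E has_real_derivative E1 t) (at t)" for t
    unfolding E_def[abs_def] E1_def
    by (auto intro!: derivative_eq_intros D simp: algebra_simps simp del: One_nat_def)
  have DE1: "(E1 has_real_derivative E2 t) (at t)" for t
  proof -
    have "(E1 has_real_derivative v 3 t * f 3 t + v 2 t * f 4 t - g 4 t * f 1 t - v 4 t * f 2 t) (at t)"
      unfolding E1_def[abs_def]
      by (auto intro!: derivative_eq_intros D simp: algebra_simps simp del: One_nat_def)
    moreover have "v 3 t * f 3 t + v 2 t * f 4 t - g 4 t * f 1 t - v 4 t * f 2 t = E2 t"
      unfolding f4 g4 E2_def E_def W_def by (simp add: algebra_simps)
    ultimately show ?thesis by simp
  qed
  have DU: "(U has_real_derivative U1 t) (at t)" for t
  proof -
    have "(U has_real_derivative W1 t * v 2 t + W t * v 3 t - ((2 * E t + A * W t) * v 1 t + W1 t * v 2 t)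
        + (E1 t * v 0 t + E t * v 1 t)) (at t)"
      unfolding U_def[abs_def]
      by (auto intro!: derivative_eq_intros D DW DW1 DE simp: algebra_simps simp del: One_nat_def)
    then show ?thesis by (simp add: U1_def algebra_simps)
  qed
  have DU1: "(U1 has_real_derivative U2 t) (at t)" for t
    unfolding U1_def[abs_def] U2_def
    by (auto intro!: derivative_eq_intros D DW DE DE1 simp: algebra_simps simp del: One_nat_def)
  \<comment> \<open>The Pluecker relation between the two-by-two minors of the jets of the two fields.\<close>
  have plucker: "W t * E2 t = W1 t * E1 t - (E t)^2 - (q t - B) * (W t)^2" for t
  proof -
    have p03: "v 1 t * f 3 t - v 4 t * f 0 t = E t + A * W t"
      using symp[of t] by (simp add: E_def W_def algebra_simps)
    have "W t * (v 3 t * f 3 t - v 4 t * f 2 t) - W1 t * E1 t + (v 1 t * f 3 t - v 4 t * f 0 t) * E t = 0"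
      by (simp add: W_def W1_def E_def E1_def algebra_simps)
    then show ?thesis unfolding p03 E2_def by (simp add: algebra_simps power2_eq_square)
  qed
  define G where "G t = C * (1 - p) * v 0 t powr (p + 1) - (U t / W t)^2" for t
  have DN: "(N has_real_derivative G t) (at t)" for t
  proof -
    define X where "X = (v 1 t * U1 t + v 0 t * U2 t - (v 2 t * U t + v 1 t * U1 t)) * W t
        - (v 0 t * U1 t - v 1 t * U t) * W1 t"
    have "(N has_real_derivative ((v 1 t * U1 t + v 0 t * U2 t - (v 2 t * U t + v 1 t * U1 t)) * W t
        - (v 0 t * U1 t - v 1 t * U t) * W1 t) / (W t * W t)) (at t)"
      unfolding N_def[abs_def]
      by (auto intro!: derivative_eq_intros D DW DU DU1 W0 simp del: One_nat_def)
    then have der: "(N has_real_derivative X / (W t * W t)) (at t)" by (simp only: X_def)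
    have "X
        = (W t)^2 * (v 0 t * (v 4 t - A * v 2 t + B * v 0 t - q t * v 0 t)) - (U t)^2"
    proof -
      have "W t * U2 t - U1 t * W1 t = (W t)^2 * (v 4 t - A * v 2 t + B * v 0 t - q t * v 0 t) - E t * U t"
      proof -
        have "W t * U2 t - U1 t * W1 t = (W t)^2 * (v 4 t - A * v 2 t) + W1 t * E t * v 1 t
            - W t * E t * v 2 t + v 0 t * (W t * E2 t - W1 t * E1 t)"
          unfolding U1_def U2_def by (simp add: algebra_simps power2_eq_square)
        then show ?thesis unfolding plucker U_def by (simp add: algebra_simps power2_eq_square)
      qed
      moreover have "((v 1 t * U1 t + v 0 t * U2 t - (v 2 t * U t + v 1 t * U1 t)) * W t
        - (v 0 t * U1 t - v 1 t * U t) * W1 t) = v 0 t * (W t * U2 t - U1 t * W1 t) - U t * (W t * v 2 t - W1 t * v 1 t)"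
        by (simp add: algebra_simps)
      moreover have "W t * v 2 t - W1 t * v 1 t = U t - E t * v 0 t" by (simp add: U_def)
      ultimately show ?thesis unfolding X_def by (simp only:) (simp add: algebra_simps power2_eq_square)
    qed
    moreover have "v 0 t * (v 4 t - A * v 2 t + B * v 0 t - q t * v 0 t) = C * (1 - p) * v 0 t powr (p + 1)"
      unfolding delaunay_ode[OF v] q_def linearized_potential_def
      using delaunay_pos[OF v, of t] by (simp add: powr_add powr_diff algebra_simps)
    ultimately have "X = (W t)^2 * (C * (1 - p) * v 0 t powr (p + 1)) - (U t)^2" by (simp only:)
    then have "X / (W t * W t) = G t"
      using W0[of t] unfolding G_def by (simp add: diff_divide_distrib power2_eq_square)
    then show ?thesis using der by (simp only:)
  qed
  obtain \<tau> where \<tau>: "\<tau> > 0" "v 1 \<tau> = 0" "v 2 \<tau> < 0" using delaunay_first_maximum[OF v] by blast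
  have "N \<tau> < N 0"
  proof (rule DERIV_neg_imp_decreasing[OF \<tau>(1)])
    fix t
    have "C * (1 - p) * v 0 t powr (p + 1) < 0"
      using C p delaunay_pos[OF v, of t] by (simp add: mult_pos_neg mult_neg_pos)
    moreover have "(U t / W t)^2 \<ge> 0" by simp
    ultimately have "G t < 0" unfolding G_def by linarith
    then show "\<exists>y. (N has_real_derivative y) (at t) \<and> y < 0" using DN by blast
  qed
  moreover have "N 0 = 0"
    using delaunay_deriv0[OF v] delaunay_third0[OF v] f
    by (simp add: N_def U1_def E1_def necksize_field_def)
  moreover have "N \<tau> = 0"
  proof -
    have sym: "v i (2 * \<tau> - r) = (- 1) ^ i * v i r" if "i < 4" for i r
      using solution_symmetric[of v \<tau> i r] v \<tau> that by (simp add: delaunay_def)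
    have v3: "v 3 \<tau> = 0" using sym[of 3 \<tau>] by simp
    \<comment> \<open>Modulo a multiple of the translation field the field \<open>f\<close> is even about \<open>\<tau>\<close>; the difference vanishes to first order at \<open>\<tau>\<close> and has linear growth.\<close>
    define c where "c = 2 * f 1 \<tau> / v 2 \<tau>"
    define w where "w = (\<lambda>i r. 1 * (1 * f i r + (- 1) * reflect \<tau> f i r) + (- c) * g i r)"
    have "jacobi q (reflect \<tau> f)"
      unfolding jacobi_def
    proof (intro conjI allI)
      show "tower (reflect \<tau> f)" by (rule tower_reflect[OF ft])
      have "q (2 * \<tau> - r) = q r" for r using sym[of 0 r] by (simp add: q_def linearized_potential_def)
      then show "reflect \<tau> f 4 r = A * reflect \<tau> f 2 r - B * reflect \<tau> f 0 r + q r * reflect \<tau> f 0 r" for r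
        using f4[of "2 * \<tau> - r"] by (simp add: reflect_def)
    qed
    then have "jacobi q w" unfolding w_def by (intro jacobi_lincomb fj gj)
    then have w: "driven w" unfolding q_def by (rule delaunay_jacobi_driven[OF v])
    obtain K where K: "\<And>r. \<bar>f 0 r\<bar> \<le> K * (1 + \<bar>r\<bar>)" using f by (auto simp: necksize_field_def)
    have gper: "v 1 (r + 2 * \<tau>) - v 1 r = 0" for r
      using symmetric_imp_periodic[OF v \<tau>(2), of 1 r] by simp
    obtain L where L: "\<And>r. \<bar>v 1 r\<bar> \<le> L * (1 + \<bar>r\<bar>)"
      using quasi_periodic_growth[of "2 * \<tau>" "v 1" 0] gper \<tau>(1) tower_continuous[OF delaunay_tower[OF v]] by auto
    have K0: "K \<ge> 0" using K[of 0] by simp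
    have "w 3 \<tau> = 0"
    proof (rule driven_growth[OF w])
      show "w 0 \<tau> = 0" using \<tau> by (simp add: w_def reflect_def g)
      show "w 1 \<tau> = 0" using \<tau> by (simp add: w_def reflect_def g[unfolded One_nat_def] c_def)
      show "\<bar>w 0 r\<bar> \<le> (K + K * (1 + 2 * \<tau>) + \<bar>c\<bar> * L) * (1 + \<bar>r\<bar>)" for r
      proof -
        have "\<bar>w 0 r\<bar> \<le> \<bar>f 0 r\<bar> + \<bar>f 0 (2 * \<tau> - r)\<bar> + \<bar>c * v 1 r\<bar>"
          unfolding w_def reflect_def g by simp
        also have "\<bar>c * v 1 r\<bar> \<le> \<bar>c\<bar> * (L * (1 + \<bar>r\<bar>))" unfolding abs_mult using L by (intro mult_left_mono) auto
        also have "\<bar>f 0 (2 * \<tau> - r)\<bar> \<le> K * ((1 + 2 * \<tau>) * (1 + \<bar>r\<bar>))"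
        proof -
          have "1 + \<bar>2 * \<tau> - r\<bar> \<le> (1 + 2 * \<tau>) + \<bar>r\<bar>" using \<tau>(1) by linarith
          also have "\<dots> \<le> (1 + 2 * \<tau>) * (1 + \<bar>r\<bar>)" using \<tau>(1) by (simp add: algebra_simps)
          finally have "K * (1 + \<bar>2 * \<tau> - r\<bar>) \<le> K * ((1 + 2 * \<tau>) * (1 + \<bar>r\<bar>))" using K0 by (rule mult_left_mono)
          then show ?thesis using K[of "2 * \<tau> - r"] by linarith
        qed
        also have "\<bar>f 0 r\<bar> \<le> K * (1 + \<bar>r\<bar>)" by (rule K)
        finally show ?thesis by (simp add: algebra_simps)
      qed
    qed simp
    then have "2 * f 3 \<tau> = c * v 4 \<tau>" by (simp add: w_def reflect_def g)
    then have "E1 \<tau> = 0" using \<tau>(3) unfolding E1_def c_def by (simp add: field_simps)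
    then show ?thesis using \<tau>(2) v3 by (simp add: N_def U1_def)
  qed
  ultimately show False by simp
qed

end

section \<open>Partial derivatives, radial functions and the divergence theorem\<close>

primrec Ck :: "nat \<Rightarrow> (real^'n::finite) set \<Rightarrow> (real^'n \<Rightarrow> real) \<Rightarrow> bool" where
  "Ck 0 S f = continuous_on S f"
| "Ck (Suc k) S f = ((\<forall>x\<in>S. f differentiable (at x)) \<and> (\<forall>i. Ck k S (pd i f)))"

lemma pd_eqI: "(f has_derivative f') (at x) \<Longrightarrow> pd i f x = f' (axis i 1)"
  unfolding pd_def dir_deriv_def using frechet_derivative_at by metis

lemma pd_cong:
  assumes S: "open S" "x \<in> S" and eq: "\<And>y. y \<in> S \<Longrightarrow> f y = g y"
  shows "pd i f x = pd i g x"
proof -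
  have "(f has_derivative D) (at x) \<longleftrightarrow> (g has_derivative D) (at x)" for D
    using has_derivative_transform_within_open[OF _ S, of f D UNIV g]
      has_derivative_transform_within_open[OF _ S, of g D UNIV f] eq by auto
  then show ?thesis unfolding pd_def dir_deriv_def frechet_derivative_def by simp
qed

lemma differentiable_cong:
  assumes S: "open S" "x \<in> S" and eq: "\<And>y. y \<in> S \<Longrightarrow> f y = g y" and f: "f differentiable (at x)"
  shows "g differentiable (at x)"
  using f has_derivative_transform_within_open[OF _ S, of f _ UNIV g] eq unfolding differentiable_def by blast

lemma Ck_cong:
  assumes "open S" "\<And>y. y \<in> S \<Longrightarrow> f y = g y" "Ck k S f"
  shows "Ck k S g"
  using assms
proof (induction k arbitrary: f g)
  case 0
  then show ?case using continuous_on_cong by force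
next
  case (Suc k)
  have "Ck k S (pd i g)" for i
    by (rule Suc.IH[OF Suc.prems(1), of "pd i f"])
      (use Suc.prems pd_cong[OF Suc.prems(1) _ Suc.prems(2)] in auto)
  then show ?case using Suc.prems differentiable_cong[OF Suc.prems(1)] by (auto, blast)
qed

lemma Ck_imp_continuous_on: "Ck k S f \<Longrightarrow> continuous_on S f"
  by (cases k) (auto intro!: continuous_at_imp_continuous_on differentiable_imp_continuous_within)

lemma Ck_pred: "Ck (Suc k) S f \<Longrightarrow> Ck k S f"
proof (induction k arbitrary: f)
  case 0 then show ?case using Ck_imp_continuous_on[of "Suc 0" S f] by simp
next
  case (Suc k) then show ?case by simp
qed

lemma Ck_le: "Ck k S f \<Longrightarrow> l \<le> k \<Longrightarrow> Ck l S f"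
  by (induction k) (use Ck_pred le_Suc_eq in blast)+

lemma Ck_subset: "Ck k S f \<Longrightarrow> S' \<subseteq> S \<Longrightarrow> Ck k S' f"
  by (induction k arbitrary: f) (auto intro: continuous_on_subset)

lemma Ck_Un: "open S \<Longrightarrow> open S' \<Longrightarrow> Ck k S f \<Longrightarrow> Ck k S' f \<Longrightarrow> Ck k (S \<union> S') f"
  by (induction k arbitrary: f) (auto intro: continuous_on_open_Un)

lemma Ck_const: "Ck k S (\<lambda>x. c)"
proof (induction k arbitrary: c)
  case (Suc k)
  have "pd i (\<lambda>x. c) = (\<lambda>x. 0)" for i :: 'a
    using pd_eqI[OF has_derivative_const] by auto
  then show ?case using Suc by simp
qed simp

lemma pd_add:
  assumes "f differentiable (at x)" "g differentiable (at x)"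
  shows "pd i (\<lambda>x. f x + g x) x = pd i f x + pd i g x"
proof -
  obtain f' g' where d: "(f has_derivative f') (at x)" "(g has_derivative g') (at x)"
    using assms by (auto simp: differentiable_def)
  show ?thesis unfolding pd_eqI[OF d(1)] pd_eqI[OF d(2)] pd_eqI[OF has_derivative_add[OF d]] by simp
qed

lemma pd_mult:
  assumes "f differentiable (at x)" "g differentiable (at x)"
  shows "pd i (\<lambda>x. f x * g x) x = f x * pd i g x + pd i f x * g x"
proof -
  obtain f' g' where d: "(f has_derivative f') (at x)" "(g has_derivative g') (at x)"
    using assms by (auto simp: differentiable_def)
  show ?thesis unfolding pd_eqI[OF d(1)] pd_eqI[OF d(2)] pd_eqI[OF has_derivative_mult[OF d]] by simp
qed

lemma Ck_add:
  assumes S: "open S" shows "Ck k S f \<Longrightarrow> Ck k S g \<Longrightarrow> Ck k S (\<lambda>x. f x + g x)"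
proof (induction k arbitrary: f g)
  case 0 then show ?case by (auto intro: continuous_on_add)
next
  case (Suc k)
  have "Ck k S (pd i (\<lambda>x. f x + g x))" for i
    by (rule Ck_cong[OF S, of "\<lambda>x. pd i f x + pd i g x"]) (use Suc pd_add[of f _ g i] in auto)
  then show ?case using Suc.prems by auto
qed

lemma Ck_mult:
  assumes S: "open S" shows "Ck k S f \<Longrightarrow> Ck k S g \<Longrightarrow> Ck k S (\<lambda>x. f x * g x)"
proof (induction k arbitrary: f g)
  case 0 then show ?case by (auto intro: continuous_on_mult)
next
  case (Suc k)
  have "Ck k S (pd i (\<lambda>x. f x * g x))" for i
  proof (rule Ck_cong[OF S, of "\<lambda>x. f x * pd i g x + pd i f x * g x"])
    show "f y * pd i g y + pd i f y * g y = pd i (\<lambda>x. f x * g x) y" if "y \<in> S" for y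
      using that Suc.prems pd_mult[of f y g i] by simp
    show "Ck k S (\<lambda>x. f x * pd i g x + pd i f x * g x)"
      by (rule Ck_add[OF S]; rule Suc.IH) (use Suc.prems Ck_pred in auto)
  qed
  then show ?case using Suc.prems by (auto intro!: differentiable_mult)
qed

lemma Ck_cmult: "open S \<Longrightarrow> Ck k S f \<Longrightarrow> Ck k S (\<lambda>x. c * f x)"
  using Ck_mult[OF _ Ck_const] by blast

lemma Ck_diff:
  assumes "open S" "Ck k S f" "Ck k S g" shows "Ck k S (\<lambda>x. f x - g x)"
  using Ck_add[OF assms(1,2) Ck_cmult[OF assms(1,3), of "- 1"]] by simp

lemma Ck_sum:
  assumes S: "open S" and "\<And>i. i \<in> I \<Longrightarrow> Ck k S (f i)"
  shows "Ck k S (\<lambda>x. \<Sum>i\<in>I. f i x)"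
  using assms(2)
proof (induction I rule: infinite_finite_induct)
  case (insert a I)
  then show ?case by (simp add: Ck_add[OF S])
qed (auto simp: Ck_const)

lemma pd_chain:
  assumes f: "f differentiable (at x)" and h: "(h has_real_derivative h') (at (f x))"
  shows "(\<lambda>x. h (f x)) differentiable (at x)" "pd i (\<lambda>x. h (f x)) x = h' * pd i f x"
proof -
  obtain f' where f': "(f has_derivative f') (at x)" using f by (auto simp: differentiable_def)
  have "((\<lambda>x. h (f x)) has_derivative (\<lambda>v. h' * f' v)) (at x)"
    using has_derivative_compose[OF f' h[unfolded has_field_derivative_def]] by simp
  then show "(\<lambda>x. h (f x)) differentiable (at x)" "pd i (\<lambda>x. h (f x)) x = h' * pd i f x"
    using pd_eqI[OF f', of i] pd_eqI[of "\<lambda>x. h (f x)"] by (auto simp: differentiable_def)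
qed

lemma Ck_compose:
  assumes S: "open S"
  shows "Ck k S f \<Longrightarrow> (\<And>j t. j < k \<Longrightarrow> (h j has_real_derivative h (Suc j) t) (at t)) \<Longrightarrow>
    continuous_on UNIV (h k) \<Longrightarrow> Ck k S (\<lambda>x. h 0 (f x))"
proof (induction k arbitrary: h)
  case 0
  then show ?case using continuous_on_compose2[of UNIV "h 0" S f] by auto
next
  case (Suc k)
  have der: "(h 0 has_real_derivative h 1 t) (at t)" for t using Suc.prems(2)[of 0 t] by simp
  have "Ck k S (pd i (\<lambda>x. h 0 (f x)))" for i
  proof (rule Ck_cong[OF S, of "\<lambda>x. h 1 (f x) * pd i f x"])
    show "h 1 (f y) * pd i f y = pd i (\<lambda>x. h 0 (f x)) y" if "y \<in> S" for y
      using that Suc.prems(1) pd_chain(2)[OF _ der, of f y i] by simp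
    have "Ck k S (\<lambda>x. h (Suc 0) (f x))"
      by (rule Suc.IH[of "\<lambda>j. h (Suc j)"]) (use Suc.prems Ck_pred[of k S f] in auto)
    then show "Ck k S (\<lambda>x. h 1 (f x) * pd i f x)" using Suc.prems by (intro Ck_mult[OF S]) auto
  qed
  moreover have "(\<lambda>x. h 0 (f x)) differentiable (at x)" if "x \<in> S" for x
    using that Suc.prems(1) by (intro pd_chain(1)[OF _ der]) auto
  ultimately show ?case by simp
qed

lemma coordinate_deriv: "((\<lambda>x. (x - p) $ i) has_derivative (\<lambda>v. v $ i)) (at x)"
  by (auto intro!: derivative_eq_intros bounded_linear.has_derivative[OF bounded_linear_vec_nth])

lemma pd_coordinate: "pd j (\<lambda>x. (x - p) $ i) x = (if i = j then 1 else 0)"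
  using pd_eqI[OF coordinate_deriv, of j p i x] by (auto simp: axis_def)

lemma Ck_coordinate: "Ck k S (\<lambda>x. (x - p) $ i)"
proof (cases k)
  case 0 then show ?thesis by (auto intro!: continuous_intros)
next
  case (Suc l)
  have "pd j (\<lambda>x. (x - p) $ i) = (\<lambda>x. if i = j then 1 else 0)" for j
    by (rule ext) (rule pd_coordinate)
  then show ?thesis using Suc coordinate_deriv[of p i] Ck_const by (auto simp: differentiable_def)
qed

lemma normsq_deriv: "((\<lambda>x. (norm (x - p))^2) has_derivative (\<lambda>v. 2 * ((x - p) \<bullet> v))) (at x)"
proof -
  have "((\<lambda>x. (x - p) \<bullet> (x - p)) has_derivative (\<lambda>v. 2 * ((x - p) \<bullet> v))) (at x)"
    by (auto intro!: derivative_eq_intros simp: inner_commute)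
  then show ?thesis by (simp add: power2_norm_eq_inner)
qed

lemma Ck_normsq: "open S \<Longrightarrow> Ck k S (\<lambda>x. (norm (x - p))^2)"
proof -
  assume S: "open S"
  have "Ck k S (\<lambda>x. \<Sum>i\<in>UNIV. (x - p) $ i * (x - p) $ i)"
    by (intro Ck_sum[OF S] Ck_mult[OF S] Ck_coordinate)
  moreover have "(\<Sum>i\<in>UNIV. (x - p) $ i * (x - p) $ i) = (norm (x - p))^2" for x
    by (simp add: power2_norm_eq_inner inner_vec_def)
  ultimately show ?thesis by simp
qed

text \<open>The cylindrical variable \<open>t = - log |x - p|\<close>.\<close>

definition log_radius :: "real^'n::finite \<Rightarrow> real^'n \<Rightarrow> real" where
  "log_radius p x = - ln (norm (x - p))"

lemma exp_log_radius:
  assumes "x \<noteq> p" shows "exp (2 * log_radius p x) * (norm (x - p))^2 = 1"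
proof -
  have n: "norm (x - p) > 0" using assms by simp
  have "exp (2 * log_radius p x) = inverse ((exp (ln (norm (x - p))))^2)"
    unfolding log_radius_def by (simp only: exp_double exp_minus power_inverse)
  then show ?thesis using n by simp
qed

lemma log_radius_deriv:
  assumes "x \<noteq> p"
  shows "(log_radius p has_derivative (\<lambda>v. - exp (2 * log_radius p x) * ((x - p) \<bullet> v))) (at x)"
proof -
  have n: "(norm (x - p))^2 > 0" using assms by simp
  have "((\<lambda>x. - (1/2) * ln ((norm (x - p))^2)) has_derivative
      (\<lambda>v. - (1/2) * (2 * ((x - p) \<bullet> v) * inverse ((norm (x - p))^2)))) (at x)"
    by (rule has_derivative_mult_right[OF has_derivative_ln[OF n normsq_deriv]])
  moreover have "inverse ((norm (x - p))^2) = exp (2 * log_radius p x)"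
    by (rule inverse_unique) (use exp_log_radius[OF assms] in \<open>simp add: mult.commute\<close>)
  moreover have "- (1/2) * ln ((norm (y - p))^2) = log_radius p y" for y
    unfolding log_radius_def by (cases "y = p") (simp_all add: ln_realpow)
  ultimately show ?thesis by (simp add: mult.commute)
qed

lemma pd_log_radius:
  "x \<noteq> p \<Longrightarrow> pd i (log_radius p) x = - exp (2 * log_radius p x) * (x - p) $ i"
  using pd_eqI[OF log_radius_deriv, of x p i] by (simp add: inner_axis)

lemma open_punctured: "open (- {p :: real^'n::finite})"
  by (rule open_Compl) simp

lemma Ck_log_radius: "Ck k (- {p}) (log_radius p)"
proof (induction k)
  case 0
  have "continuous_on (- {p}) (log_radius p)"
    using has_derivative_continuous[OF log_radius_deriv] by (auto intro!: continuous_at_imp_continuous_on)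
  then show ?case by simp
next
  case (Suc k)
  have "Ck k (- {p}) (\<lambda>x. 2 ^ 0 * exp (2 * log_radius p x))"
    by (rule Ck_compose[OF open_punctured Suc, of "\<lambda>j t. 2 ^ j * exp (2 * t)"])
      (auto intro!: derivative_eq_intros continuous_intros)
  then have e: "Ck k (- {p}) (\<lambda>x. exp (2 * log_radius p x))" by simp
  have c: "Ck k (- {p}) (\<lambda>x. (- 1) * (exp (2 * log_radius p x) * (x - p) $ i))" for i
    by (intro Ck_cmult Ck_mult e Ck_coordinate open_punctured)
  have "Ck k (- {p}) (pd i (log_radius p))" for i
    by (rule Ck_cong[OF open_punctured _ c[of i]]) (simp add: pd_log_radius)
  moreover have "log_radius p differentiable (at x)" if "x \<noteq> p" for x
    using log_radius_deriv[OF that] by (auto simp: differentiable_def)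
  ultimately show ?case by simp
qed

lemma Ck_shift:
  assumes "Ck k UNIV f" shows "Ck k UNIV (\<lambda>x. f (x - p))"
  using assms
proof (induction k arbitrary: f)
  case 0
  have "continuous_on UNIV (\<lambda>x. f (x - p))"
    by (rule continuous_on_compose2[of UNIV f]) (use 0 in \<open>auto intro!: continuous_intros\<close>)
  then show ?case by simp
next
  case (Suc k)
  have der: "((\<lambda>x. f (x - p)) has_derivative f') (at x)" if "(f has_derivative f') (at (x - p))" for f' x
  proof -
    have "((\<lambda>x. x - p) has_derivative (\<lambda>v. v)) (at x)" by (auto intro!: derivative_eq_intros)
    from has_derivative_compose[OF this that] show ?thesis by simp
  qed
  have "pd i (\<lambda>x. f (x - p)) x = pd i f (x - p)" for i x
  proof -
    obtain f' where "(f has_derivative f') (at (x - p))"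
      using Suc.prems by (auto simp: differentiable_def)
    then show ?thesis using pd_eqI der by metis
  qed
  then have "pd i (\<lambda>x. f (x - p)) = (\<lambda>x. pd i f (x - p))" for i by auto
  moreover have "(\<lambda>x. f (x - p)) differentiable (at x)" for x
    using Suc.prems der[of _ x] unfolding differentiable_def Ck.simps by blast
  ultimately show ?case using Suc by simp
qed

lemma smooth_imp_Ck:
  assumes "smooth_on UNIV f" shows "Ck k UNIV f"
proof -
  have "Ck k UNIV f" if "\<And>bs x. set bs \<subseteq> Basis \<Longrightarrow> foldr dir_deriv bs f differentiable (at x)"
    using that
  proof (induction k arbitrary: f)
    case 0
    have "f differentiable (at x)" for x using 0[of "[]" x] by simp
    then show ?case by (auto intro!: continuous_at_imp_continuous_on differentiable_imp_continuous_within)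
  next
    case (Suc k)
    have "f differentiable (at x)" for x using Suc.prems[of "[]" x] by simp
    moreover have "Ck k UNIV (pd i f)" for i
    proof (rule Suc.IH)
      fix bs :: "(real^'a) list" and x assume "set bs \<subseteq> Basis"
      moreover have "axis i (1::real) \<in> Basis" by (simp add: axis_in_Basis_iff)
      ultimately show "foldr dir_deriv bs (pd i f) differentiable (at x)"
        using Suc.prems[of "bs @ [axis i 1]" x] by (simp add: pd_def)
    qed
    ultimately show ?case by simp
  qed
  then show ?thesis using assms by (simp add: smooth_on_def)
qed

lemma laplacian_cong:
  assumes S: "open S" "x \<in> S" and eq: "\<And>y. y \<in> S \<Longrightarrow> f y = g y"
  shows "laplacian f x = laplacian g x"
  unfolding laplacian_def by (intro sum.cong refl pd_cong[OF S] pd_cong[OF S(1) _ eq])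

lemma Ck_laplacian:
  assumes S: "open S" and f: "Ck (Suc (Suc k)) S f" shows "Ck k S (laplacian f)"
  unfolding laplacian_def[abs_def] using f by (intro Ck_sum[OF S]) auto

lemma pd_radial:
  assumes "x \<noteq> p" and h: "(h has_real_derivative h') (at (log_radius p x))"
  shows "(\<lambda>x. h (log_radius p x)) differentiable (at x)"
    "pd i (\<lambda>x. h (log_radius p x)) x = - h' * exp (2 * log_radius p x) * (x - p) $ i"
proof -
  have "log_radius p differentiable (at x)"
    using log_radius_deriv[OF assms(1)] by (auto simp: differentiable_def)
  from pd_chain[OF this h] show "(\<lambda>x. h (log_radius p x)) differentiable (at x)"
    "pd i (\<lambda>x. h (log_radius p x)) x = - h' * exp (2 * log_radius p x) * (x - p) $ i"
    by (auto simp: pd_log_radius[OF assms(1)])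
qed

text \<open>The variable \<open>t = - log |x - p|\<close> satisfies \<open>|\<nabla>t|\<^sup>2 = exp (2 t)\<close> and \<open>\<Delta>t = - (n - 2) exp (2 t)\<close>.\<close>

lemma laplacian_radial:
  fixes p :: "real^'n::finite"
  assumes x: "x \<noteq> p" and h: "\<And>t. (h has_real_derivative h1 t) (at t)"
    "\<And>t. (h1 has_real_derivative h2 t) (at t)"
  shows "laplacian (\<lambda>x. h (log_radius p x)) x =
    exp (2 * log_radius p x) * (h2 (log_radius p x) - (real CARD('n) - 2) * h1 (log_radius p x))"
proof -
  define L where "L = log_radius p x"
  have second: "pd i (pd i (\<lambda>x. h (log_radius p x))) x
      = exp (2 * L) * (exp (2 * L) * (h2 L + 2 * h1 L)) * ((x - p) $ i)^2 - exp (2 * L) * h1 L" for i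
  proof -
    have "pd i (pd i (\<lambda>x. h (log_radius p x))) x
        = pd i (\<lambda>x. (- h1 (log_radius p x) * exp (2 * log_radius p x)) * (x - p) $ i) x"
      by (rule pd_cong[OF open_punctured[of p]]) (use x pd_radial(2)[OF _ h(1)] in auto)
    also have "\<dots> = (- h1 L * exp (2 * L)) * pd i (\<lambda>x. (x - p) $ i) x
        + pd i (\<lambda>x. - h1 (log_radius p x) * exp (2 * log_radius p x)) x * (x - p) $ i"
    proof -
      have d: "((\<lambda>t. - h1 t * exp (2 * t)) has_real_derivative - (h2 L + 2 * h1 L) * exp (2 * L)) (at (log_radius p x))"
        unfolding L_def by (auto intro!: derivative_eq_intros h simp: algebra_simps)
      show ?thesis unfolding L_def
        by (rule pd_mult[OF pd_radial(1)[OF x d]])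
          (use coordinate_deriv in \<open>auto simp: differentiable_def\<close>)
    qed
    also have "pd i (\<lambda>x. - h1 (log_radius p x) * exp (2 * log_radius p x)) x
        = - (- (h2 L + 2 * h1 L) * exp (2 * L)) * exp (2 * log_radius p x) * (x - p) $ i"
    proof (rule pd_radial(2)[OF x])
      show "((\<lambda>t. - h1 t * exp (2 * t)) has_real_derivative - (h2 L + 2 * h1 L) * exp (2 * L)) (at (log_radius p x))"
        unfolding L_def by (auto intro!: derivative_eq_intros h simp: algebra_simps)
    qed
    finally show ?thesis unfolding pd_coordinate L_def by (simp add: algebra_simps power2_eq_square)
  qed
  have "laplacian (\<lambda>x. h (log_radius p x)) x
      = exp (2 * L) * (exp (2 * L) * (h2 L + 2 * h1 L)) * (\<Sum>i\<in>UNIV. ((x - p) $ i)^2) - real CARD('n) * (exp (2 * L) * h1 L)"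
    unfolding laplacian_def second sum_subtractf by (simp add: sum_distrib_left)
  also have "(\<Sum>i\<in>UNIV. ((x - p) $ i)^2) = (norm (x - p))^2"
    unfolding power2_norm_eq_inner inner_vec_def by (simp add: power2_eq_square)
  also have "exp (2 * L) * (exp (2 * L) * (h2 L + 2 * h1 L)) * (norm (x - p))^2 =
      (exp (2 * L) * (norm (x - p))^2) * (exp (2 * L) * (h2 L + 2 * h1 L))" by simp
  also have "exp (2 * L) * (norm (x - p))^2 = 1" unfolding L_def by (rule exp_log_radius[OF x])
  finally show ?thesis unfolding L_def by (simp add: algebra_simps)
qed

text \<open>By translation invariance the difference quotients of \<open>f\<close> in direction \<open>i\<close> have integral \<open>0\<close>; they
converge to the partial derivative and are dominated on a ball.\<close>

lemma integral_pd_zero: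
  fixes f :: "real^'n::finite \<Rightarrow> real"
  assumes f: "Ck 1 UNIV f" and R: "\<And>x. norm x > R \<Longrightarrow> f x = 0"
  shows "integrable lborel (pd i f)" "integral\<^sup>L lborel (pd i f) = 0"
proof -
  define e where "e = (axis i 1 :: real^'n)"
  have ne: "norm e = 1" by (simp add: e_def)
  have diff: "f differentiable (at x)" for x using f by simp
  have cont: "continuous_on UNIV f" "continuous_on UNIV (pd i f)"
    using Ck_imp_continuous_on[OF f] f by auto
  have pd0: "pd i f x = 0" if "norm x > R" for x
  proof -
    have op: "open {x::real^'n. norm x > R}" by (intro open_Collect_less continuous_intros)
    have "pd i f x = pd i (\<lambda>x. 0) x" by (rule pd_cong[OF op]) (use that R in auto)
    then show ?thesis using pd_eqI[OF has_derivative_const, of i 0 x] by simp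
  qed
  have compact_integrable: "integrable lborel g" if "continuous_on UNIV g" "\<And>x. norm x > \<bar>R\<bar> + 1 \<Longrightarrow> g x = 0"
    for g :: "real^'n \<Rightarrow> real"
  proof -
    have "integrable lborel (\<lambda>x. indicator (cball 0 (\<bar>R\<bar> + 1)) x *\<^sub>R g x)"
      by (rule borel_integrable_compact) (use continuous_on_subset[OF that(1)] in auto)
    moreover have "(\<lambda>x. indicator (cball 0 (\<bar>R\<bar> + 1)) x *\<^sub>R g x) = g"
      using that(2) by (auto simp: indicator_def fun_eq_iff)
    ultimately show ?thesis by (simp only:)
  qed
  have int_f: "integrable lborel f" by (rule compact_integrable) (use cont R in auto)
  show int_pd: "integrable lborel (pd i f)" by (rule compact_integrable) (use cont pd0 in auto)
  have "compact (pd i f ` cball 0 (\<bar>R\<bar> + 1))"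
    by (intro compact_continuous_image continuous_on_subset[OF cont(2)]) auto
  then obtain b where b: "\<And>x. x \<in> cball 0 (\<bar>R\<bar> + 1) \<Longrightarrow> \<bar>pd i f x\<bar> \<le> b"
    using compact_imp_bounded bounded_real by (metis imageI)
  have b0: "0 \<le> b" using b[of 0] by force
  have bound: "\<bar>pd i f x\<bar> \<le> b" for x
    using b[of x] pd0[of x] b0 by (cases "norm x > \<bar>R\<bar> + 1") auto
  have line: "((\<lambda>s. f (x + s *\<^sub>R e)) has_real_derivative pd i f (x + s *\<^sub>R e)) (at s)" for x s
  proof -
    obtain f' where f': "(f has_derivative f') (at (x + s *\<^sub>R e))"
      using diff by (auto simp: differentiable_def)
    have "((\<lambda>s. x + s *\<^sub>R e) has_derivative (\<lambda>h. h *\<^sub>R e)) (at s)"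
      by (auto intro!: derivative_eq_intros)
    from has_derivative_compose[OF this f']
    have "((\<lambda>s. f (x + s *\<^sub>R e)) has_derivative (\<lambda>h. f' (h *\<^sub>R e))) (at s)" .
    moreover have "f' (h *\<^sub>R e) = pd i f (x + s *\<^sub>R e) * h" for h
      using pd_eqI[OF f', of i] linear_scale[OF has_derivative_linear[OF f'], of h e] by (simp add: e_def)
    ultimately show ?thesis by (simp add: has_field_derivative_def)
  qed
  define d where "d n = (1::real) / real (Suc n)" for n
  have d: "0 < d n" "d n \<le> 1" for n by (auto simp: d_def)
  have d0: "d \<longlonglongrightarrow> 0" unfolding d_def using LIMSEQ_Suc[OF lim_const_over_n[of 1]] by simp
  define s where "s n x = (f (x + d n *\<^sub>R e) - f x) / d n" for n x
  have shift: "integrable lborel (\<lambda>x. f (x + c))" "(\<integral>x. f (x + c) \<partial>lborel) = integral\<^sup>L lborel f" for c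
  proof -
    have "lborel = distr lborel borel (\<lambda>x. c + x :: real^'n)" by (rule lborel_distr_plus[symmetric])
    then have "integrable (distr lborel borel (\<lambda>x. c + x)) f" "integral\<^sup>L lborel f = integral\<^sup>L (distr lborel borel (\<lambda>x. c + x)) f"
      using int_f by auto
    then show "integrable lborel (\<lambda>x. f (x + c))" "(\<integral>x. f (x + c) \<partial>lborel) = integral\<^sup>L lborel f"
      using cont(1) by (simp_all add: integrable_distr_eq integral_distr borel_measurable_continuous_onI add.commute)
  qed
  have s_zero: "integral\<^sup>L lborel (s n) = 0" for n
    unfolding s_def[abs_def] using shift int_f by simp
  have "(\<lambda>n. integral\<^sup>L lborel (s n)) \<longlonglongrightarrow> integral\<^sup>L lborel (pd i f)"
  proof (rule integral_dominated_convergence[where w = "\<lambda>x. indicator (cball 0 (\<bar>R\<bar> + 1)) x *\<^sub>R b"])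
    show "pd i f \<in> borel_measurable lborel" using int_pd by auto
    show "s n \<in> borel_measurable lborel" for n
      unfolding s_def[abs_def] using shift int_f by (intro borel_measurable_divide borel_measurable_diff) auto
    show "integrable lborel (\<lambda>x. indicator (cball 0 (\<bar>R\<bar> + 1)) x *\<^sub>R b)"
      by (rule borel_integrable_compact) auto
    show "AE x in lborel. (\<lambda>n. s n x) \<longlonglongrightarrow> pd i f x"
    proof (rule AE_I2)
      fix x
      have "((\<lambda>h. (f (x + h *\<^sub>R e) - f x) / h) \<longlongrightarrow> pd i f x) (at 0)"
        using line[of x 0] unfolding DERIV_def by simp
      moreover have "filterlim d (at 0) sequentially"
        using d0 d(1) by (auto simp: filterlim_at intro!: always_eventually) (metis less_irrefl)
      ultimately show "(\<lambda>n. s n x) \<longlonglongrightarrow> pd i f x"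
        unfolding s_def by (rule filterlim_compose)
    qed
    show "AE x in lborel. norm (s n x) \<le> indicator (cball 0 (\<bar>R\<bar> + 1)) x *\<^sub>R b" for n
    proof (rule AE_I2)
      fix x
      show "norm (s n x) \<le> indicator (cball 0 (\<bar>R\<bar> + 1)) x *\<^sub>R b"
      proof (cases "norm x > \<bar>R\<bar> + 1")
        case True
        have "norm (x + d n *\<^sub>R e) \<ge> norm x - norm (d n *\<^sub>R e)" by (rule norm_diff_ineq)
        then have "norm (x + d n *\<^sub>R e) > R" using True d[of n] ne by simp
        then show ?thesis using True R[of x] R[of "x + d n *\<^sub>R e"] by (simp add: s_def)
      next
        case False
        have "norm (f (x + d n *\<^sub>R e) - f (x + 0 *\<^sub>R e)) \<le> b * norm (d n - 0)"
          by (rule field_differentiable_bound[of UNIV "\<lambda>s. f (x + s *\<^sub>R e)" "\<lambda>s. pd i f (x + s *\<^sub>R e)"])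
            (use line bound in auto)
        then have "\<bar>s n x\<bar> \<le> b" using d[of n] by (simp add: s_def abs_divide pos_divide_le_eq)
        then show ?thesis using False by (simp add: indicator_def)
      qed
    qed
  qed
  then have "(\<lambda>n. 0) \<longlonglongrightarrow> integral\<^sup>L lborel (pd i f)" using s_zero by simp
  then show "integral\<^sup>L lborel (pd i f) = 0" by (simp add: LIMSEQ_const_iff)
qed

section \<open>Green's formula on the perforated space\<close>

text \<open>The vector field whose divergence is \<open>v \<Delta>\<^sup>2 w - w \<Delta>\<^sup>2 v\<close>.\<close>

definition flux :: "(real^'n::finite \<Rightarrow> real) \<Rightarrow> (real^'n \<Rightarrow> real) \<Rightarrow> 'n \<Rightarrow> real^'n \<Rightarrow> real" where
  "flux v w i x = v x * pd i (laplacian w) x - pd i v x * laplacian w x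
     + (laplacian v x * pd i w x - w x * pd i (laplacian v) x)"

lemma Ck_4_parts:
  assumes S: "open S" and v: "Ck 4 S v"
  shows "Ck 2 S v" "Ck 2 S (pd i v)" "Ck 2 S (laplacian v)" "Ck 1 S (pd i (laplacian v))"
proof -
  have v': "Ck (Suc (Suc 2)) S v" using v by (simp add: eval_nat_numeral)
  show "Ck 2 S v" using Ck_le[OF v] by simp
  have "Ck (Suc 3) S v" using v by (simp add: eval_nat_numeral)
  then have "Ck 3 S (pd i v)" unfolding Ck.simps by blast
  then show "Ck 2 S (pd i v)" by (rule Ck_le) simp
  show l: "Ck 2 S (laplacian v)" by (rule Ck_laplacian[OF S v'])
  have "Ck (Suc 1) S (laplacian v)" using l by (simp add: eval_nat_numeral)
  then show "Ck 1 S (pd i (laplacian v))" by simp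
qed

lemma Ck_flux:
  assumes S: "open S" and v: "Ck 4 S v" and w: "Ck 4 S w"
  shows "Ck 1 S (flux v w i)"
  unfolding flux_def[abs_def]
  by (intro Ck_add Ck_diff Ck_mult S; (rule Ck_4_parts[OF S v] Ck_4_parts[OF S w])?;
      rule Ck_le[where k = 2]; (rule Ck_4_parts[OF S v] Ck_4_parts[OF S w])?; simp)

lemma Ck_differentiable: "Ck k S f \<Longrightarrow> 0 < k \<Longrightarrow> x \<in> S \<Longrightarrow> f differentiable (at x)"
  by (cases k) auto

lemma pd_diff:
  assumes "f differentiable (at x)" "g differentiable (at x)"
  shows "pd i (\<lambda>x. f x - g x) x = pd i f x - pd i g x"
proof -
  obtain f' g' where d: "(f has_derivative f') (at x)" "(g has_derivative g') (at x)"
    using assms by (auto simp: differentiable_def)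
  show ?thesis unfolding pd_eqI[OF d(1)] pd_eqI[OF d(2)] pd_eqI[OF has_derivative_diff[OF d]] by simp
qed

lemma flux_divergence:
  assumes S: "open S" and v: "Ck 4 S v" and w: "Ck 4 S w" and x: "x \<in> S"
  shows "(\<Sum>i\<in>UNIV. pd i (flux v w i) x) = v x * laplacian (laplacian w) x - w x * laplacian (laplacian v) x"
proof -
  have "pd i (flux v w i) x = v x * pd i (pd i (laplacian w)) x - pd i (pd i v) x * laplacian w x
      + (laplacian v x * pd i (pd i w) x - w x * pd i (pd i (laplacian v)) x)" for i
  proof -
    have parts: "h differentiable (at x)" "pd i h differentiable (at x)" "laplacian h differentiable (at x)"
      "pd i (laplacian h) differentiable (at x)" if h: "Ck 4 S h" for h
      using Ck_differentiable[OF Ck_4_parts(1)[OF S h] _ x] Ck_differentiable[OF Ck_4_parts(2)[OF S h] _ x]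
        Ck_differentiable[OF Ck_4_parts(3)[OF S h] _ x] Ck_differentiable[OF Ck_4_parts(4)[OF S h] _ x] by auto
    note D = parts[OF v] parts[OF w]
    show ?thesis unfolding flux_def[abs_def]
      by (simp add: pd_add pd_diff pd_mult D differentiable_add differentiable_diff differentiable_mult)
  qed
  then show ?thesis
    by (simp add: sum.distrib sum_subtractf sum_distrib_left[symmetric] sum_distrib_right[symmetric] laplacian_def[symmetric])
qed

text \<open>The derivatives of \<open>exp (a t) f t\<close>, by the Leibniz rule. With \<open>t = - log |x - p|\<close> this is the inverse
Emden-Fowler transform of \<open>f\<close>.\<close>

definition twist :: "real \<Rightarrow> (nat \<Rightarrow> real \<Rightarrow> real) \<Rightarrow> nat \<Rightarrow> real \<Rightarrow> real" where
  "twist a f j t = exp (a * t) * (if j = 0 then f 0 t else if j = 1 then f 1 t + a * f 0 t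
     else if j = 2 then f 2 t + 2 * a * f 1 t + a^2 * f 0 t
     else if j = 3 then f 3 t + 3 * a * f 2 t + 3 * a^2 * f 1 t + a^3 * f 0 t
     else f 4 t + 4 * a * f 3 t + 6 * a^2 * f 2 t + 4 * a^3 * f 1 t + a^4 * f 0 t)"

lemma twist_tower:
  assumes f: "tower f" shows "tower (twist a f)"
  by (rule towerI)
    (auto simp: twist_def[abs_def] power2_eq_square power3_eq_cube power4_eq_xxxx algebra_simps simp del: One_nat_def
      intro!: derivative_eq_intros tower_derivs[OF f])

text \<open>The derivatives of \<open>exp (2 t) (F'' - k F')\<close>, which is the Laplacian of \<open>F (- log |x - p|)\<close> when \<open>k = n - 2\<close>.\<close>

definition radial_laplacian :: "real \<Rightarrow> (nat \<Rightarrow> real \<Rightarrow> real) \<Rightarrow> nat \<Rightarrow> real \<Rightarrow> real" where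
  "radial_laplacian k F j t = exp (2 * t) * (if j = 0 then F 2 t - k * F 1 t
     else if j = 1 then F 3 t + 2 * F 2 t - k * (F 2 t + 2 * F 1 t)
     else F 4 t + 4 * F 3 t + 4 * F 2 t - k * (F 3 t + 4 * F 2 t + 4 * F 1 t))"

lemma radial_laplacian_derivs:
  assumes F: "tower F"
  shows "(radial_laplacian k F 0 has_real_derivative radial_laplacian k F 1 t) (at t)"
    "(radial_laplacian k F 1 has_real_derivative radial_laplacian k F 2 t) (at t)"
  by (auto simp: radial_laplacian_def[abs_def] algebra_simps simp del: One_nat_def
      intro!: derivative_eq_intros tower_derivs[OF F])

lemma radial_laplacian_eq:
  fixes p :: "real^'n::finite"
  assumes S: "open S" "x \<in> S" "p \<notin> S" and v: "\<And>y. y \<in> S \<Longrightarrow> v y = F 0 (log_radius p y)"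
    and F: "\<And>t. (F 0 has_real_derivative F 1 t) (at t)" "\<And>t. (F 1 has_real_derivative F 2 t) (at t)"
  shows "laplacian v x = exp (2 * log_radius p x) *
    (F 2 (log_radius p x) - (real CARD('n) - 2) * F 1 (log_radius p x))"
proof -
  have "laplacian v x = laplacian (\<lambda>x. F 0 (log_radius p x)) x"
    by (rule laplacian_cong[OF S(1,2) v])
  also have "\<dots> = exp (2 * log_radius p x) *
    (F 2 (log_radius p x) - (real CARD('n) - 2) * F 1 (log_radius p x))"
    by (rule laplacian_radial[OF _ F]) (use S in auto)
  finally show ?thesis .
qed

lemma radial_parts:
  fixes p :: "real^'n::finite"
  assumes n: "real CARD('n) = 2 * a + 4" and S: "open S" "x \<in> S" "p \<notin> S"
    and v': "\<forall>y\<in>S. v y = twist a f 0 (log_radius p y)" and f: "tower f"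
  defines "M \<equiv> radial_laplacian (2 * a + 2) (twist a f)" and "L \<equiv> log_radius p x"
  shows "pd i v x = - twist a f 1 L * exp (2 * L) * (x - p) $ i"
    "laplacian v x = M 0 L" "pd i (laplacian v) x = - M 1 L * exp (2 * L) * (x - p) $ i"
    "laplacian (laplacian v) x = exp (2 * L) * (M 2 L - (2 * a + 2) * M 1 L)"
proof -
  have v: "v y = twist a f 0 (log_radius p y)" if "y \<in> S" for y using v' that by blast
  note D = tower_derivs[OF twist_tower[OF f, of a]]
  note DM = radial_laplacian_derivs[OF twist_tower[OF f, of a], of "2 * a + 2", folded M_def]
  have xp: "y \<noteq> p" if "y \<in> S" for y using S that by auto
  have lap: "laplacian v y = M 0 (log_radius p y)" if "y \<in> S" for y
    using radial_laplacian_eq[OF S(1) that S(3) v D(1,2)] n by (simp add: M_def radial_laplacian_def)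
  show "laplacian v x = M 0 L" using lap[OF S(2)] by (simp add: L_def)
  have "pd i v x = pd i (\<lambda>y. twist a f 0 (log_radius p y)) x" by (rule pd_cong[OF S(1,2) v])
  then show "pd i v x = - twist a f 1 L * exp (2 * L) * (x - p) $ i"
    unfolding L_def using pd_radial(2)[OF xp[OF S(2)] D(1)] by simp
  have "pd i (laplacian v) x = pd i (\<lambda>y. M 0 (log_radius p y)) x" by (rule pd_cong[OF S(1,2) lap])
  then show "pd i (laplacian v) x = - M 1 L * exp (2 * L) * (x - p) $ i"
    unfolding L_def using pd_radial(2)[OF xp[OF S(2)] DM(1)] by simp
  show "laplacian (laplacian v) x = exp (2 * L) * (M 2 L - (2 * a + 2) * M 1 L)"
    using radial_laplacian_eq[OF S lap DM] n by (simp add: L_def)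
qed

text \<open>In cylindrical variables the flux becomes the symplectic pairing, and the divergence its derivative.\<close>

lemma radial_flux:
  fixes p :: "real^'n::finite"
  assumes n: "real CARD('n) = 2 * a + 4" and S: "open S" "x \<in> S" "p \<notin> S"
    and v: "\<forall>y\<in>S. v y = twist a f 0 (log_radius p y)" and f: "tower f"
    and w: "\<forall>y\<in>S. w y = twist a g 0 (log_radius p y)" and g: "tower g"
    and A: "A = a^2 + (a + 2)^2"
  defines "L \<equiv> log_radius p x"
  shows "flux v w i x = - exp (2 * L) * exp ((2 * a + 2) * L) * symplectic_pairing A f g L * (x - p) $ i"
    "v x * laplacian (laplacian w) x - w x * laplacian (laplacian v) x
      = exp ((2 * a + 4) * L) * (f 0 L * (g 4 L - A * g 2 L) - (f 4 L - A * f 2 L) * g 0 L)"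
proof -
  note pv = radial_parts[OF n S v f, folded L_def]
  note pw = radial_parts[OF n S w g, folded L_def]
  have v0: "v x = twist a f 0 L" "w x = twist a g 0 L" using v w S by (auto simp: L_def)
  have e1: "exp ((2 * a + 2) * L) = exp (a * L) * exp (a * L) * exp (2 * L)"
    by (simp add: exp_add[symmetric] algebra_simps)
  have e2: "exp ((2 * a + 4) * L) = exp (a * L) * exp (a * L) * exp (2 * L) * exp (2 * L)"
    by (simp add: exp_add[symmetric] algebra_simps)
  define X where "X = exp (a * L)"
  define Y where "Y = exp (2 * L)"
  show "flux v w i x = - exp (2 * L) * exp ((2 * a + 2) * L) * symplectic_pairing A f g L * (x - p) $ i"
    unfolding flux_def pv pw v0 e1 A symplectic_pairing_def radial_laplacian_def twist_def X_def[symmetric] Y_def[symmetric]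
    by (simp add: algebra_simps power2_eq_square power3_eq_cube del: vector_minus_component)
  show "v x * laplacian (laplacian w) x - w x * laplacian (laplacian v) x
      = exp ((2 * a + 4) * L) * (f 0 L * (g 4 L - A * g 2 L) - (f 4 L - A * f 2 L) * g 0 L)"
    unfolding pv pw v0 e2 A radial_laplacian_def twist_def X_def[symmetric] Y_def[symmetric]
    by (simp add: algebra_simps power2_eq_square power3_eq_cube power4_eq_xxxx)
qed

text \<open>A quadratic spline that rises from \<open>0\<close> to \<open>1\<close> on the unit interval. Continuity of its derivative, the
tent function, suffices to cut off a vector field.\<close>

definition smooth_step :: "real \<Rightarrow> real" where
  "smooth_step y = 2 * (max 0 y)^2 - 4 * (max 0 (y - 1/2))^2 + 2 * (max 0 (y - 1))^2"

definition tent :: "real \<Rightarrow> real" where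
  "tent y = 4 * max 0 y - 8 * max 0 (y - 1/2) + 4 * max 0 (y - 1)"

lemma pos_part_square_deriv: "((\<lambda>y. (max 0 y)^2) has_real_derivative 2 * max 0 y) (at (y::real))"
proof -
  consider "y < 0" | "y > 0" | "y = 0" by linarith
  then show ?thesis
  proof cases
    case 1
    have "((\<lambda>y. 0) has_real_derivative 0) (at y)" by simp
    then have "((\<lambda>y. (max 0 y)^2) has_real_derivative 0) (at y)"
      by (rule has_field_derivative_transform_within_open[where S = "{..<0}"]) (use 1 in auto)
    then show ?thesis using 1 by simp
  next
    case 2
    have "((\<lambda>y. y^2) has_real_derivative 2 * y) (at y)" by (auto intro!: derivative_eq_intros)
    then have "((\<lambda>y. (max 0 y)^2) has_real_derivative 2 * y) (at y)"
      by (rule has_field_derivative_transform_within_open[where S = "{0<..}"]) (use 2 in auto)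
    then show ?thesis using 2 by simp
  next
    case 3
    have "((\<lambda>h. ((max 0 (0 + h))^2 - (max 0 0)^2) / h) \<longlongrightarrow> 0) (at (0::real))"
    proof (rule Lim_null_comparison)
      show "\<forall>\<^sub>F h in at 0. norm (((max 0 (0 + h))^2 - (max 0 0)^2) / h) \<le> \<bar>h\<bar>"
        by (rule always_eventually) (auto simp: max_def power2_eq_square)
      show "((\<lambda>h::real. \<bar>h\<bar>) \<longlongrightarrow> 0) (at 0)" by (rule tendsto_rabs_zero) (rule tendsto_ident_at)
    qed
    then show ?thesis using 3 by (simp add: DERIV_def)
  qed
qed

lemma smooth_step_deriv: "(smooth_step has_real_derivative tent y) (at y)"
proof -
  have "((\<lambda>y. (max 0 (y - c))^2) has_real_derivative 2 * max 0 (y - c)) (at y)" for c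
  proof -
    have "((\<lambda>y. y - c) has_real_derivative 1) (at y)" by (auto intro!: derivative_eq_intros)
    from DERIV_chain2[OF pos_part_square_deriv this] show ?thesis by simp
  qed
  note d = this[of 0, simplified] this[of "1/2"] this[of 1]
  have "((\<lambda>y. 2 * (max 0 y)^2 - 4 * (max 0 (y - 1/2))^2 + 2 * (max 0 (y - 1))^2) has_real_derivative
      2 * (2 * max 0 y) - 4 * (2 * max 0 (y - 1/2)) + 2 * (2 * max 0 (y - 1))) (at y)"
    by (intro DERIV_add DERIV_diff DERIV_cmult d)
  then show ?thesis by (simp add: smooth_step_def[abs_def] tent_def)
qed

lemma tent_continuous: "continuous_on S tent"
  unfolding tent_def[abs_def] by (intro continuous_intros)

lemma smooth_step_values: "y \<le> 0 \<Longrightarrow> smooth_step y = 0" "y \<ge> 1 \<Longrightarrow> smooth_step y = 1"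
  by (auto simp: smooth_step_def max_def power2_eq_square algebra_simps)

lemma tent_values: "y \<le> 0 \<Longrightarrow> tent y = 0" "y \<ge> 1 \<Longrightarrow> tent y = 0" "tent y \<ge> 0" "0 < y \<Longrightarrow> y < 1 \<Longrightarrow> tent y > 0"
  by (auto simp: tent_def max_def)

text \<open>An affine function of \<open>|x - p|\<^sup>2\<close> that is negative inside the ball of radius \<open>r / 2\<close> and exceeds \<open>1\<close> outside
the ball of radius \<open>r\<close>.\<close>

definition shell :: "real \<Rightarrow> real^'n::finite \<Rightarrow> real^'n \<Rightarrow> real" where
  "shell r p x = 4 / r^2 * (norm (x - p))^2 - 1"

text \<open>The weight with which the pairing at \<open>p\<close> enters Green's formula: the integral of the
gradient of the cut-off against the flux of a pair of fields of pairing \<open>-1\<close>. Only its positivity matters.\<close>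

definition shell_mass :: "real \<Rightarrow> real \<Rightarrow> real^'n::finite \<Rightarrow> real" where
  "shell_mass a r p = (\<integral>x. 8 / r^2 * tent (shell r p x) * exp ((2 * a + 2) * log_radius p x) \<partial>lborel)"

lemma shell_bounds:
  assumes r: "r > 0"
  shows "norm (x - p) \<le> r / 2 \<Longrightarrow> shell r p x \<le> 0" "norm (x - p) \<ge> r \<Longrightarrow> shell r p x \<ge> 1"
    "norm (x - p) > r / 2 \<Longrightarrow> shell r p x > 0" "norm (x - p) = 3 / 5 * r \<Longrightarrow> 0 < shell r p x \<and> shell r p x < 1"
proof -
  have eq: "shell r p x = (norm (x - p) / (r / 2))^2 - 1" using r by (simp add: shell_def power2_eq_square)
  show "shell r p x \<le> 0" if "norm (x - p) \<le> r / 2"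
    unfolding eq using that r power_le_one[of "norm (x - p) / (r / 2)" 2] by (simp add: divide_le_eq)
  show "shell r p x > 0" if "norm (x - p) > r / 2"
    unfolding eq using that r one_less_power[of "norm (x - p) / (r / 2)" 2] by (simp add: less_divide_eq)
  show "shell r p x \<ge> 1" if "norm (x - p) \<ge> r"
  proof -
    have "2 \<le> norm (x - p) / (r / 2)" using that r by (simp add: le_divide_eq)
    then have "2^2 \<le> (norm (x - p) / (r / 2))^2" by (intro power_mono) auto
    then show ?thesis unfolding eq by simp
  qed
  show "0 < shell r p x \<and> shell r p x < 1" if "norm (x - p) = 3 / 5 * r"
    unfolding eq that using r by (simp add: power2_eq_square)
qed

lemma shell_continuous: "continuous_on S (shell r p)"
  unfolding shell_def[abs_def] by (intro continuous_intros)

lemma shell_mass_integrand: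
  fixes p :: "real^'n::finite" and a :: real
  assumes r: "r > 0"
  defines "k \<equiv> \<lambda>x. 8 / r^2 * tent (shell r p x) * exp ((2 * a + 2) * log_radius p x)"
  shows "integrable lborel k" "shell_mass a r p > 0"
proof -
  define Z where "Z = cball p r - ball p (r / 2)"
  have Z: "compact Z" unfolding Z_def by (intro compact_diff) auto
  have pZ: "p \<notin> Z" using r by (simp add: Z_def)
  have cont: "continuous_on (- {p}) k" unfolding k_def
    by (intro continuous_intros continuous_on_compose2[OF tent_continuous shell_continuous] Ck_imp_continuous_on[OF Ck_log_radius]) auto
  have zero: "k x = 0" if "x \<notin> Z" for x
  proof -
    have "norm (x - p) \<le> r / 2 \<or> norm (x - p) \<ge> r"
      using that unfolding Z_def by (auto simp: dist_norm norm_minus_commute not_le)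
    then have "tent (shell r p x) = 0" using shell_bounds(1,2)[OF r, of x p] tent_values(1,2) by blast
    then show ?thesis by (simp add: k_def)
  qed
  have "integrable lborel (\<lambda>x. indicator Z x *\<^sub>R k x)"
    by (rule borel_integrable_compact[OF Z]) (use continuous_on_subset[OF cont] pZ in auto)
  moreover have "(\<lambda>x. indicator Z x *\<^sub>R k x) = k" using zero by (auto simp: indicator_def fun_eq_iff)
  ultimately show int: "integrable lborel k" by (simp only:)
  have nonneg: "k x \<ge> 0" for x unfolding k_def using tent_values(3) by simp
  have "shell_mass a r p \<ge> 0" unfolding shell_mass_def k_def[symmetric] using nonneg by (intro integral_nonneg_AE) auto
  moreover have "shell_mass a r p \<noteq> 0"
  proof
    assume "shell_mass a r p = 0"
    then have "integral\<^sup>L lborel k = 0" by (simp add: shell_mass_def k_def)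
    then have "AE x in lborel. k x = 0" using integral_nonneg_eq_0_iff_AE[OF int] nonneg by simp
    then obtain N where N: "{x\<in>space lborel. \<not> k x = 0} \<subseteq> N" "emeasure lborel N = 0" "N \<in> sets lborel"
      by (rule AE_E)
    \<comment> \<open>The integrand is positive on an open set, which is not empty since it contains points at distance \<open>3 r / 5\<close>.\<close>
    define U where "U = {x. 0 < shell r p x} \<inter> {x. shell r p x < 1}"
    have "open U" unfolding U_def
      by (intro open_Int open_Collect_less continuous_intros shell_continuous)
    obtain e :: "real^'n" where e: "norm e = 1" using norm_axis_1 by blast
    have "p + (3 / 5 * r) *\<^sub>R e \<in> U" unfolding U_def using shell_bounds(4)[OF r, of "p + (3 / 5 * r) *\<^sub>R e" p] e r by simp
    then have "\<not> negligible U" using open_not_negligible[OF \<open>open U\<close>] by blast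
    moreover have "U \<subseteq> N"
    proof
      fix x assume "x \<in> U"
      then have "tent (shell r p x) > 0" using tent_values(4) by (auto simp: U_def)
      then have "k x \<noteq> 0" unfolding k_def using r by simp
      then show "x \<in> N" using N(1) by auto
    qed
    moreover have "negligible N"
      using N(2,3) by (simp add: negligible_iff_null_sets null_sets_def null_sets_completionI)
    ultimately show False using negligible_subset by blast
  qed
  ultimately show "shell_mass a r p > 0" by simp
qed

lemma pd_sum:
  assumes "\<And>j. j \<in> I \<Longrightarrow> f j differentiable (at x)"
  shows "pd i (\<lambda>x. \<Sum>j\<in>I. f j x) x = (\<Sum>j\<in>I. pd i (f j) x)"
proof -
  obtain f' where f': "\<And>j. j \<in> I \<Longrightarrow> (f j has_derivative f' j) (at x)"
    using assms unfolding differentiable_def by metis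
  have "pd i (\<lambda>x. \<Sum>j\<in>I. f j x) x = (\<Sum>j\<in>I. f' j (axis i 1))"
    by (rule pd_eqI) (rule has_derivative_sum[OF f'])
  also have "\<dots> = (\<Sum>j\<in>I. pd i (f j) x)" by (intro sum.cong refl pd_eqI[OF f', symmetric])
  finally show ?thesis .
qed

text \<open>Equal to \<open>0\<close> near the points of \<open>P\<close> and to \<open>1\<close> away from them, provided that they are far apart.\<close>

definition hole_cutoff :: "real \<Rightarrow> (real^'n::finite) set \<Rightarrow> real^'n \<Rightarrow> real" where
  "hole_cutoff r P x = 1 - (\<Sum>p\<in>P. 1 - smooth_step (shell r p x))"

lemma Ck_hole_cutoff: "Ck 1 UNIV (hole_cutoff r P)"
proof -
  have "Ck 1 UNIV (\<lambda>x. smooth_step (shell r p x))" for p :: "real^'n::finite"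
  proof -
    have sh: "Ck 1 UNIV (shell r p)"
      unfolding shell_def[abs_def] by (intro Ck_diff Ck_cmult Ck_normsq Ck_const) auto
    have "Ck 1 UNIV (\<lambda>x. (if 0 = (0::nat) then smooth_step else tent) (shell r p x))"
      by (rule Ck_compose[OF open_UNIV sh, of "\<lambda>j. if j = 0 then smooth_step else tent"])
        (auto intro: smooth_step_deriv tent_continuous)
    then show ?thesis by simp
  qed
  then show ?thesis unfolding hole_cutoff_def[abs_def]
    by (intro Ck_diff Ck_sum Ck_const) auto
qed

lemma pd_hole_cutoff:
  fixes x :: "real^'n::finite"
  shows
  "pd i (hole_cutoff r P) x = (\<Sum>p\<in>P. tent (shell r p x) * (8 / r^2 * (x - p) $ i))"
proof -
  have dsh: "(shell r p has_derivative (\<lambda>v. 4 / r^2 * (2 * ((x - p) \<bullet> v)))) (at x)" for p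
  proof -
    have "((\<lambda>x. 4 / r^2 * (norm (x - p))^2 - 1) has_derivative (\<lambda>v. 4 / r^2 * (2 * ((x - p) \<bullet> v)) - 0)) (at x)"
      by (intro has_derivative_diff has_derivative_mult_right normsq_deriv has_derivative_const)
    then show ?thesis by (simp add: shell_def[abs_def])
  qed
  have sh: "shell r p differentiable (at x)" "pd i (shell r p) x = 8 / r^2 * (x - p) $ i" for p
    using dsh[of p] pd_eqI[OF dsh, of i p] by (auto simp: differentiable_def inner_axis simp del: vector_minus_component)
  note st = pd_chain[OF sh(1) smooth_step_deriv]
  have "pd i (hole_cutoff r P) x = 0 - pd i (\<lambda>x. \<Sum>p\<in>P. 1 - smooth_step (shell r p x)) x"
  proof -
    have "\<exists>D. \<forall>p. ((\<lambda>x. 1 - smooth_step (shell r p x)) has_derivative D p) (at x)"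
      using differentiable_diff[OF differentiable_const st(1)] unfolding differentiable_def by (intro choice) blast
    then obtain D where D: "\<And>p. ((\<lambda>x. 1 - smooth_step (shell r p x)) has_derivative D p) (at x)" by blast
    have "(\<lambda>x. \<Sum>p\<in>P. 1 - smooth_step (shell r p x)) differentiable (at x)"
      using has_derivative_sum[of P "\<lambda>p x. 1 - smooth_step (shell r p x)" D] D unfolding differentiable_def by blast
    then show ?thesis
      unfolding hole_cutoff_def[abs_def] using pd_eqI[OF has_derivative_const, of i 1 x] by (subst pd_diff) auto
  qed
  also have "pd i (\<lambda>x. \<Sum>p\<in>P. 1 - smooth_step (shell r p x)) x = (\<Sum>p\<in>P. pd i (\<lambda>x. 1 - smooth_step (shell r p x)) x)"
    by (rule pd_sum) (auto intro!: differentiable_diff st(1))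
  also have "\<dots> = (\<Sum>p\<in>P. - (tent (shell r p x) * (8 / r^2 * (x - p) $ i)))"
  proof (rule sum.cong[OF refl])
    fix p
    have "pd i (\<lambda>x. 1 - smooth_step (shell r p x)) x = pd i (\<lambda>x. 1) x - pd i (\<lambda>x. smooth_step (shell r p x)) x"
      by (rule pd_diff) (auto intro: st(1))
    then show "pd i (\<lambda>x. 1 - smooth_step (shell r p x)) x = - (tent (shell r p x) * (8 / r^2 * (x - p) $ i))"
      using st(2) sh(2) pd_eqI[OF has_derivative_const, of i 1 x] by simp
  qed
  finally show ?thesis by (simp add: sum_negf)
qed

lemma green_integrand_eq:
  "green_integrand u v w x = v x * laplacian (laplacian w) x - w x * laplacian (laplacian v) x"
  by (simp add: green_integrand_def jacobi_op_def Let_def algebra_simps)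

text \<open>The flux, cut off near the punctures, is a compactly supported vector field, so its divergence has integral
zero. Where the cut-off differs from \<open>1\<close> the flux itself is divergence free, hence the integral over
the perforated space equals minus the integral of the gradient of the cut-off against the flux. This
takes place in annuli, where the flux is explicit; no integration over spheres is needed.\<close>

theorem green_formula:
  fixes P :: "(real^'n::finite) set" and f g :: "real^'n \<Rightarrow> nat \<Rightarrow> real \<Rightarrow> real"
  assumes n: "real CARD('n) = 2 * a + 4" and A: "A = a^2 + (a + 2)^2"
    and P: "finite P" and r0: "r0 > 0" "disjoint_family_on (\<lambda>p. ball p (2 * r0)) P"
    and v: "Ck 4 (- P) v" and w: "Ck 4 (- P) w"
    and support: "\<And>x. norm x > R \<Longrightarrow> v x = 0" "\<And>x. norm x > R \<Longrightarrow> w x = 0"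
    and v_loc: "\<And>p x. p \<in> P \<Longrightarrow> x \<in> ball p r0 - {p} \<Longrightarrow> v x = twist a (f p) 0 (log_radius p x)"
    and w_loc: "\<And>p x. p \<in> P \<Longrightarrow> x \<in> ball p r0 - {p} \<Longrightarrow> w x = twist a (g p) 0 (log_radius p x)"
    and f: "\<And>p. p \<in> P \<Longrightarrow> tower (f p)" and g: "\<And>p. p \<in> P \<Longrightarrow> tower (g p)"
    and eq: "\<And>p t. p \<in> P \<Longrightarrow> f p 0 t * (g p 4 t - A * g p 2 t) = (f p 4 t - A * f p 2 t) * g p 0 t"
    and c: "\<And>p t. p \<in> P \<Longrightarrow> symplectic_pairing A (f p) (g p) t = c p"
  shows "r > 0 \<Longrightarrow> set_integrable lborel (perforated_space P r) (green_integrand u v w)"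
    "0 < r \<Longrightarrow> r < r0 \<Longrightarrow> green_integral P u v w r = (\<Sum>p\<in>P. c p * shell_mass a r0 p)"
proof -
  define gr where "gr x = v x * laplacian (laplacian w) x - w x * laplacian (laplacian v) x" for x
  have green: "green_integrand u v w = gr" by (simp add: fun_eq_iff green_integrand_eq gr_def)
  have oP: "open (- P)" using P by (simp add: finite_imp_closed open_Compl)
  have apart: "norm (x - q) \<ge> r0" if "p \<in> P" "q \<in> P" "p \<noteq> q" "x \<in> ball p r0" for p q x
  proof (rule ccontr)
    assume "\<not> norm (x - q) \<ge> r0"
    then have "x \<in> ball q (2 * r0)" using r0(1) by (simp add: dist_norm norm_minus_commute)
    moreover have "x \<in> ball p (2 * r0)" using that(4) r0(1) by simp
    ultimately show False using r0(2) that unfolding disjoint_family_on_def by blast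
  qed
  have cont: "continuous_on (- P) gr"
  proof -
    have v': "Ck (Suc (Suc 2)) (- P) v" "Ck (Suc (Suc 2)) (- P) w" using v w by (simp_all add: eval_nat_numeral)
    have "Ck 0 (- P) (laplacian (laplacian h))" if "Ck (Suc (Suc 2)) (- P) h" for h
    proof -
      have "Ck (Suc (Suc 0)) (- P) (laplacian h)" using Ck_laplacian[OF oP that] by (simp add: eval_nat_numeral)
      then show ?thesis by (rule Ck_laplacian[OF oP])
    qed
    then have "continuous_on (- P) (laplacian (laplacian v))" "continuous_on (- P) (laplacian (laplacian w))"
      using v' by auto
    then show ?thesis unfolding gr_def
      using Ck_imp_continuous_on[OF v] Ck_imp_continuous_on[OF w] by (intro continuous_intros)
  qed
  have integrable: "integrable lborel (\<lambda>x. indicator (perforated_space P r) x *\<^sub>R gr x)" if r: "r > 0" for r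
  proof -
    define Z where "Z = perforated_space P r \<inter> cball 0 R"
    have "closed (perforated_space P r)" unfolding perforated_space_def by (intro closed_Compl open_UN ballI open_ball)
    then have Z: "compact Z" unfolding Z_def by (intro closed_Int_compact compact_cball)
    have "Z \<subseteq> - P" unfolding Z_def perforated_space_def using r by force
    then have "integrable lborel (\<lambda>x. indicator Z x *\<^sub>R gr x)"
      by (intro borel_integrable_compact[OF Z] continuous_on_subset[OF cont])
    moreover have "(\<lambda>x. indicator Z x *\<^sub>R gr x) = (\<lambda>x. indicator (perforated_space P r) x *\<^sub>R gr x)"
      using support by (auto simp: Z_def indicator_def gr_def fun_eq_iff not_le)
    ultimately show ?thesis by (simp only:)
  qed
  then show "r > 0 \<Longrightarrow> set_integrable lborel (perforated_space P r) (green_integrand u v w)"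
    by (simp add: set_integrable_def green)
  assume r: "0 < r" "r < r0"
  define cut where "cut = hole_cutoff r0 P"
  define Y where "Y i x = cut x * flux v w i x" for i x
  define k where "k p x = 8 / r0^2 * tent (shell r0 p x) * exp ((2 * a + 2) * log_radius p x)" for p x :: "real^'n"
  have outside: "shell r0 q x \<ge> 1" if "p \<in> P" "q \<in> P" "p \<noteq> q" "x \<in> ball p r0" for p q x
    using shell_bounds(2)[OF r0(1)] apart[OF that] by blast
  have cut_near: "cut x = smooth_step (shell r0 p x)" if p: "p \<in> P" "x \<in> ball p r0" for p x
  proof -
    have "(\<Sum>q\<in>P. 1 - smooth_step (shell r0 q x)) = (\<Sum>q\<in>P. if q = p then 1 - smooth_step (shell r0 p x) else 0)"
      using outside[OF p(1) _ _ p(2)] smooth_step_values(2) by (intro sum.cong) auto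
    then show ?thesis using p P by (simp add: cut_def hole_cutoff_def)
  qed
  have flux1: "Ck 1 (- P) (flux v w i)" for i by (rule Ck_flux[OF oP v w])
  have Y: "Ck 1 UNIV (Y i)" for i
  proof -
    have "Ck 1 (- P) (Y i)" unfolding Y_def
      by (intro Ck_mult[OF oP] flux1 Ck_subset[OF Ck_hole_cutoff[of r0 P, folded cut_def]]) auto
    moreover have "Ck 1 (\<Union>p\<in>P. ball p (r0 / 2)) (Y i)"
    proof (rule Ck_cong[OF _ _ Ck_const[of _ _ 0]])
      show "open (\<Union>p\<in>P. ball p (r0 / 2))" by auto
      fix x assume "x \<in> (\<Union>p\<in>P. ball p (r0 / 2))"
      then obtain p where p: "p \<in> P" "x \<in> ball p (r0 / 2)" by auto
      have "shell r0 p x \<le> 0" using shell_bounds(1)[OF r0(1), of x p] p by (simp add: dist_norm norm_minus_commute)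
      then have "cut x = 0" using cut_near[of p x] p r0 smooth_step_values(1) by simp
      then show "0 = Y i x" by (simp add: Y_def)
    qed
    ultimately have "Ck 1 (- P \<union> (\<Union>p\<in>P. ball p (r0 / 2))) (Y i)" using oP by (intro Ck_Un) auto
    moreover have "- P \<union> (\<Union>p\<in>P. ball p (r0 / 2)) = UNIV" using r0(1) by auto
    ultimately show ?thesis by simp
  qed
  have Y0: "Y i x = 0" if "norm x > R" for i x
  proof -
    have op: "open {x::real^'n. norm x > R}" by (intro open_Collect_less continuous_intros)
    have p0: "pd i h x = 0" if "\<And>y. norm y > R \<Longrightarrow> h y = 0" for h :: "real^'n \<Rightarrow> real"
    proof -
      have "pd i h x = pd i (\<lambda>x. 0) x" by (rule pd_cong[OF op]) (use that \<open>norm x > R\<close> in auto)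
      then show ?thesis using pd_eqI[OF has_derivative_const, of i 0 x] by simp
    qed
    show ?thesis using support that p0[of v] p0[of w] by (simp add: Y_def flux_def)
  qed
  note int_Y = integral_pd_zero[OF Y Y0]
  have pointwise: "(\<Sum>i\<in>UNIV. pd i (Y i) x) = indicator (perforated_space P r) x *\<^sub>R gr x - (\<Sum>p\<in>P. c p * k p x)"
    if x: "x \<notin> P" for x
  proof -
    have dcut: "cut differentiable (at x)" using Ck_differentiable[OF Ck_hole_cutoff] unfolding cut_def by auto
    have dfl: "flux v w i differentiable (at x)" for i using Ck_differentiable[OF flux1] x by auto
    have "(\<Sum>i\<in>UNIV. pd i (Y i) x) = (\<Sum>i\<in>UNIV. cut x * pd i (flux v w i) x + pd i cut x * flux v w i x)"
      unfolding Y_def by (intro sum.cong refl pd_mult dcut dfl)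
    also have "\<dots> = cut x * gr x + (\<Sum>i\<in>UNIV. pd i cut x * flux v w i x)"
      using flux_divergence[OF oP v w, of x] x by (simp add: sum.distrib sum_distrib_left[symmetric] gr_def)
    finally have div: "(\<Sum>i\<in>UNIV. pd i (Y i) x) = cut x * gr x + (\<Sum>i\<in>UNIV. pd i cut x * flux v w i x)" .
    show ?thesis
    proof (cases "\<exists>p\<in>P. x \<in> ball p r0")
      case True
      then obtain p where p: "p \<in> P" "x \<in> ball p r0" by blast
      define L where "L = log_radius p x"
      have S: "open (ball p r0 - {p})" "x \<in> ball p r0 - {p}" "p \<notin> ball p r0 - {p}"
        using p x by (auto intro: open_Diff)
      have loc: "\<forall>y\<in>ball p r0 - {p}. v y = twist a (f p) 0 (log_radius p y)"
        "\<forall>y\<in>ball p r0 - {p}. w y = twist a (g p) 0 (log_radius p y)"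
        using v_loc[OF p(1)] w_loc[OF p(1)] by blast+
      note rf = radial_flux[OF n S loc(1) f[OF p(1)] loc(2) g[OF p(1)] A]
      have gr0: "gr x = 0" unfolding gr_def rf(2) using eq[OF p(1)] by simp
      have tq: "tent (shell r0 q x) = (if q = p then tent (shell r0 p x) else 0)" if "q \<in> P" for q
        using outside[OF p(1) that _ p(2)] tent_values(2) by auto
      have "pd i cut x = tent (shell r0 p x) * (8 / r0^2 * (x - p) $ i)" for i
      proof -
        have "pd i cut x = (\<Sum>q\<in>P. if q = p then tent (shell r0 p x) * (8 / r0^2 * (x - p) $ i) else 0)"
          unfolding cut_def pd_hole_cutoff by (intro sum.cong refl) (auto simp: tq)
        then show ?thesis using p P by simp
      qed
      then have "(\<Sum>i\<in>UNIV. pd i cut x * flux v w i x)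
          = (\<Sum>i\<in>UNIV. - (8 / r0^2 * tent (shell r0 p x) * exp ((2 * a + 2) * L) * c p * exp (2 * L)) * ((x - p) $ i)^2)"
        unfolding rf(1) c[OF p(1)] L_def by (intro sum.cong refl) (simp add: power2_eq_square)
      also have "\<dots> = - (8 / r0^2 * tent (shell r0 p x) * exp ((2 * a + 2) * L) * c p * exp (2 * L)) * (\<Sum>i\<in>UNIV. ((x - p) $ i)^2)"
        by (simp only: sum_distrib_left)
      also have "(\<Sum>i\<in>UNIV. ((x - p) $ i)^2) = (norm (x - p))^2"
        unfolding power2_norm_eq_inner inner_vec_def by (simp add: power2_eq_square)
      also have "- (8 / r0^2 * tent (shell r0 p x) * exp ((2 * a + 2) * L) * c p * exp (2 * L)) * (norm (x - p))^2
          = - (c p * k p x) * (exp (2 * L) * (norm (x - p))^2)" by (simp add: k_def L_def)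
      also have "exp (2 * L) * (norm (x - p))^2 = 1" unfolding L_def by (rule exp_log_radius) (use S in auto)
      finally have "(\<Sum>i\<in>UNIV. pd i cut x * flux v w i x) = - (c p * k p x)" by simp
      moreover have "(\<Sum>q\<in>P. c q * k q x) = (\<Sum>q\<in>P. if q = p then c p * k p x else 0)"
        by (intro sum.cong refl) (simp add: k_def tq)
      ultimately show ?thesis using div gr0 p P by simp
    next
      case False
      then have far: "shell r0 q x \<ge> 1" if "q \<in> P" for q
        using that shell_bounds(2)[OF r0(1), of x q] by (auto simp: dist_norm norm_minus_commute not_less)
      have "cut x = 1" using far smooth_step_values(2) by (simp add: cut_def hole_cutoff_def)
      moreover have "pd i cut x = 0" for i
        unfolding cut_def pd_hole_cutoff using far tent_values(2) by simp
      moreover have "(\<Sum>p\<in>P. c p * k p x) = 0" using far tent_values(2) by (simp add: k_def)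
      moreover have "x \<in> perforated_space P r" using False r by (force simp: perforated_space_def)
      ultimately show ?thesis using div by simp
    qed
  qed
  have k: "integrable lborel (k p)" "integral\<^sup>L lborel (k p) = shell_mass a r0 p" for p
    using shell_mass_integrand(1)[OF r0(1), of p a] by (simp_all add: k_def[abs_def] shell_mass_def)
  have "0 = (\<integral>x. (\<Sum>i\<in>UNIV. pd i (Y i) x) \<partial>lborel)"
    using int_Y by (simp add: Bochner_Integration.integral_sum)
  also have "\<dots> = (\<integral>x. indicator (perforated_space P r) x *\<^sub>R gr x - (\<Sum>p\<in>P. c p * k p x) \<partial>lborel)"
  proof (rule integral_cong_AE)
    show "(\<lambda>x. \<Sum>i\<in>UNIV. pd i (Y i) x) \<in> borel_measurable lborel"
      using int_Y(1) by (intro borel_measurable_sum) auto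
    show "(\<lambda>x. indicator (perforated_space P r) x *\<^sub>R gr x - (\<Sum>p\<in>P. c p * k p x)) \<in> borel_measurable lborel"
      using integrable[OF r(1)] k(1) by (intro borel_measurable_diff borel_measurable_sum borel_measurable_times) auto
    have "AE x in lborel. x \<notin> P" by (rule AE_not_in) (rule finite_imp_null_set_lborel[OF P])
    then show "AE x in lborel. (\<Sum>i\<in>UNIV. pd i (Y i) x)
        = indicator (perforated_space P r) x *\<^sub>R gr x - (\<Sum>p\<in>P. c p * k p x)"
      by (rule AE_mp) (use pointwise in auto)
  qed
  also have "\<dots> = (\<integral>x. indicator (perforated_space P r) x *\<^sub>R gr x \<partial>lborel) - (\<Sum>p\<in>P. c p * shell_mass a r0 p)"
    using integrable[OF r(1)] k by (simp add: Bochner_Integration.integral_diff Bochner_Integration.integral_sum)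
  finally show "green_integral P u v w r = (\<Sum>p\<in>P. c p * shell_mass a r0 p)"
    by (simp add: green_integral_def set_lebesgue_integral_def green)
qed

section \<open>Symplectic linear algebra, punctures and geometric Jacobi fields\<close>

text \<open>Since \<open>\<omega>\<close> is given by a nondegenerate matrix in the coefficients, a combination that is zero as
a vector has zero coefficients. Thus the generators are linearly independent as well.\<close>

lemma symplectic_form_of_weights:
  fixes e1 e2 :: "'i \<Rightarrow> 'v::real_vector" and \<omega> :: "'v \<Rightarrow> 'v \<Rightarrow> real" and k :: "'i \<Rightarrow> real"
  defines "combo \<equiv> \<lambda>P c d. \<Sum>p\<in>P. c p *\<^sub>R e1 p + d p *\<^sub>R e2 p"
  assumes P: "finite P" and k: "\<forall>p\<in>P. k p \<noteq> 0"
    and \<omega>: "\<And>c d c' d'. \<omega> (combo P c d) (combo P c' d') = (\<Sum>p\<in>P. (c p * d' p - d p * c' p) * k p)"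
  shows "span (e1 ` P \<union> e2 ` P) = {combo P c d | c d. True}"
    "dim (span (e1 ` P \<union> e2 ` P)) = 2 * card P"
    "symplectic_form_on (span (e1 ` P \<union> e2 ` P)) \<omega>"
proof -
  define \<delta> where "\<delta> p q = (if q = p then 1 else 0 :: real)" for p q :: 'i
  have lin: "a *\<^sub>R combo P c d + b *\<^sub>R combo P c' d' = combo P (\<lambda>p. a * c p + b * c' p) (\<lambda>p. a * d p + b * d' p)" for a b c d c' d'
    unfolding combo_def by (simp add: scaleR_sum_right sum.distrib[symmetric] algebra_simps)
  have e1: "e1 p = combo P (\<delta> p) (\<lambda>_. 0)" and e2: "e2 p = combo P (\<lambda>_. 0) (\<delta> p)" if "p \<in> P" for p
  proof -
    have "combo P (\<delta> p) (\<lambda>_. 0) = (\<Sum>q\<in>P. if q = p then e1 p else 0)"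
      "combo P (\<lambda>_. 0) (\<delta> p) = (\<Sum>q\<in>P. if q = p then e2 p else 0)"
      unfolding combo_def \<delta>_def by (auto intro!: sum.cong)
    then show "e1 p = combo P (\<delta> p) (\<lambda>_. 0)" "e2 p = combo P (\<lambda>_. 0) (\<delta> p)" using that P by simp_all
  qed
  have zero: "combo P (\<lambda>_. 0) (\<lambda>_. 0) = 0" by (simp add: combo_def)
  show span: "span (e1 ` P \<union> e2 ` P) = {combo P c d | c d. True}"
  proof
    have "subspace {combo P c d | c d. True}"
    proof (rule subspaceI)
      show "0 \<in> {combo P c d | c d. True}" using zero[symmetric] by blast
      fix x y a assume "x \<in> {combo P c d | c d. True}"
      then obtain c d where x: "x = combo P c d" by blast
      show "a *\<^sub>R x \<in> {combo P c d | c d. True}"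
        using lin[of a c d 0 c d] unfolding x by auto
      assume "y \<in> {combo P c d | c d. True}"
      then obtain c' d' where y: "y = combo P c' d'" by blast
      show "x + y \<in> {combo P c d | c d. True}"
        using lin[of 1 c d 1 c' d'] unfolding x y by auto
    qed
    moreover have "e1 ` P \<union> e2 ` P \<subseteq> {combo P c d | c d. True}" using e1 e2 by blast
    ultimately show "span (e1 ` P \<union> e2 ` P) \<subseteq> {combo P c d | c d. True}" by (simp add: span_minimal)
    show "{combo P c d | c d. True} \<subseteq> span (e1 ` P \<union> e2 ` P)"
    proof clarify
      fix c d
      have "c p *\<^sub>R e1 p + d p *\<^sub>R e2 p \<in> span (e1 ` P \<union> e2 ` P)" if "p \<in> P" for p
        using that by (intro span_add[OF span_scale[OF span_base] span_scale[OF span_base]]) auto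
      then show "combo P c d \<in> span (e1 ` P \<union> e2 ` P)" unfolding combo_def by (rule span_sum)
    qed
  qed
  have nondegenerate: "c p = 0 \<and> d p = 0"
    if z: "\<And>c' d'. \<omega> (combo P c d) (combo P c' d') = 0" and p: "p \<in> P" for c d p
  proof -
    have "(\<Sum>q\<in>P. (c q * \<delta> p q - d q * 0) * k q) = (\<Sum>q\<in>P. if q = p then c p * k p else 0)"
      "(\<Sum>q\<in>P. (c q * 0 - d q * \<delta> p q) * k q) = (\<Sum>q\<in>P. if q = p then - d p * k p else 0)"
      unfolding \<delta>_def by (auto intro!: sum.cong)
    then have "c p * k p = 0" "- d p * k p = 0"
      using z[of "\<lambda>_. 0" "\<delta> p"] z[of "\<delta> p" "\<lambda>_. 0"] p P unfolding \<omega> by simp_all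
    then show ?thesis using k p by simp
  qed
  have unique: "c p = 0 \<and> d p = 0" if z: "combo P c d = 0" and p: "p \<in> P" for c d p
  proof (rule nondegenerate[OF _ p])
    show "\<omega> (combo P c d) (combo P c' d') = 0" for c' d'
      unfolding z zero[symmetric] unfolding \<omega> by simp
  qed
  have diff: "combo P c d - combo P c' d' = combo P (\<lambda>p. c p - c' p) (\<lambda>p. d p - d' p)" for c d c' d'
    using lin[of 1 c d "- 1" c' d'] by simp
  have same: "c p = c' p \<and> d p = d' p" if "combo P c d = combo P c' d'" "p \<in> P" for c d c' d' p
    using unique[of "\<lambda>p. c p - c' p" "\<lambda>p. d p - d' p" p] diff[of c d c' d'] that by simp
  have inj: "inj_on e1 P" "inj_on e2 P"
  proof -
    show "inj_on e1 P"
    proof (rule inj_onI)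
      fix p q assume pq: "p \<in> P" "q \<in> P" "e1 p = e1 q"
      then have "combo P (\<delta> p) (\<lambda>_. 0) = combo P (\<delta> q) (\<lambda>_. 0)" using e1 by simp
      from same[OF this pq(1)] show "p = q" by (auto simp: \<delta>_def split: if_splits)
    qed
    show "inj_on e2 P"
    proof (rule inj_onI)
      fix p q assume pq: "p \<in> P" "q \<in> P" "e2 p = e2 q"
      then have "combo P (\<lambda>_. 0) (\<delta> p) = combo P (\<lambda>_. 0) (\<delta> q)" using e2 by simp
      from same[OF this pq(1)] show "p = q" by (auto simp: \<delta>_def split: if_splits)
    qed
  qed
  have disj: "e1 ` P \<inter> e2 ` P = {}"
  proof (rule ccontr)
    assume "e1 ` P \<inter> e2 ` P \<noteq> {}"
    then obtain p q where pq: "p \<in> P" "q \<in> P" "e1 p = e2 q" by auto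
    then have "combo P (\<delta> p) (\<lambda>_. 0) = combo P (\<lambda>_. 0) (\<delta> q)" using e1 e2 by simp
    from same[OF this pq(1)] show False by (simp add: \<delta>_def)
  qed
  have "independent (e1 ` P \<union> e2 ` P)"
  proof (rule independent_if_scalars_zero)
    show "finite (e1 ` P \<union> e2 ` P)" using P by simp
    fix f x assume z: "(\<Sum>x\<in>e1 ` P \<union> e2 ` P. f x *\<^sub>R x) = 0" and x: "x \<in> e1 ` P \<union> e2 ` P"
    have "(\<Sum>x\<in>e1 ` P \<union> e2 ` P. f x *\<^sub>R x) = (\<Sum>x\<in>e1 ` P. f x *\<^sub>R x) + (\<Sum>x\<in>e2 ` P. f x *\<^sub>R x)"
      using P disj by (intro sum.union_disjoint) auto
    also have "\<dots> = combo P (\<lambda>p. f (e1 p)) (\<lambda>p. f (e2 p))"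
      by (simp only: sum.reindex[OF inj(1)] sum.reindex[OF inj(2)] combo_def sum.distrib o_def)
    finally have "combo P (\<lambda>p. f (e1 p)) (\<lambda>p. f (e2 p)) = 0" using z by simp
    from unique[OF this] show "f x = 0" using x by blast
  qed
  then show "dim (span (e1 ` P \<union> e2 ` P)) = 2 * card P"
    using P disj inj by (simp add: dim_eq_card_independent card_Un_disjoint card_image)
  have elem: "\<exists>c d. x = combo P c d" if "x \<in> span (e1 ` P \<union> e2 ` P)" for x
    using that unfolding span by blast
  show "symplectic_form_on (span (e1 ` P \<union> e2 ` P)) \<omega>"
    unfolding symplectic_form_on_def
  proof (intro conjI ballI allI impI)
    show "subspace (span (e1 ` P \<union> e2 ` P))" by (rule subspace_span)
    fix x assume x: "x \<in> span (e1 ` P \<union> e2 ` P)"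
    obtain c d where cd: "x = combo P c d" using elem[OF x] by blast
    show "\<omega> x x = 0" unfolding cd \<omega> by (simp add: mult.commute)
    show "x = 0" if "\<forall>y\<in>span (e1 ` P \<union> e2 ` P). \<omega> x y = 0"
    proof -
      have "\<omega> (combo P c d) (combo P c' d') = 0" for c' d' using that cd span by blast
      then have "c p = 0 \<and> d p = 0" if "p \<in> P" for p using nondegenerate that by blast
      then show ?thesis unfolding cd combo_def by simp
    qed
    fix y z a b assume y: "y \<in> span (e1 ` P \<union> e2 ` P)" and z: "z \<in> span (e1 ` P \<union> e2 ` P)"
    obtain c1 d1 where 1: "y = combo P c1 d1" using elem[OF y] by blast
    obtain c2 d2 where 2: "z = combo P c2 d2" using elem[OF z] by blast
    show "\<omega> (a *\<^sub>R x + b *\<^sub>R y) z = a * \<omega> x z + b * \<omega> y z"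
      unfolding cd 1 2 lin \<omega> sum_distrib_left sum.distrib[symmetric]
      by (intro sum.cong refl) (simp add: algebra_simps)
    show "\<omega> z (a *\<^sub>R x + b *\<^sub>R y) = a * \<omega> z x + b * \<omega> z y"
      unfolding cd 1 2 lin \<omega> sum_distrib_left sum.distrib[symmetric]
      by (intro sum.cong refl) (simp add: algebra_simps)
  qed
qed

text \<open>The height over the equator determines \<open>|x|\<close>, and then the horizontal part determines \<open>J x\<close>; the isometry
\<open>J\<close> maps onto the equatorial hyperplane by counting dimensions.\<close>

lemma stereographic_bij:
  fixes N :: "('n::finite) ambient" and J :: "real^'n \<Rightarrow> 'n ambient"
  assumes "stereo_frame N J"
  shows "bij_betw (inv_stereo N J) UNIV (unit_sphere - {N})"
proof -
  have N: "norm N = 1" and J: "linear J" and iso: "\<And>x. norm (J x) = norm x" and orth: "\<And>x. J x \<bullet> N = 0"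
    using assms by (auto simp: stereo_frame_def)
  have NN: "N \<bullet> N = 1" using N by (simp add: dot_square_norm)
  have orth': "N \<bullet> J x = 0" for x using orth[of x] by (simp add: inner_commute)
  have pos: "1 + (norm x)^2 > 0" for x :: "real^'n" by (simp add: add_pos_nonneg)
  have height: "inv_stereo N J x \<bullet> N = 1 - 2 / (1 + (norm x)^2)" for x
    unfolding inv_stereo_def inner_scaleR_left inner_add_left orth NN using pos[of x] by (simp add: field_simps)
  have injJ: "J x = J y \<Longrightarrow> x = y" for x y
  proof -
    assume "J x = J y"
    then have "norm (J (x - y)) = 0" using J by (simp add: linear_diff)
    then show "x = y" using iso by simp
  qed
  have inj: "inj (inv_stereo N J)"
  proof (rule injI)
    fix x y assume eq: "inv_stereo N J x = inv_stereo N J y"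
    then have "2 / (1 + (norm x)^2) = 2 / (1 + (norm y)^2)" using height[of x] height[of y] by simp
    then have n: "(norm x)^2 = (norm y)^2" using pos[of x] pos[of y] by (simp add: field_simps)
    then have "J x = J y" using eq pos[of y] by (simp add: inv_stereo_def)
    then show "x = y" by (rule injJ)
  qed
  have hyper: "range J = {y. N \<bullet> y = 0}"
  proof (rule subspace_dim_equal)
    show "subspace (range J)" using J by (simp add: linear_subspace_image)
    show "subspace {y. N \<bullet> y = 0}" by (rule subspace_hyperplane)
    show "range J \<subseteq> {y. N \<bullet> y = 0}" using orth' by auto
    have "dim (range J) = dim (UNIV :: (real^'n) set)"
      by (rule dim_image_eq[OF J]) (use injJ in \<open>auto simp: inj_on_def\<close>)
    moreover have "dim {y. N \<bullet> y = 0} = DIM((real^'n) \<times> real) - 1"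
      by (rule dim_hyperplane) (use N in auto)
    ultimately show "dim {y. N \<bullet> y = 0} \<le> dim (range J)" by simp
  qed
  have into: "inv_stereo N J x \<in> unit_sphere - {N}" for x
  proof -
    define R where "R = (norm x)^2"
    have R: "1 + R > 0" using pos[of x] by (simp add: R_def)
    have "(2 *\<^sub>R J x + (R - 1) *\<^sub>R N) \<bullet> (2 *\<^sub>R J x + (R - 1) *\<^sub>R N) = 4 * (J x \<bullet> J x) + (R - 1)^2"
      by (simp add: inner_add_left inner_add_right orth orth' NN power2_eq_square)
    also have "J x \<bullet> J x = R" by (simp add: R_def dot_square_norm iso)
    also have "4 * R + (R - 1)^2 = (1 + R)^2" by (simp add: power2_eq_square algebra_simps)
    finally have "norm (2 *\<^sub>R J x + (R - 1) *\<^sub>R N) = 1 + R"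
      using R by (simp add: norm_eq_sqrt_inner)
    then have "norm (inv_stereo N J x) = 1" using R by (simp add: inv_stereo_def R_def)
    moreover have "inv_stereo N J x \<noteq> N" using height[of x] NN pos[of x] by auto
    ultimately show ?thesis by simp
  qed
  have onto: "q \<in> range (inv_stereo N J)" if q: "norm q = 1" "q \<noteq> N" for q
  proof -
    define s where "s = q \<bullet> N"
    have qq: "q \<bullet> q = 1" using q by (simp add: dot_square_norm)
    have sN: "N \<bullet> q = s" by (simp add: s_def inner_commute)
    have "0 < (q - N) \<bullet> (q - N)" using q by simp
    then have s: "s < 1" by (simp add: inner_diff_left inner_diff_right qq NN sN s_def[symmetric])
    have "q - s *\<^sub>R N \<in> {y. N \<bullet> y = 0}" by (simp add: inner_diff_right sN NN)
    then obtain z where z: "J z = q - s *\<^sub>R N" unfolding hyper[symmetric] by force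
    define x where "x = (1 / (1 - s)) *\<^sub>R z"
    have "(norm z)^2 = (q - s *\<^sub>R N) \<bullet> (q - s *\<^sub>R N)" using iso[of z] z by (simp add: dot_square_norm)
    also have "\<dots> = (1 - s) * (1 + s)"
      by (simp add: inner_diff_left inner_diff_right qq NN sN s_def[symmetric] algebra_simps)
    finally have nz: "(norm z)^2 = (1 - s) * (1 + s)" .
    have nx: "(norm x)^2 = (1 + s) / (1 - s)"
      using s nz by (simp add: x_def power_mult_distrib power2_eq_square[of "1 - s"] power_divide)
    have Jx: "J x = (1 / (1 - s)) *\<^sub>R (q - s *\<^sub>R N)" unfolding x_def using J z by (simp add: linear_scale)
    have c1: "1 / (1 + (norm x)^2) = (1 - s) / 2" and c2: "(norm x)^2 - 1 = 2 * s / (1 - s)"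
      unfolding nx using s by (simp_all add: field_simps)
    have "inv_stereo N J x = ((1 - s) / 2) *\<^sub>R (2 *\<^sub>R (1 / (1 - s)) *\<^sub>R (q - s *\<^sub>R N) + (2 * s / (1 - s)) *\<^sub>R N)"
      unfolding inv_stereo_def c1 c2 Jx ..
    also have "\<dots> = ((1 - s) / 2 * (2 * (1 / (1 - s)))) *\<^sub>R (q - s *\<^sub>R N) + ((1 - s) / 2 * (2 * s / (1 - s))) *\<^sub>R N"
      by (simp only: scaleR_add_right scaleR_scaleR mult.assoc)
    also have "(1 - s) / 2 * (2 * (1 / (1 - s))) = 1" using s by (simp add: field_simps)
    also have "(1 - s) / 2 * (2 * s / (1 - s)) = s" using s by (simp add: field_simps)
    also have "1 *\<^sub>R (q - s *\<^sub>R N) + s *\<^sub>R N = q" by simp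
    finally show ?thesis by (metis rangeI)
  qed
  have sup: "unit_sphere - {N} \<subseteq> range (inv_stereo N J)"
  proof
    fix q assume "q \<in> unit_sphere - {N}"
    then have sph: "q \<in> unit_sphere" and ne: "q \<noteq> N" by blast+
    from sph have "norm q = 1" by (rule mem_sphere_0[THEN iffD1])
    then show "q \<in> range (inv_stereo N J)" using ne by (rule onto)
  qed
  have "range (inv_stereo N J) \<subseteq> unit_sphere - {N}" by (rule image_subsetI) (rule into)
  then have range: "range (inv_stereo N J) = unit_sphere - {N}" using sup by (rule subset_antisym)
  show ?thesis using inj range by (simp add: bij_betw_def)
qed

lemma card_vimage_stereographic:
  assumes "stereo_frame N J" "\<Lambda> \<subseteq> unit_sphere" "N \<notin> \<Lambda>" "finite \<Lambda>"
  shows "finite (inv_stereo N J -` \<Lambda>)" "card (inv_stereo N J -` \<Lambda>) = card \<Lambda>"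
proof -
  have inj: "inj (inv_stereo N J)" and range: "range (inv_stereo N J) = unit_sphere - {N}"
    using stereographic_bij[OF assms(1)] by (auto simp: bij_betw_def)
  show "finite (inv_stereo N J -` \<Lambda>)" by (rule finite_vimageI[OF assms(4) inj])
  show "card (inv_stereo N J -` \<Lambda>) = card \<Lambda>"
    by (rule card_vimage_inj[OF inj]) (use range assms in auto)
qed

text \<open>The coefficients of the Delaunay equation factor with \<open>la = a\<^sup>2\<close> and \<open>lb = (a + 2)\<^sup>2\<close>.\<close>

lemma delaunay_family_powers:
  fixes V :: "real \<Rightarrow> real \<Rightarrow> real" and d :: nat
  assumes d: "d \<ge> 5" and V: "\<forall>e\<in>{0<..eps_bar d}. delaunay_solution d e (V e)"
  defines "a \<equiv> (real d - 4) / 2"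
  shows "delaunay_family (a^2 + (a + 2)^2) (a^2 * (a + 2)^2) (real d * (real d - 4) * ((real d)^2 - 4) / 16)
    ((real d + 4) / (real d - 4)) (a^2) ((a + 2)^2) (eps_bar d) (\<lambda>e i. (deriv ^^ i) (V e))"
proof -
  define n where "n = real d"
  have n: "n \<ge> 5" using d by (simp add: n_def)
  have n2: "n^2 > 4"
  proof -
    have "5^2 \<le> n^2" using n by (intro power_mono) auto
    then show ?thesis by simp
  qed
  have a: "a = (n - 4) / 2" by (simp add: a_def n_def)
  have A: "(n * (n - 4) + 8) / 2 = a^2 + (a + 2)^2" by (simp add: a power2_eq_square field_simps)
  have B: "n^2 * (n - 4)^2 / 16 = a^2 * (a + 2)^2" by (simp add: a power2_eq_square field_simps)
  interpret fourth_order_ode "a^2 + (a + 2)^2" "a^2 * (a + 2)^2" "n * (n - 4) * (n^2 - 4) / 16"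
    "(n + 4) / (n - 4)" "a^2" "(a + 2)^2"
  proof unfold_locales
    show "0 < n * (n - 4) * (n^2 - 4) / 16" using n n2 by simp
    show "1 < (n + 4) / (n - 4)" using n by (simp add: less_divide_eq)
    have "a > 0" using n by (simp add: a)
    then show "0 < a^2" "0 < (a + 2)^2" by simp_all
  qed simp_all
  have eb: "eps_bar d = (n * (n - 4) / (n^2 - 4)) powr ((n - 4) / 8)" by (simp add: eps_bar_def n_def)
  interpret delaunay_ode "a^2 + (a + 2)^2" "a^2 * (a + 2)^2" "n * (n - 4) * (n^2 - 4) / 16"
    "(n + 4) / (n - 4)" "a^2" "(a + 2)^2" "eps_bar d"
  proof unfold_locales
    show "eps_bar d > 0" unfolding eb using n n2 by simp
    have ex: "(n + 4) / (n - 4) - 1 = 8 / (n - 4)" using n by (simp add: field_simps)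
    have "eps_bar d powr ((n + 4) / (n - 4) - 1) = n * (n - 4) / (n^2 - 4)"
    proof -
      have "(n - 4) / 8 * (8 / (n - 4)) = 1" using n by simp
      then show ?thesis unfolding ex eb powr_powr
        using n n2 by (simp only:) simp
    qed
    note power = this
    have "x * y / 16 * (x / y) = x * x / 16" if "y \<noteq> 0" for x y :: real using that by simp
    from this[of "n^2 - 4" "n * (n - 4)"]
    show "n * (n - 4) * (n^2 - 4) / 16 * eps_bar d powr ((n + 4) / (n - 4) - 1) = a^2 * (a + 2)^2"
      unfolding B[symmetric] power using n2 by (simp add: power2_eq_square ac_simps)
  qed
  show ?thesis unfolding n_def[symmetric]
  proof unfold_locales
    fix e assume e: "0 < e" "e < eps_bar d"
    then have sol: "delaunay_solution d e (V e)" using V by auto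
    have tow: "tower (\<lambda>i. (deriv ^^ i) (V e))"
      using sol unfolding tower_def delaunay_solution_def Let_def
      by (auto simp: DERIV_deriv_iff_real_differentiable)
    have ode: "(deriv ^^ 4) (V e) t - (n * (n - 4) + 8) / 2 * (deriv ^^ 2) (V e) t + n^2 * (n - 4)^2 / 16 * V e t
        - n * (n - 4) * (n^2 - 4) / 16 * V e t powr ((n + 4) / (n - 4)) = 0" for t
      using sol unfolding delaunay_solution_def Let_def n_def by blast
    have "solution (\<lambda>i. (deriv ^^ i) (V e))"
      unfolding solution_def
    proof (intro conjI allI tow)
      show "0 \<le> (deriv ^^ 0) (V e) t" for t
        using sol unfolding delaunay_solution_def Let_def by (simp add: less_imp_le)
      show "(deriv ^^ 4) (V e) t = (a^2 + (a + 2)^2) * (deriv ^^ 2) (V e) t - a^2 * (a + 2)^2 * (deriv ^^ 0) (V e) t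
          + n * (n - 4) * (n^2 - 4) / 16 * (deriv ^^ 0) (V e) t powr ((n + 4) / (n - 4))" for t
        using ode[of t] unfolding A B by simp
    qed
    then show "delaunay e (\<lambda>i. (deriv ^^ i) (V e))"
      using sol e unfolding delaunay_def delaunay_solution_def Let_def by simp
  qed
qed

lemma mu_pos:
  assumes "d \<ge> 5" shows "mu d > 0"
proof -
  define n where "n = real d"
  have n: "n \<ge> 5" using assms by (simp add: n_def)
  have "0 < 8 * n^2 * (n - 4)" using n by simp
  then have "(n^2 - 4 * n + 8)^2 < n^4 - 64 * n + 64"
    by (simp add: power2_eq_square power4_eq_xxxx algebra_simps)
  then have "n^2 - 4 * n + 8 < sqrt (n^4 - 64 * n + 64)" by (rule real_less_rsqrt)
  then show ?thesis by (simp add: mu_def n_def[symmetric])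
qed

text \<open>The two geometric fields solve the same linear equation and pair to a nonzero constant. On the cylinder this
constant is \<open>2 m\<^sup>3 + A m\<close> with \<open>m = sqrt \<mu>\<close>.\<close>

lemma geometric_jacobi_fields:
  fixes V :: "real \<Rightarrow> real \<Rightarrow> real" and d :: nat
  assumes d: "d \<ge> 5" and V: "\<forall>e\<in>{0<..eps_bar d}. delaunay_solution d e (V e)"
    and e: "e \<in> {0<..eps_bar d}"
  defines "A \<equiv> ((real d - 4) / 2)^2 + ((real d - 4) / 2 + 2)^2"
  shows "\<exists>F G q \<kappa>. tower F \<and> tower G \<and> F 0 = w0_plus d V e \<and> G 0 = w0_minus d V e \<and>
    continuous_on UNIV (F 4) \<and> continuous_on UNIV (G 4) \<and>
    (\<forall>t. F 4 t - A * F 2 t = q t * F 0 t) \<and> (\<forall>t. G 4 t - A * G 2 t = q t * G 0 t) \<and>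
    \<kappa> \<noteq> 0 \<and> (\<forall>t. symplectic_pairing A F G t = \<kappa>)"
proof (cases "e = eps_bar d")
  case True
  define m where "m = sqrt (mu d)"
  have m: "m > 0" using mu_pos[OF d] by (simp add: m_def)
  define F where "F i t = (if i = 0 then sin (m * t) else if i = 1 then m * cos (m * t)
    else if i = 2 then - (m^2) * sin (m * t) else if i = 3 then - (m^3) * cos (m * t) else m^4 * sin (m * t))" for i :: nat and t
  define G where "G i t = (if i = 0 then cos (m * t) else if i = 1 then - m * sin (m * t)
    else if i = 2 then - (m^2) * cos (m * t) else if i = 3 then m^3 * sin (m * t) else m^4 * cos (m * t))" for i :: nat and t
  have F: "tower F" by (rule towerI)
      (auto intro!: derivative_eq_intros simp: F_def[abs_def] power2_eq_square power3_eq_cube power4_eq_xxxx)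
  have G: "tower G" by (rule towerI)
      (auto intro!: derivative_eq_intros simp: G_def[abs_def] power2_eq_square power3_eq_cube power4_eq_xxxx)
  have "A \<ge> 0" by (simp add: A_def)
  then have nz: "2 * m^3 + A * m \<noteq> 0" using m by (simp add: add_pos_nonneg less_imp_neq[symmetric])
  have pair: "symplectic_pairing A F G t = 2 * m^3 + A * m" for t
  proof -
    have "symplectic_pairing A F G t = (2 * m^3 + A * m) * (sin (m * t))^2 + (2 * m^3 + A * m) * (cos (m * t))^2"
      by (simp add: symplectic_pairing_def F_def G_def power2_eq_square power3_eq_cube algebra_simps)
    also have "\<dots> = (2 * m^3 + A * m) * ((sin (m * t))^2 + (cos (m * t))^2)" by (simp only: distrib_left)
    finally show ?thesis by simp
  qed
  have "F 0 = w0_plus d V e" "G 0 = w0_minus d V e"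
    using True by (auto simp: F_def G_def w0_plus_def w0_minus_def m_def fun_eq_iff)
  moreover have "continuous_on UNIV (F 4)" "continuous_on UNIV (G 4)"
    by (auto simp: F_def[abs_def] G_def[abs_def] intro!: continuous_intros)
  moreover have "F 4 t - A * F 2 t = (m^4 + A * m^2) * F 0 t" "G 4 t - A * G 2 t = (m^4 + A * m^2) * G 0 t" for t
    by (simp_all add: F_def G_def algebra_simps)
  ultimately show ?thesis using F G nz pair
    by (intro exI[of _ F] exI[of _ G] exI[of _ "\<lambda>_. m^4 + A * m^2"] exI[of _ "2 * m^3 + A * m"]) simp
next
  case False
  then have e: "0 < e" "e < eps_bar d" using e by auto
  define a where "a = (real d - 4) / 2"
  interpret delaunay_family "a^2 + (a + 2)^2" "a^2 * (a + 2)^2" "real d * (real d - 4) * ((real d)^2 - 4) / 16"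
    "(real d + 4) / (real d - 4)" "a^2" "(a + 2)^2" "eps_bar d" "\<lambda>e i. (deriv ^^ i) (V e)"
    using delaunay_family_powers[OF d V] by (simp add: a_def)
  define v where "v = (\<lambda>i. (deriv ^^ i) (V e))"
  have v: "delaunay e v" unfolding v_def by (rule family[OF e])
  obtain f where f: "necksize_field e f" "\<And>t. ((\<lambda>e. (deriv ^^ 0) (V e) t) has_real_derivative f 0 t) (at e)"
    using necksize_derivative[OF e] by blast
  define g where "g = translation_field v"
  define q where "q = linearized_potential v"
  have gj: "jacobi q g" unfolding g_def q_def by (rule translation_field_jacobi[OF v])
  have fj: "jacobi q f" using f(1) by (simp add: necksize_field_def q_def v_def)
  have A: "A = a^2 + (a + 2)^2" by (simp add: A_def a_def)
  have pair: "symplectic_pairing A g f t = symplectic_pairing A g f 0" for t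
    unfolding A by (rule symplectic_pairing_constant[OF gj fj])
  have nz: "symplectic_pairing A g f 0 \<noteq> 0"
    unfolding A g_def v_def by (rule symplectic_pairing_nonzero[OF e f(1)])
  have "g 0 t = w0_plus d V e t" for t
    using False by (simp add: g_def translation_field_def w0_plus_def v_def)
  then have g0: "g 0 = w0_plus d V e" by auto
  have "deriv (\<lambda>e. V e t) e = f 0 t" for t using DERIV_imp_deriv[OF f(2)[of t]] by simp
  then have f0: "f 0 = w0_minus d V e" using False by (auto simp: w0_minus_def)
  have qc: "continuous_on UNIV q"
    unfolding q_def linearized_potential_def[abs_def]
    using tower_continuous[OF delaunay_tower[OF v], of 0] delaunay_pos[OF v]
    by (intro continuous_intros continuous_on_powr) (auto simp: less_imp_neq[symmetric])
  have eq: "h 4 = (\<lambda>t. A * h 2 t - a^2 * (a + 2)^2 * h 0 t + q t * h 0 t)" "tower h" if "jacobi q h" for h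
    using that unfolding jacobi_def A by auto
  have cont: "continuous_on UNIV (h 4)" if h: "jacobi q h" for h
    unfolding eq(1)[OF h] by (intro continuous_intros qc tower_continuous[OF eq(2)[OF h]]) auto
  have op: "h 4 t - A * h 2 t = (q t - a^2 * (a + 2)^2) * h 0 t" if h: "jacobi q h" for h t
    unfolding eq(1)[OF h] by (simp add: algebra_simps)
  show ?thesis
    using g0 f0 nz pair cont[OF gj] cont[OF fj] op[OF gj] op[OF fj] eq(2)[OF gj] eq(2)[OF fj]
    by (intro exI[of _ g] exI[of _ f] exI[of _ "\<lambda>t. q t - a^2 * (a + 2)^2"] exI[of _ "symplectic_pairing A g f 0"]) blast
qed

section \<open>The deficiency space\<close>

definition deficiency_field ::
  "(real^'n::finite \<Rightarrow> real) \<Rightarrow> (real^'n \<Rightarrow> real \<Rightarrow> real) \<Rightarrow> (real^'n \<Rightarrow> real) \<Rightarrow> (real^'n) set \<Rightarrow> real^'n \<Rightarrow> real" where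
  "deficiency_field \<eta> w T P x = (\<Sum>p\<in>P. local_field \<eta> p (w p) (T p) x)"

lemma twist_0: "twist a f 0 t = exp (a * t) * f 0 t"
  by (simp add: twist_def)

lemma local_field_eq:
  fixes p :: "real^'n::finite"
  assumes "x \<noteq> p"
  shows "local_field \<eta> p w T x = \<eta> (x - p) * (exp ((real CARD('n) - 4) / 2 * log_radius p x) * w (log_radius p x + T))"
  using assms by (simp add: local_field_def emden_fowler_inv_def log_radius_def powr_def field_simps)

lemma Ck_local_field:
  fixes p :: "real^'n::finite"
  assumes \<eta>: "smooth_on UNIV \<eta>" and f: "tower f" and cont: "continuous_on UNIV (f 4)"
  shows "Ck 4 (- {p}) (local_field \<eta> p (f 0) T)"
proof -
  define a where "a = (real CARD('n) - 4) / 2"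
  define g where "g = (\<lambda>i t. f i (t + T))"
  have g: "tower g" unfolding g_def by (rule tower_translate[OF f])
  have "Ck 4 (- {p}) (\<lambda>x. twist a g 0 (log_radius p x))"
  proof (rule Ck_compose[OF open_punctured Ck_log_radius])
    show "(twist a g j has_real_derivative twist a g (Suc j) t) (at t)" if "j < 4" for j t
      using twist_tower[OF g, of a] that unfolding tower_def by blast
    have g4: "continuous_on UNIV (g 4)" unfolding g_def
      by (rule continuous_on_compose2[OF cont]) (auto intro!: continuous_intros)
    have "continuous_on UNIV (\<lambda>t. exp (a * t) * (g 4 t + 4 * a * g 3 t + 6 * a^2 * g 2 t + 4 * a^3 * g 1 t + a^4 * g 0 t))"
      by (intro continuous_intros g4 tower_continuous[OF g]) auto
    then show "continuous_on UNIV (twist a g 4)" by (simp add: twist_def[abs_def])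
  qed
  moreover have "Ck 4 (- {p}) (\<lambda>x. \<eta> (x - p))"
    by (rule Ck_subset[OF Ck_shift[OF smooth_imp_Ck[OF \<eta>]]]) simp
  ultimately have "Ck 4 (- {p}) (\<lambda>x. \<eta> (x - p) * twist a g 0 (log_radius p x))"
    by (intro Ck_mult open_punctured)
  then show ?thesis
    by (rule Ck_cong[OF open_punctured, rotated]) (simp add: local_field_eq twist_0 a_def g_def)
qed

lemma deficiency_field_local:
  fixes P :: "(real^'n::finite) set"
  assumes \<eta>: "cutoff r0 \<eta>" and r0: "r0 > 0" "disjoint_family_on (\<lambda>p. ball p (2 * r0)) P"
    and P: "finite P" and p: "p \<in> P" and x: "x \<in> ball p r0 - {p}"
  shows "deficiency_field \<eta> (\<lambda>p. f p 0) T P x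
    = twist ((real CARD('n) - 4) / 2) (\<lambda>i t. f p i (t + T p)) 0 (log_radius p x)"
proof -
  have other: "local_field \<eta> q (f q 0) (T q) x = 0" if q: "q \<in> P" "q \<noteq> p" for q
  proof -
    have "x \<in> ball p (2 * r0)" using x r0(1) by auto
    then have "x \<notin> ball q (2 * r0)" using r0(2) p q unfolding disjoint_family_on_def by blast
    then have "norm (x - q) > 3 * r0 / 2" using r0(1) by (simp add: dist_norm norm_minus_commute)
    then have "\<eta> (x - q) = 0" using \<eta> by (simp add: cutoff_def)
    then show ?thesis by (simp add: local_field_def)
  qed
  have "deficiency_field \<eta> (\<lambda>p. f p 0) T P x = (\<Sum>q\<in>P. if q = p then local_field \<eta> p (f p 0) (T p) x else 0)"
    unfolding deficiency_field_def using other by (intro sum.cong) auto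
  also have "\<dots> = local_field \<eta> p (f p 0) (T p) x" using p P by simp
  also have "\<eta> (x - p) = 1" using \<eta> x by (simp add: cutoff_def dist_norm norm_minus_commute)
  then have "local_field \<eta> p (f p 0) (T p) x
      = twist ((real CARD('n) - 4) / 2) (\<lambda>i t. f p i (t + T p)) 0 (log_radius p x)"
    using x by (simp add: local_field_eq twist_0)
  finally show ?thesis .
qed

lemma deficiency_field_support:
  assumes \<eta>: "cutoff r0 \<eta>" and r0: "r0 > 0" and P: "finite P"
    and x: "norm x > (\<Sum>p\<in>P. norm p) + 2 * r0"
  shows "deficiency_field \<eta> w T P x = 0"
  unfolding deficiency_field_def
proof (rule sum.neutral, rule ballI)
  fix p assume p: "p \<in> P"
  have "norm p \<le> (\<Sum>p\<in>P. norm p)" using P p by (intro member_le_sum) auto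
  moreover have "norm x - norm p \<le> norm (x - p)" by (rule norm_triangle_ineq2)
  ultimately have "norm (x - p) > 3 * r0 / 2" using x r0 by linarith
  then have "\<eta> (x - p) = 0" using \<eta> by (simp add: cutoff_def)
  then show "local_field \<eta> p (w p) (T p) x = 0" by (simp add: local_field_def)
qed

lemma symplectic_pairing_lincomb:
  "symplectic_pairing A (\<lambda>i t. c * F i t + d * G i t) (\<lambda>i t. c' * F i t + d' * G i t) t
    = (c * d' - d * c') * symplectic_pairing A F G t"
  by (simp add: symplectic_pairing_def algebra_simps)

lemma sum_fun_apply: "(\<Sum>i\<in>I. f i) x = (\<Sum>i\<in>I. f i x)"
  by (induction I rule: infinite_finite_induct) auto

theorem theorem16:
  fixes \<Lambda> :: "('n::finite) ambient set" and g :: "'n tensor2" and k :: nat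
    and N :: "'n ambient" and J :: "real^'n \<Rightarrow> 'n ambient"
    and P :: "(real^'n) set" and u :: "real^'n \<Rightarrow> real"
    and V :: "real \<Rightarrow> real \<Rightarrow> real" and \<epsilon> T :: "real^'n \<Rightarrow> real"
    and r0 :: real and \<eta> :: "real^'n \<Rightarrow> real"
  assumes dimension: "CARD('n) \<ge> 5"
    and punctures: "\<Lambda> \<subseteq> unit_sphere" "finite \<Lambda>" "card \<Lambda> = k"
    and conformal: "conformal_to_round (unit_sphere - \<Lambda>) g"
    and complete: "complete_metric_on (unit_sphere - \<Lambda>) g"
    and Q_const: "const_Q_curvature (unit_sphere - \<Lambda>) g
                    (real CARD('n) * ((real CARD('n))^2 - 4) / 8)"
    and projection: "stereo_frame N J" "N \<notin> \<Lambda>"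
    and P_def: "P = inv_stereo N J -` \<Lambda>"
    and u_pos: "\<forall>x\<in>- P. u x > 0"
    and u_factor: "\<forall>x\<in>- P. \<forall>X Y. pullback (inv_stereo N J) g x X Y
                     = u x powr (4 / (real CARD('n) - 4)) * (X \<bullet> Y)"
    and delaunay: "\<forall>e\<in>{0<..eps_bar CARD('n)}. delaunay_solution CARD('n) e (V e)"
    and necksizes: "\<forall>p\<in>P. \<epsilon> p \<in> {0<..eps_bar CARD('n)}"
    and asymptotics: "\<forall>p\<in>P. asymptotic_to u p (V (\<epsilon> p)) (T p)"
    and radius: "r0 > 0" "disjoint_family_on (\<lambda>p. ball p (2 * r0)) P"
    and cutoff: "cutoff r0 \<eta>"
  shows "dim (deficiency_space V P \<epsilon> T \<eta>) = 2 * k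
    \<and> (\<forall>v\<in>deficiency_space V P \<epsilon> T \<eta>. \<forall>w\<in>deficiency_space V P \<epsilon> T \<eta>.
         (\<forall>r>0. set_integrable lborel (perforated_space P r) (green_integrand u v w))
         \<and> (green_integral P u v w \<longlongrightarrow> omega_form P u v w) (at_right 0))
    \<and> symplectic_form_on (deficiency_space V P \<epsilon> T \<eta>) (omega_form P u)"
proof -
  define a where "a = (real CARD('n) - 4) / 2"
  define A where "A = a^2 + (a + 2)^2"
  have n: "real CARD('n) = 2 * a + 4" by (simp add: a_def field_simps)
  have P: "finite P" "card P = k"
    using card_vimage_stereographic[OF projection(1) punctures(1) projection(2) punctures(2)] punctures(3)
    by (simp_all add: P_def)
  have "\<forall>p\<in>P. \<exists>F G q \<kappa>. tower F \<and> tower G \<and> F 0 = w0_plus CARD('n) V (\<epsilon> p) \<and> G 0 = w0_minus CARD('n) V (\<epsilon> p) \<and>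
    continuous_on UNIV (F 4) \<and> continuous_on UNIV (G 4) \<and>
    (\<forall>t. F 4 t - A * F 2 t = q t * F 0 t) \<and> (\<forall>t. G 4 t - A * G 2 t = q t * G 0 t) \<and>
    \<kappa> \<noteq> 0 \<and> (\<forall>t. symplectic_pairing A F G t = \<kappa>)"
    using geometric_jacobi_fields[OF dimension delaunay] necksizes unfolding A_def a_def by blast
  then obtain F G q \<kappa> where
    tow: "\<And>p. p \<in> P \<Longrightarrow> tower (F p)" "\<And>p. p \<in> P \<Longrightarrow> tower (G p)" and
    F0: "\<And>p. p \<in> P \<Longrightarrow> F p 0 = w0_plus CARD('n) V (\<epsilon> p)" and
    G0: "\<And>p. p \<in> P \<Longrightarrow> G p 0 = w0_minus CARD('n) V (\<epsilon> p)" and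
    cont: "\<And>p. p \<in> P \<Longrightarrow> continuous_on UNIV (F p 4)" "\<And>p. p \<in> P \<Longrightarrow> continuous_on UNIV (G p 4)" and
    F4: "\<And>p t. p \<in> P \<Longrightarrow> F p 4 t - A * F p 2 t = q p t * F p 0 t" and
    G4: "\<And>p t. p \<in> P \<Longrightarrow> G p 4 t - A * G p 2 t = q p t * G p 0 t" and
    \<kappa>: "\<And>p. p \<in> P \<Longrightarrow> \<kappa> p \<noteq> 0" "\<And>p t. p \<in> P \<Longrightarrow> symplectic_pairing A (F p) (G p) t = \<kappa> p"
    unfolding bchoice_iff by blast
  define e1 where "e1 p = local_field \<eta> p (w0_plus CARD('n) V (\<epsilon> p)) (T p)" for p
  define e2 where "e2 p = local_field \<eta> p (w0_minus CARD('n) V (\<epsilon> p)) (T p)" for p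
  define combo where "combo P c d = (\<Sum>p\<in>P. c p *\<^sub>R e1 p + d p *\<^sub>R e2 p)" for P c d
  define H where "H c d p = (\<lambda>i t. c p * F p i t + d p * G p i t)" for c d :: "real^'n \<Rightarrow> real" and p
  define Hs where "Hs c d p = (\<lambda>i t. H c d p i (t + T p))" for c d p
  have space: "deficiency_space V P \<epsilon> T \<eta> = span (e1 ` P \<union> e2 ` P)"
    by (simp add: deficiency_space_def e1_def[abs_def] e2_def[abs_def])
  have combo_eq: "combo P c d = deficiency_field \<eta> (\<lambda>p. H c d p 0) T P" for c d
  proof
    fix x
    have "c p * e1 p x + d p * e2 p x = local_field \<eta> p (H c d p 0) (T p) x" if p: "p \<in> P" for p
      unfolding e1_def e2_def F0[OF p, symmetric] G0[OF p, symmetric] H_def local_field_def emden_fowler_inv_def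
      by (simp add: algebra_simps)
    then show "combo P c d x = deficiency_field \<eta> (\<lambda>p. H c d p 0) T P x"
      unfolding combo_def deficiency_field_def sum_fun_apply by (simp add: scaleR_fun_def)
  qed
  have Ht: "tower (H c d p)" "continuous_on UNIV (H c d p 4)" if p: "p \<in> P" for c d p
    unfolding H_def using tower_lincomb[OF tow[OF p]] cont[OF p] by (auto intro!: continuous_intros)
  have oP: "open (- P)" using P(1) by (simp add: finite_imp_closed open_Compl)
  have smooth: "Ck 4 (- P) (combo P c d)" for c d
    unfolding combo_eq deficiency_field_def[abs_def]
  proof (rule Ck_sum[OF oP])
    fix p assume p: "p \<in> P"
    have "Ck 4 (- {p}) (local_field \<eta> p (H c d p 0) (T p))"
      using cutoff by (intro Ck_local_field Ht[OF p]) (simp add: cutoff_def)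
    then show "Ck 4 (- P) (local_field \<eta> p (H c d p 0) (T p))" by (rule Ck_subset) (use p in auto)
  qed
  have supp: "combo P c d x = 0" if "norm x > (\<Sum>p\<in>P. norm p) + 2 * r0" for c d x
    unfolding combo_eq by (rule deficiency_field_support[OF cutoff radius(1) P(1) that])
  have loc: "combo P c d x = twist a (Hs c d p) 0 (log_radius p x)" if "p \<in> P" "x \<in> ball p r0 - {p}" for c d p x
    unfolding combo_eq a_def Hs_def by (rule deficiency_field_local[OF cutoff radius P(1) that])
  have Hst: "tower (Hs c d p)" if "p \<in> P" for c d p
    unfolding Hs_def by (rule tower_translate[OF Ht(1)[OF that]])
  have op: "H c d p 4 t - A * H c d p 2 t = q p t * H c d p 0 t" if "p \<in> P" for c d p t
  proof -
    have "H c d p 4 t - A * H c d p 2 t = c p * (F p 4 t - A * F p 2 t) + d p * (G p 4 t - A * G p 2 t)"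
      by (simp add: H_def algebra_simps)
    then show ?thesis unfolding F4[OF that] G4[OF that] by (simp add: H_def algebra_simps)
  qed
  have eq: "Hs c d p 0 t * (Hs c' d' p 4 t - A * Hs c' d' p 2 t) = (Hs c d p 4 t - A * Hs c d p 2 t) * Hs c' d' p 0 t"
    if "p \<in> P" for c d c' d' p t
    unfolding Hs_def op[OF that] by (simp add: algebra_simps)
  have pair: "symplectic_pairing A (Hs c d p) (Hs c' d' p) t = (c p * d' p - d p * c' p) * \<kappa> p"
    if "p \<in> P" for c d c' d' p t
  proof -
    have "symplectic_pairing A (Hs c d p) (Hs c' d' p) t = symplectic_pairing A (H c d p) (H c' d' p) (t + T p)"
      by (simp add: symplectic_pairing_def Hs_def)
    then show ?thesis unfolding H_def symplectic_pairing_lincomb \<kappa>(2)[OF that] .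
  qed
  have integrable: "set_integrable lborel (perforated_space P r) (green_integrand u (combo P c d) (combo P c' d'))"
    if "r > 0" for r c d c' d'
    by (rule green_formula(1)[where f = "Hs c d" and g = "Hs c' d'" and c = "\<lambda>p. (c p * d' p - d p * c' p) * \<kappa> p"
          and R = "(\<Sum>p\<in>P. norm p) + 2 * r0"])
      (rule n A_def P(1) radius smooth supp loc Hst eq pair that | assumption)+
  define w where "w p = \<kappa> p * shell_mass a r0 p" for p
  have green_value: "green_integral P u (combo P c d) (combo P c' d') r = (\<Sum>p\<in>P. (c p * d' p - d p * c' p) * w p)"
    if "0 < r" "r < r0" for r c d c' d'
  proof -
    have "green_integral P u (combo P c d) (combo P c' d') r
        = (\<Sum>p\<in>P. (c p * d' p - d p * c' p) * \<kappa> p * shell_mass a r0 p)"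
      by (rule green_formula(2)[where f = "Hs c d" and g = "Hs c' d'" and c = "\<lambda>p. (c p * d' p - d p * c' p) * \<kappa> p"
          and R = "(\<Sum>p\<in>P. norm p) + 2 * r0"])
        (rule n A_def P(1) radius smooth supp loc Hst eq pair that | assumption)+
    then show ?thesis by (simp add: w_def mult.assoc)
  qed
  have lim: "(green_integral P u (combo P c d) (combo P c' d') \<longlongrightarrow> (\<Sum>p\<in>P. (c p * d' p - d p * c' p) * w p)) (at_right 0)" for c d c' d'
  proof (rule tendsto_eventually)
    have "\<forall>\<^sub>F r in at_right 0. 0 < r \<and> r < r0"
      using radius(1) by (intro eventually_conj eventually_at_right_less eventually_at_right_real[THEN eventually_mono]) auto
    then show "\<forall>\<^sub>F r in at_right 0. green_integral P u (combo P c d) (combo P c' d') r = (\<Sum>p\<in>P. (c p * d' p - d p * c' p) * w p)"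
      by (rule eventually_mono) (use green_value in blast)
  qed
  have omega: "omega_form P u (combo P c d) (combo P c' d') = (\<Sum>p\<in>P. (c p * d' p - d p * c' p) * w p)" for c d c' d'
    unfolding omega_form_def by (rule tendsto_Lim[OF trivial_limit_at_right_real lim])
  have w: "\<forall>p\<in>P. w p \<noteq> 0"
  proof
    fix p assume "p \<in> P"
    then show "w p \<noteq> 0"
      using \<kappa>(1) shell_mass_integrand(2)[OF radius(1), of a p] by (simp add: w_def)
  qed
  note S = symplectic_form_of_weights[of P w "omega_form P u" e1 e2, folded combo_def, OF P(1) w omega]
  have "set_integrable lborel (perforated_space P r) (green_integrand u v v')"
    "(green_integral P u v v' \<longlongrightarrow> omega_form P u v v') (at_right 0)"
    if v: "v \<in> deficiency_space V P \<epsilon> T \<eta>" "v' \<in> deficiency_space V P \<epsilon> T \<eta>" and r: "r > 0" for v v' and r :: real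
  proof -
    obtain c d where 1: "v = combo P c d" using v(1) unfolding space S(1) by blast
    obtain c' d' where 2: "v' = combo P c' d'" using v(2) unfolding space S(1) by blast
    show "set_integrable lborel (perforated_space P r) (green_integrand u v v')"
      unfolding 1 2 by (rule integrable[OF r])
    show "(green_integral P u v v' \<longlongrightarrow> omega_form P u v v') (at_right 0)"
      unfolding 1 2 omega by (rule lim)
  qed
  note facts = this
  have "(\<forall>v\<in>deficiency_space V P \<epsilon> T \<eta>. \<forall>w\<in>deficiency_space V P \<epsilon> T \<eta>.
         (\<forall>r>0. set_integrable lborel (perforated_space P r) (green_integrand u v w))
         \<and> (green_integral P u v w \<longlongrightarrow> omega_form P u v w) (at_right 0))"
    using facts(1) facts(2)[OF _ _ zero_less_one] by blast
  moreover have "dim (deficiency_space V P \<epsilon> T \<eta>) = 2 * k" using S(2) by (simp add: space P(2))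
  moreover have "symplectic_form_on (deficiency_space V P \<epsilon> T \<eta>) (omega_form P u)" using S(3) by (simp add: space)
  ultimately show ?thesis by blast
qed

end
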